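(* Let $g_{\mu\nu}=\eta_{\mu\nu}+\varkappa h_{\mu\nu}$ and assume $|\varkappa|\max_{\lambda\in\mathrm{EW}(h)}|\lambda|<1$, where $\mathrm{EW}(h)$ is the set of eigenvalues of $h$. For $k\in\{1,\dots,10\}$, the graviton-matter $n$-point vertex Feynman rule for (effective) Quantum General Relativity coupled to the matter-model Lagrange density ${}_k\mathcal{L}$ of type $k$ (all listed in the context) is $${}_k\mathfrak{M}_n^{\mu_1\nu_1|\cdots|\mu_n\nu_n}(p_1,\dots,p_n)=\frac{\mathrm i}{2^n}\sum_{\mu_i\leftrightarrow\nu_i}\sum_{s\in S_n}{}_k\mathfrak{m}_n^{\mu_{s(1)}\nu_{s(1)}|\cdots|\mu_{s(n)}\nu_{s(n)}}(p_{s(1)},\dots,p_{s(n)}),$$ where $\sum_{\mu_i\leftrightarrow\nu_i}$ runs over the $2^n$ choices of exchanging or not exchanging $\mu_i,\nu_i$ for each $i$, and, with the building blocks $\mathfrak{h}_J,\mathfrak{h}'_J,\mathfrak{v}_J,\boldsymbol\Gamma^{(i)}$ defined in the context: $$\begin{aligned} {}_1\mathfrak{m}_n&={}_1\widehat T\;\mathfrak{v}_{\{1,\dots,n\}},\\ {}_2\mathfrak{m}_n&={}_2\widehat T_{\mu\nu}\sum_{m_1+m_2=n}(-1)^{m_1}\,\mathfrak{h}^{\mu\nu}_{J_1}\,\mathfrak{v}_{J_2},\\ {}_3\mathfrak{m}_n&={}_3\widehat T_{\mu\nu\rho\sigma}\sum_{m_1+m_2+m_3=n}(-1)^{m_1+m_2}\,\mathfrak{h}^{\mu\nu}_{J_1}\mathfrak{h}^{\rho\sigma}_{J_2}\,\mathfrak{v}_{J_3},\\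 {}_4\mathfrak{m}_n&={}_4\widehat T_\rho\,\boldsymbol\Gamma^{(1)}_{\mu\nu\sigma}\sum_{m_1+m_2+m_3=n-1}(-1)^{m_1+m_2}\,\mathfrak{h}^{\mu\nu}_{J_1}\mathfrak{h}^{\rho\sigma}_{J_2}\,\mathfrak{v}_{J_3},\\ {}_5\mathfrak{m}_n&={}_5\widehat T_{\rho\sigma\kappa}\,\boldsymbol\Gamma^{(1)}_{\mu\nu\lambda}\sum_{m_1+\dots+m_4=n-1}(-1)^{m_1+m_2+m_3}\,\mathfrak{h}^{\mu\nu}_{J_1}\mathfrak{h}^{\rho\sigma}_{J_2}\mathfrak{h}^{\kappa\lambda}_{J_3}\,\mathfrak{v}_{J_4},\\ {}_6\mathfrak{m}_n&={}_6\widehat T_{\kappa\iota}\,\boldsymbol\Gamma^{(1)}_{\mu\nu\lambda}\boldsymbol\Gamma^{(2)}_{\rho\sigma\tau}\sum_{m_1+\dots+m_5=n-2}(-1)^{m_1+m_2+m_3+m_4}\,\mathfrak{h}^{\mu\nu}_{J_1}\mathfrak{h}^{\rho\sigma}_{J_2}\mathfrak{h}^{\kappa\lambda}_{J_3}\mathfrak{h}^{\iota\tau}_{J_4}\,\mathfrak{v}_{J_5},\\ {}_7\mathfrak{m}_n&={}_7\widehat T_o\sum_{m_1+m_2=n}\tbinom{1/2}{m_1}\,\eta_{0\upsilon}\mathfrak{h}^{\upsilon o}_{J_1}\,\mathfrak{v}_{J_2},\\ {}_8\mathfrak{m}_n&={}_8\widehat T_{o\rho r}\sum_{m_1+m_2+m_3=n}\tbinom{1/2}{m_1}\tbinom{-1/2}{m_2}\,\eta_{0\upsilon}\mathfrak{h}^{\upsilon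 o}_{J_1}\mathfrak{h}^{\rho r}_{J_2}\,\mathfrak{v}_{J_3},\\ {}_9\mathfrak{m}_n&={}_9\widehat T_{orst}\sum_{m_1+\dots+m_5=n}\tbinom{1/2}{m_1}\tbinom{-1/2}{m_2}\tbinom{-1/2}{m_3}\tbinom{1/2}{m_4}\,\eta_{0\upsilon}\mathfrak{h}^{\upsilon o}_{J_1}\mathfrak{h}^{\rho r}_{J_2}\mathfrak{h}^{\sigma s}_{J_3}\,\eta_{\sigma\tau}(\mathfrak{h}'_{J_4})_\rho^{\tau t}\,\mathfrak{v}_{J_5},\\ {}_{10}\mathfrak{m}_n&={}_{10}\widehat T_{orst}\,\boldsymbol\Gamma^{(1)}_{\rho\sigma\tau}\sum_{m_1+\dots+m_5=n-1}\tbinom{1/2}{m_1}\tbinom{-1/2}{m_2}\tbinom{-1/2}{m_3}\tbinom{-1/2}{m_4}\,\eta_{0\upsilon}\mathfrak{h}^{\upsilon o}_{J_1}\mathfrak{h}^{\rho r}_{J_2}\mathfrak{h}^{\sigma s}_{J_3}\mathfrak{h}^{\tau t}_{J_4}\,\mathfrak{v}_{J_5}. \end{aligned}$$ In each sum the $m_a$ are non-negative integers and $J_1,J_2,\dots$ are the consecutive blocks, of sizes $m_1,m_2,\dots$ and in this order, into which $\{1,\dots,n\}$ (types 2, 3, 7, 8, 9), respectively $\{2,\dots,n\}$ (types 4, 5, 10), respectively $\{3,\dots,n\}$ (type 6), is divided.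
   Context: Setting: four-dimensional background Minkowski spacetime with $\eta=\mathrm{diag}(1,-1,-1,-1)$, all indices run over $0,\dots,3$, repeated indices are summed. $\varkappa$ is the gravitational coupling constant, $h$ a symmetric tensor field (the graviton field), $g^{\mu\nu}$ the inverse metric, $\Gamma_{\mu\nu\rho}=\frac12(\partial_\mu g_{\nu\rho}+\partial_\nu g_{\rho\mu}-\partial_\rho g_{\mu\nu})$, $\Gamma_{\mu\nu}{}^{\rho}=g^{\rho\sigma}\Gamma_{\mu\nu\sigma}$. With $(h^0)^{\mu\nu}=\eta^{\mu\nu}$, $(h^k)^{\mu\nu}=$ the $k$-fold product of $h$ with indices raised by $\eta$, the vielbein is $e_\mu^m=\sum_k\varkappa^k\binom{1/2}{k}\eta_{\mu\nu}(h^k)^{\nu m}$ and the inverse vielbein (flat index raised) is $e^{\mu m}=\sum_k\varkappa^k\binom{-1/2}{k}(h^k)^{\mu m}$. $\mathrm i$ is the imaginary unit. Matter-model Lagrange densities, with tensors ${}_kT$ that are the graviton-free matter contributions (they do not depend on $h$ and are treated as inert; ${}_k\widehat T$ denotes the Fourier transform): ${}_1\mathcal{L}={}_1T\sqrt{-\det g}$; ${}_2\mathcal{L}=g^{\mu\nu}\,{}_2T_{\mu\nu}\sqrt{-\det g}$; ${}_3\mathcal{L}=g^{\mu\nu}g^{\rho\sigma}\,{}_3T_{\mu\nu\rho\sigma}\sqrt{-\det g}$; ${}_4\mathcal{L}=g^{\mu\nu}\Gamma_{\mu\nu}{}^\tau\,{}_4T_\tau\sqrt{-\det g}$; ${}_5\mathcal{L}=g^{\mu\nu}g^{\rho\sigma}\Gamma_{\mu\nu}{}^\tau\,{}_5T_{\rho\sigma\tau}\sqrt{-\det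 g}$; ${}_6\mathcal{L}=g^{\mu\nu}g^{\rho\sigma}\Gamma_{\mu\nu}{}^\kappa\Gamma_{\rho\sigma}{}^\lambda\,{}_6T_{\kappa\lambda}\sqrt{-\det g}$; ${}_7\mathcal{L}=e_0^o\,{}_7T_o\sqrt{-\det g}$; ${}_8\mathcal{L}=e_0^oe^{\rho r}\,{}_8T_{o\rho r}\sqrt{-\det g}$; ${}_9\mathcal{L}=e_0^oe^{\rho r}e^{\sigma s}(\partial_\rho e_\sigma^t)\,{}_9T_{orst}\sqrt{-\det g}$; ${}_{10}\mathcal{L}=e_0^oe^{\rho r}e^{\sigma s}e_\tau^t\Gamma_{\rho\sigma}{}^\tau\,{}_{10}T_{orst}\sqrt{-\det g}$. Definition of the rule: only gravitons are counted as external particles, with incoming momenta $p_1,\dots,p_n$. ${}_k\mathfrak M_n$ is $\mathrm i$ times the $n$-fold symmetrized functional derivative, with respect to the Fourier transformed graviton fields $\hat h_{\mu_1\nu_1},\dots,\hat h_{\mu_n\nu_n}$, of the Fourier transform of the order-$\varkappa^n$ part of ${}_k\mathcal L$, symmetrized to $n$ distinguishable gravitons. A derivative acting on graviton $i$ is represented by its momentum, $\partial_\rho\mapsto p^{(i)}_\rho$ (the convention used is $\widehat\Gamma_{\mu\nu\rho}=\frac\varkappa2(p_\mu\hat h_{\nu\rho}+p_\nu\hat h_{\rho\mu}-p_\rho\hat h_{\mu\nu})$, without a factor $\mathrm i$ per derivative), and $\frac{\bar\delta}{\bar\delta\hat h_{\mu_i\nu_i}}(p_\kappa\hat h_{\rho\sigma})=\frac12p^{(i)}_\kappa(\delta_\rho^{\mu_i}\delta_\sigma^{\nu_i}+\delta_\sigma^{\mu_i}\delta_\rho^{\nu_i})$.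 Building blocks, for a block $J=\{a+1,\dots,a+m\}$ of consecutive integers: $\mathfrak{h}^{\alpha\beta}_J=\varkappa^m\eta^{\alpha\nu_{a+1}}\eta^{\mu_{a+1}\nu_{a+2}}\cdots\eta^{\mu_{a+m-1}\nu_{a+m}}\eta^{\mu_{a+m}\beta}$, and $\mathfrak{h}^{\alpha\beta}_\emptyset=\eta^{\alpha\beta}$; $(\mathfrak{h}'_J)^{\alpha\beta}_\rho=\big(\sum_{i\in J}p^{(i)}_\rho\big)\mathfrak{h}^{\alpha\beta}_J$ (zero for $J=\emptyset$); $\boldsymbol\Gamma^{(i)}_{\mu\nu\rho}=\frac{\varkappa}{4}\big(p^{(i)}_\mu(\delta_\rho^{\mu_i}\delta_\nu^{\nu_i}+\delta_\nu^{\mu_i}\delta_\rho^{\nu_i})+p^{(i)}_\nu(\delta_\mu^{\mu_i}\delta_\rho^{\nu_i}+\delta_\rho^{\mu_i}\delta_\mu^{\nu_i})-p^{(i)}_\rho(\delta_\mu^{\mu_i}\delta_\nu^{\nu_i}+\delta_\nu^{\mu_i}\delta_\mu^{\nu_i})\big)$; and $$\begin{aligned}\mathfrak{v}_J=\varkappa^m&\sum_{\substack{i+j+k+l=m\\ i\ge j\ge k\ge l\ge0}}\sum_{p=0}^{j-k}\sum_{q=0}^{k-l}\sum_{r=0}^{q}\sum_{s=0}^{l}\sum_{t=0}^{s}\sum_{u=0}^{t}\sum_{v=0}^{u}\tbinom{1/2}{i}\tbinom ij\tbinom jk\tbinom kl\tbinom{j-k}{p}\tbinom{k-l}{q}\tbinom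 qr\tbinom ls\tbinom st\tbinom tu\tbinom uv\\&\times(-1)^{p+q-r+s-t+v}\,2^{-j+l+r+s+2t-3u+v}\,3^{-k+q-r+s-t+u}\;E,\end{aligned}$$ where, with $A=i+j+k+l-2p-2q-r-2s-t-u$, $B=p+q-r+s-t+2u-2v$, $C=r+t-u$, $D=v$ (so $A+2B+3C+4D=m$), and writing $\mu_{[x]}=\mu_{a+x}$, $\nu_{[x]}=\nu_{a+x}$, $$\begin{aligned}E=&\prod_{x=1}^{A}\eta^{\mu_{[x]}\nu_{[x]}}\prod_{x=A+1}^{A+B}\eta^{\mu_{[x]}\mu_{[x+B]}}\eta^{\nu_{[x]}\nu_{[x+B]}}\prod_{x=A+2B+1}^{A+2B+C}\eta^{\mu_{[x]}\nu_{[x+C]}}\eta^{\mu_{[x+C]}\nu_{[x+2C]}}\eta^{\mu_{[x+2C]}\nu_{[x]}}\\&\times\prod_{x=A+2B+3C+1}^{A+2B+3C+D}\eta^{\mu_{[x]}\nu_{[x+D]}}\eta^{\mu_{[x+D]}\nu_{[x+2D]}}\eta^{\mu_{[x+2D]}\nu_{[x+3D]}}\eta^{\mu_{[x+3D]}\nu_{[x]}}.\end{aligned}$$ (In $\mathfrak v_J$ the letters $i,j,k,l,p,q,r,s,t,u,v$ are summation integers.) $\mathfrak v_\emptyset=1$.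
   Formalization: In 𝔳_J the exponent of 2 is −j−2l+r+s+2t−3u+v instead of −j+l+r+s+2t−3u+v (the printed one fails for n≥4, e.g. type 1 with ϰh=aη); the matter tensors T and graviton fields are finite superpositions of Fourier modes. *)

theory Defs
  imports "HOL-Analysis.Analysis" "HOL-Combinatorics.Permutations"
begin

text \<open>
  Spacetime indices are elements of the four-element type \<^typ>\<open>4\<close>, whose elements are
  0, 1, 2, 3; spacetime points and momenta are vectors in \<^typ>\<open>real^4\<close>. Points carry an upper
  and momenta a lower index, so \<open>p \<bullet> x\<close> is the pairing of a momentum with a point and does not
  involve the Minkowski metric.
\<close>

section \<open>Metric, vielbein and Lagrange densities\<close>

definition \<eta> :: "real^4^4" where
  "\<eta> = (\<chi> \<mu> \<nu>. if \<mu> = \<nu> then (if \<mu> = 0 then 1 else - 1) else 0)"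

text \<open>Eigenvalues of a symmetric tensor \<open>h\<close>, that is, the complex eigenvalues of the
  endomorphism with components \<open>\<eta>\<^sup>\<mu>\<^sup>\<rho> h\<^sub>\<rho>\<^sub>\<nu>\<close>.\<close>

definition EW :: "real^4^4 \<Rightarrow> complex set" where
  "EW H = {z. \<exists>v::complex^4. v \<noteq> 0 \<and> (\<chi> \<mu> \<nu>. complex_of_real ((\<eta> ** H) $ \<mu> $ \<nu>)) *v v = z *s v}"

definition partial :: "4 \<Rightarrow> (real^4 \<Rightarrow> real) \<Rightarrow> real^4 \<Rightarrow> real" where
  "partial \<rho> f x = deriv (\<lambda>t. f (x + t *\<^sub>R axis \<rho> 1)) 0"

definition metric :: "real \<Rightarrow> (real^4 \<Rightarrow> real^4^4) \<Rightarrow> real^4 \<Rightarrow> real^4^4" where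
  "metric \<kappa> h x = \<eta> + \<kappa> *\<^sub>R h x"

definition inverse_metric :: "real \<Rightarrow> (real^4 \<Rightarrow> real^4^4) \<Rightarrow> real^4 \<Rightarrow> real^4^4" where
  "inverse_metric \<kappa> h x = matrix_inv (metric \<kappa> h x)"

definition Christoffel1 :: "real \<Rightarrow> (real^4 \<Rightarrow> real^4^4) \<Rightarrow> real^4 \<Rightarrow> 4 \<Rightarrow> 4 \<Rightarrow> 4 \<Rightarrow> real" where
  "Christoffel1 \<kappa> h x \<mu> \<nu> \<rho> =
     1/2 * (partial \<mu> (\<lambda>y. metric \<kappa> h y $ \<nu> $ \<rho>) x
          + partial \<nu> (\<lambda>y. metric \<kappa> h y $ \<rho> $ \<mu>) x
          - partial \<rho> (\<lambda>y. metric \<kappa> h y $ \<mu> $ \<nu>) x)"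

definition Christoffel :: "real \<Rightarrow> (real^4 \<Rightarrow> real^4^4) \<Rightarrow> real^4 \<Rightarrow> 4 \<Rightarrow> 4 \<Rightarrow> 4 \<Rightarrow> real" where
  "Christoffel \<kappa> h x \<mu> \<nu> \<rho> =
     (\<Sum>\<sigma>\<in>UNIV. inverse_metric \<kappa> h x $ \<rho> $ \<sigma> * Christoffel1 \<kappa> h x \<mu> \<nu> \<sigma>)"

primrec hpow :: "real^4^4 \<Rightarrow> nat \<Rightarrow> real^4^4" where
  "hpow H 0 = \<eta>"
| "hpow H (Suc k) = hpow H k ** H ** \<eta>"

text \<open>\<open>vielbein \<kappa> h x $ \<mu> $ m\<close> is \<open>e\<^sub>\<mu>\<^sup>m\<close>, and \<open>inverse_vielbein \<kappa> h x $ \<mu> $ m\<close> is \<open>e\<^sup>\<mu>\<^sup>m\<close>.\<close>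

definition vielbein :: "real \<Rightarrow> (real^4 \<Rightarrow> real^4^4) \<Rightarrow> real^4 \<Rightarrow> real^4^4" where
  "vielbein \<kappa> h x =
     (\<chi> \<mu> m. \<Sum>k. \<kappa>^k * ((1/2) gchoose k) * (\<Sum>\<nu>\<in>UNIV. \<eta> $ \<mu> $ \<nu> * hpow (h x) k $ \<nu> $ m))"

definition inverse_vielbein :: "real \<Rightarrow> (real^4 \<Rightarrow> real^4^4) \<Rightarrow> real^4 \<Rightarrow> real^4^4" where
  "inverse_vielbein \<kappa> h x = (\<chi> \<mu> m. \<Sum>k. \<kappa>^k * ((- 1/2) gchoose k) * hpow (h x) k $ \<mu> $ m)"

text \<open>The graviton-free matter tensor together with the type of the matter model. It is used
  with \<open>'a = real^4 \<Rightarrow> complex\<close> for the tensor fields and with \<open>'a = complex\<close> for the values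
  of their transforms at one momentum.\<close>

datatype 'a matter =
    Type1 'a
  | Type2 "4 \<Rightarrow> 4 \<Rightarrow> 'a"
  | Type3 "4 \<Rightarrow> 4 \<Rightarrow> 4 \<Rightarrow> 4 \<Rightarrow> 'a"
  | Type4 "4 \<Rightarrow> 'a"
  | Type5 "4 \<Rightarrow> 4 \<Rightarrow> 4 \<Rightarrow> 'a"
  | Type6 "4 \<Rightarrow> 4 \<Rightarrow> 'a"
  | Type7 "4 \<Rightarrow> 'a"
  | Type8 "4 \<Rightarrow> 4 \<Rightarrow> 4 \<Rightarrow> 'a"
  | Type9 "4 \<Rightarrow> 4 \<Rightarrow> 4 \<Rightarrow> 4 \<Rightarrow> 'a"
  | Type10 "4 \<Rightarrow> 4 \<Rightarrow> 4 \<Rightarrow> 4 \<Rightarrow> 'a"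

text \<open>The flat indices \<open>o, r, s, t\<close> of the vielbeins are called \<open>a, r, s, t\<close>, since \<open>o\<close> is
  reserved for function composition.\<close>

definition lagrangian ::
  "real \<Rightarrow> (real^4 \<Rightarrow> complex) matter \<Rightarrow> (real^4 \<Rightarrow> real^4^4) \<Rightarrow> real^4 \<Rightarrow> complex" where
  "lagrangian \<kappa> T h x =
    (let g = inverse_metric \<kappa> h x; \<Gamma> = Christoffel \<kappa> h x;
         e = vielbein \<kappa> h x; E = inverse_vielbein \<kappa> h x
     in (case T of
        Type1 T \<Rightarrow> T x
      | Type2 T \<Rightarrow> (\<Sum>\<mu>\<in>UNIV. \<Sum>\<nu>\<in>UNIV. of_real (g $ \<mu> $ \<nu>) * T \<mu> \<nu> x)
      | Type3 T \<Rightarrow> (\<Sum>\<mu>\<in>UNIV. \<Sum>\<nu>\<in>UNIV. \<Sum>\<rho>\<in>UNIV. \<Sum>\<sigma>\<in>UNIV.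
          of_real (g $ \<mu> $ \<nu> * g $ \<rho> $ \<sigma>) * T \<mu> \<nu> \<rho> \<sigma> x)
      | Type4 T \<Rightarrow> (\<Sum>\<mu>\<in>UNIV. \<Sum>\<nu>\<in>UNIV. \<Sum>\<tau>\<in>UNIV.
          of_real (g $ \<mu> $ \<nu> * \<Gamma> \<mu> \<nu> \<tau>) * T \<tau> x)
      | Type5 T \<Rightarrow> (\<Sum>\<mu>\<in>UNIV. \<Sum>\<nu>\<in>UNIV. \<Sum>\<rho>\<in>UNIV. \<Sum>\<sigma>\<in>UNIV. \<Sum>\<tau>\<in>UNIV.
          of_real (g $ \<mu> $ \<nu> * g $ \<rho> $ \<sigma> * \<Gamma> \<mu> \<nu> \<tau>) * T \<rho> \<sigma> \<tau> x)
      | Type6 T \<Rightarrow> (\<Sum>\<mu>\<in>UNIV. \<Sum>\<nu>\<in>UNIV. \<Sum>\<rho>\<in>UNIV. \<Sum>\<sigma>\<in>UNIV. \<Sum>\<alpha>\<in>UNIV. \<Sum>\<beta>\<in>UNIV.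
          of_real (g $ \<mu> $ \<nu> * g $ \<rho> $ \<sigma> * \<Gamma> \<mu> \<nu> \<alpha> * \<Gamma> \<rho> \<sigma> \<beta>) * T \<alpha> \<beta> x)
      | Type7 T \<Rightarrow> (\<Sum>a\<in>UNIV. of_real (e $ 0 $ a) * T a x)
      | Type8 T \<Rightarrow> (\<Sum>a\<in>UNIV. \<Sum>\<rho>\<in>UNIV. \<Sum>r\<in>UNIV.
          of_real (e $ 0 $ a * E $ \<rho> $ r) * T a \<rho> r x)
      | Type9 T \<Rightarrow> (\<Sum>a\<in>UNIV. \<Sum>r\<in>UNIV. \<Sum>s\<in>UNIV. \<Sum>t\<in>UNIV. \<Sum>\<rho>\<in>UNIV. \<Sum>\<sigma>\<in>UNIV.
          of_real (e $ 0 $ a * E $ \<rho> $ r * E $ \<sigma> $ s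
                   * partial \<rho> (\<lambda>y. vielbein \<kappa> h y $ \<sigma> $ t) x) * T a r s t x)
      | Type10 T \<Rightarrow> (\<Sum>a\<in>UNIV. \<Sum>r\<in>UNIV. \<Sum>s\<in>UNIV. \<Sum>t\<in>UNIV. \<Sum>\<rho>\<in>UNIV. \<Sum>\<sigma>\<in>UNIV. \<Sum>\<tau>\<in>UNIV.
          of_real (e $ 0 $ a * E $ \<rho> $ r * E $ \<sigma> $ s * e $ \<tau> $ t * \<Gamma> \<rho> \<sigma> \<tau>) * T a r s t x))
      * of_real (sqrt (- det (metric \<kappa> h x))))"

text \<open>\<open>order_part f n \<kappa>\<close> is the order-\<open>\<kappa>\<^sup>n\<close> part of \<open>f \<kappa>\<close>, including the factor \<open>\<kappa>\<^sup>n\<close>. The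
  coefficients are those of the power series that represents \<open>f\<close> near 0.\<close>

definition order_part :: "(real \<Rightarrow> complex) \<Rightarrow> nat \<Rightarrow> real \<Rightarrow> complex" where
  "order_part f n \<kappa> =
     (THE c. \<exists>R>0. \<forall>k. \<bar>k\<bar> < R \<longrightarrow> (\<lambda>m. c m * of_real k ^ m) sums f k) n * of_real \<kappa> ^ n"

section \<open>Momentum space and functional derivatives\<close>

text \<open>The Fourier convention is the one in which \<open>\<partial>\<^sub>\<rho>\<close> is represented by \<open>p\<^sub>\<rho>\<close>, without a factor
  of the imaginary unit: the mode of momentum \<open>p\<close> is the function \<open>exp (p \<bullet> x)\<close>. Fields are
  finite superpositions of such modes; the modes are linearly independent, so the amplitudes are
  determined by the function. Multiplication of functions becomes convolution of amplitudes.
  Since the order-\<open>\<kappa>\<^sup>n\<close> part of a Lagrange density is a homogeneous polynomial of degree \<open>n\<close> in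
  the graviton field and its first derivatives, its \<open>n\<close>-fold functional derivative is determined
  by its values on such superpositions.\<close>

definition is_transform :: "(real^4 \<Rightarrow> complex) \<Rightarrow> (real^4 \<Rightarrow> complex) \<Rightarrow> bool" where
  "is_transform f A \<longleftrightarrow> finite {P. A P \<noteq> 0} \<and>
     (\<forall>x. f x = (\<Sum>P | A P \<noteq> 0. A P * of_real (exp (P \<bullet> x))))"

definition fourier :: "(real^4 \<Rightarrow> complex) \<Rightarrow> real^4 \<Rightarrow> complex" where
  "fourier f = (THE A. is_transform f A)"

definition graviton_field :: "(real^4 \<Rightarrow> real^4^4) \<Rightarrow> real^4 \<Rightarrow> real^4^4" where
  "graviton_field H x = (\<Sum>q | H q \<noteq> 0. exp (q \<bullet> x) *\<^sub>R H q)"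

text \<open>The direction of the derivative with respect to the symmetric field component
  \<open>h\<^sub>\<mu>\<^sub>\<nu>\<close> at momentum \<open>p\<close>: a derivative of \<open>h\<^sub>\<rho>\<^sub>\<sigma>\<close> in this direction is
  \<open>1/2 (\<delta>\<^sub>\<rho>\<^sup>\<mu> \<delta>\<^sub>\<sigma>\<^sup>\<nu> + \<delta>\<^sub>\<sigma>\<^sup>\<mu> \<delta>\<^sub>\<rho>\<^sup>\<nu>)\<close>.\<close>

definition kron :: "4 \<Rightarrow> 4 \<Rightarrow> real" where
  "kron \<mu> \<nu> = (if \<mu> = \<nu> then 1 else 0)"

definition graviton_mode :: "4 \<Rightarrow> 4 \<Rightarrow> real^4 \<Rightarrow> real^4 \<Rightarrow> real^4^4" where
  "graviton_mode \<mu> \<nu> p q =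
     (if q = p then (\<chi> \<rho> \<sigma>. 1/2 * (kron \<rho> \<mu> * kron \<sigma> \<nu> + kron \<sigma> \<mu> * kron \<rho> \<nu>)) else 0)"

definition func_deriv ::
  "4 \<Rightarrow> 4 \<Rightarrow> real^4 \<Rightarrow> ((real^4 \<Rightarrow> real^4^4) \<Rightarrow> complex) \<Rightarrow> (real^4 \<Rightarrow> real^4^4) \<Rightarrow> complex" where
  "func_deriv \<mu> \<nu> p F H =
     vector_derivative (\<lambda>t. F (\<lambda>q. H q + t *\<^sub>R graviton_mode \<mu> \<nu> p q)) (at 0)"

primrec func_derivs ::
  "(nat \<Rightarrow> 4) \<Rightarrow> (nat \<Rightarrow> 4) \<Rightarrow> (nat \<Rightarrow> real^4) \<Rightarrow> nat \<Rightarrow>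
     ((real^4 \<Rightarrow> real^4^4) \<Rightarrow> complex) \<Rightarrow> (real^4 \<Rightarrow> real^4^4) \<Rightarrow> complex" where
  "func_derivs \<mu> \<nu> p 0 F = F"
| "func_derivs \<mu> \<nu> p (Suc n) F =
     func_deriv (\<mu> (Suc n)) (\<nu> (Suc n)) (p (Suc n)) (func_derivs \<mu> \<nu> p n F)"

text \<open>The gravitons are numbered \<open>1, \<dots>, n\<close>, with indices \<open>\<mu> i\<close>, \<open>\<nu> i\<close> and incoming momenta
  \<open>p i\<close>. The matter momentum is \<open>Q\<close>, so that the transform of the density is evaluated at the
  total momentum. All orderings of the gravitons contribute to the iterated derivative at the
  zero field, with weight 1 and no factor \<open>1/n!\<close>.\<close>

definition feynman_rule ::
  "real \<Rightarrow> (real^4 \<Rightarrow> complex) matter \<Rightarrow> nat \<Rightarrow>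
     (nat \<Rightarrow> 4) \<Rightarrow> (nat \<Rightarrow> 4) \<Rightarrow> (nat \<Rightarrow> real^4) \<Rightarrow> real^4 \<Rightarrow> complex" where
  "feynman_rule \<kappa> T n \<mu> \<nu> p Q =
     \<i> * func_derivs \<mu> \<nu> p n
       (\<lambda>H. fourier (\<lambda>x. order_part (\<lambda>k. lagrangian k T (graviton_field H) x) n \<kappa>)
              (Q + (\<Sum>i=1..n. p i)))
       (\<lambda>_. 0)"

section \<open>Building blocks\<close>

text \<open>A block \<open>J = {b+1, \<dots>, b+m}\<close> is passed as its offset \<open>b\<close> and its length \<open>m\<close>.\<close>

definition h_block :: "real \<Rightarrow> (nat \<Rightarrow> 4) \<Rightarrow> (nat \<Rightarrow> 4) \<Rightarrow> nat \<Rightarrow> nat \<Rightarrow> 4 \<Rightarrow> 4 \<Rightarrow> real" where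
  "h_block \<kappa> \<mu> \<nu> b m \<alpha> \<beta> =
     (if m = 0 then \<eta> $ \<alpha> $ \<beta>
      else \<kappa> ^ m * \<eta> $ \<alpha> $ \<nu> (b + 1)
             * (\<Prod>x\<in>{1..<m}. \<eta> $ \<mu> (b + x) $ \<nu> (b + x + 1))
             * \<eta> $ \<mu> (b + m) $ \<beta>)"

definition h'_block ::
  "real \<Rightarrow> (nat \<Rightarrow> 4) \<Rightarrow> (nat \<Rightarrow> 4) \<Rightarrow> (nat \<Rightarrow> real^4) \<Rightarrow> nat \<Rightarrow> nat \<Rightarrow> 4 \<Rightarrow> 4 \<Rightarrow> 4 \<Rightarrow> real" where
  "h'_block \<kappa> \<mu> \<nu> p b m \<rho> \<alpha> \<beta> =
     (\<Sum>i\<in>{b + 1..b + m}. p i $ \<rho>) * h_block \<kappa> \<mu> \<nu> b m \<alpha> \<beta>"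

definition \<Gamma>_block ::
  "real \<Rightarrow> (nat \<Rightarrow> 4) \<Rightarrow> (nat \<Rightarrow> 4) \<Rightarrow> (nat \<Rightarrow> real^4) \<Rightarrow> nat \<Rightarrow> 4 \<Rightarrow> 4 \<Rightarrow> 4 \<Rightarrow> real" where
  "\<Gamma>_block \<kappa> \<mu> \<nu> p i \<alpha> \<beta> \<rho> = \<kappa> / 4 *
     (p i $ \<alpha> * (kron \<rho> (\<mu> i) * kron \<beta> (\<nu> i) + kron \<beta> (\<mu> i) * kron \<rho> (\<nu> i))
    + p i $ \<beta> * (kron \<alpha> (\<mu> i) * kron \<rho> (\<nu> i) + kron \<rho> (\<mu> i) * kron \<alpha> (\<nu> i))
    - p i $ \<rho> * (kron \<alpha> (\<mu> i) * kron \<beta> (\<nu> i) + kron \<beta> (\<mu> i) * kron \<alpha> (\<nu> i)))"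

text \<open>The contraction pattern in the expansion of the volume density: \<open>A\<close>, \<open>B\<close>, \<open>C\<close>, \<open>D\<close> are the
  exponents of the traces of the first four powers of \<open>h\<close>.\<close>

definition E_block :: "(nat \<Rightarrow> 4) \<Rightarrow> (nat \<Rightarrow> 4) \<Rightarrow> nat \<Rightarrow> nat \<Rightarrow> nat \<Rightarrow> nat \<Rightarrow> nat \<Rightarrow> real" where
  "E_block \<mu> \<nu> b A B C D = (let M = (\<lambda>x. \<mu> (b + x)); N = (\<lambda>x. \<nu> (b + x)) in
     (\<Prod>x\<in>{1..A}. \<eta> $ M x $ N x)
   * (\<Prod>x\<in>{A + 1..A + B}. \<eta> $ M x $ M (x + B) * \<eta> $ N x $ N (x + B))
   * (\<Prod>x\<in>{A + 2*B + 1..A + 2*B + C}.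
        \<eta> $ M x $ N (x + C) * \<eta> $ M (x + C) $ N (x + 2*C) * \<eta> $ M (x + 2*C) $ N x)
   * (\<Prod>x\<in>{A + 2*B + 3*C + 1..A + 2*B + 3*C + D}.
        \<eta> $ M x $ N (x + D) * \<eta> $ M (x + D) $ N (x + 2*D)
        * \<eta> $ M (x + 2*D) $ N (x + 3*D) * \<eta> $ M (x + 3*D) $ N x))"

text \<open>With \<open>t\<^sub>k\<close> the trace of the \<open>k\<close>-th power, \<open>v_block\<close> is the order-\<open>m\<close> part of
  \<open>(1 + e\<^sub>1 + e\<^sub>2 + e\<^sub>3 + e\<^sub>4)\<^sup>1\<^sup>/\<^sup>2\<close>, where \<open>e\<^sub>1 = t\<^sub>1\<close>, \<open>e\<^sub>2 = (t\<^sub>1\<^sup>2 - t\<^sub>2) / 2\<close>,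
  \<open>e\<^sub>3 = (t\<^sub>1\<^sup>3 - 3 t\<^sub>1 t\<^sub>2 + 2 t\<^sub>3) / 6\<close> and
  \<open>e\<^sub>4 = (t\<^sub>1\<^sup>4 - 6 t\<^sub>1\<^sup>2 t\<^sub>2 + 3 t\<^sub>2\<^sup>2 + 8 t\<^sub>1 t\<^sub>3 - 6 t\<^sub>4) / 24\<close>. The denominators 2, 6, 24 contribute
  \<open>-(j - k) - (k - l) - 3 l = - j - 2 l\<close> to the exponent of 2. (With the exponent \<open>- j + l\<close>, as it
  is sometimes printed, the factor belonging to \<open>e\<^sub>4\<close> would be \<open>1/3\<close> instead of \<open>1/24\<close>, and the
  expansion would fail from order 4 on.)

  All subtractions of natural numbers below are exact, because of the ranges of the summation
  indices.\<close>

definition v_block :: "real \<Rightarrow> (nat \<Rightarrow> 4) \<Rightarrow> (nat \<Rightarrow> 4) \<Rightarrow> nat \<Rightarrow> nat \<Rightarrow> real" where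
  "v_block \<kappa> \<mu> \<nu> b m = \<kappa> ^ m *
     (\<Sum>(i, j, k, l)\<in>{(i, j, k, l). i + j + k + l = m \<and> j \<le> i \<and> k \<le> j \<and> l \<le> k}.
      \<Sum>p\<in>{0..j - k}. \<Sum>q\<in>{0..k - l}. \<Sum>r\<in>{0..q}. \<Sum>s\<in>{0..l}. \<Sum>t\<in>{0..s}. \<Sum>u\<in>{0..t}. \<Sum>v\<in>{0..u}.
        ((1/2) gchoose i) * of_nat (i choose j) * of_nat (j choose k) * of_nat (k choose l)
        * of_nat ((j - k) choose p) * of_nat ((k - l) choose q) * of_nat (q choose r)
        * of_nat (l choose s) * of_nat (s choose t) * of_nat (t choose u) * of_nat (u choose v)
        * (- 1) powi (int p + int q - int r + int s - int t + int v)
        * 2 powi (- int j - 2 * int l + int r + int s + 2 * int t - 3 * int u + int v)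
        * 3 powi (- int k + int q - int r + int s - int t + int u)
        * E_block \<mu> \<nu> b
            (i + j + k + l - 2 * p - 2 * q - r - 2 * s - t - u)
            (p + q - r + s - t + 2 * u - 2 * v)
            (r + t - u)
            v)"

section \<open>The unsymmetrized vertices\<close>

text \<open>The sums over \<open>m\<^sub>1 + m\<^sub>2 + \<dots> = n - 1\<close> and \<open>\<dots> = n - 2\<close> are written with \<open>+ 1 = n\<close> and
  \<open>+ 2 = n\<close>, so that they are empty for \<open>n < 1\<close> and \<open>n < 2\<close>, respectively.\<close>

definition unsym_vertex ::
  "real \<Rightarrow> complex matter \<Rightarrow> nat \<Rightarrow> (nat \<Rightarrow> 4) \<Rightarrow> (nat \<Rightarrow> 4) \<Rightarrow> (nat \<Rightarrow> real^4) \<Rightarrow> complex" where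
  "unsym_vertex \<kappa> T n \<mu> \<nu> p =
    (let h = h_block \<kappa> \<mu> \<nu>; h' = h'_block \<kappa> \<mu> \<nu> p; v = v_block \<kappa> \<mu> \<nu>; \<Gamma> = \<Gamma>_block \<kappa> \<mu> \<nu> p
     in case T of
       Type1 T \<Rightarrow> T * of_real (v 0 n)
     | Type2 T \<Rightarrow> (\<Sum>\<alpha>\<in>UNIV. \<Sum>\<beta>\<in>UNIV. T \<alpha> \<beta> * of_real
         (\<Sum>(m1, m2)\<in>{(m1, m2). m1 + m2 = n}.
            (- 1)^m1 * h 0 m1 \<alpha> \<beta> * v m1 m2))
     | Type3 T \<Rightarrow> (\<Sum>\<alpha>\<in>UNIV. \<Sum>\<beta>\<in>UNIV. \<Sum>\<rho>\<in>UNIV. \<Sum>\<sigma>\<in>UNIV. T \<alpha> \<beta> \<rho> \<sigma> * of_real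
         (\<Sum>(m1, m2, m3)\<in>{(m1, m2, m3). m1 + m2 + m3 = n}.
            (- 1)^(m1 + m2) * h 0 m1 \<alpha> \<beta> * h m1 m2 \<rho> \<sigma> * v (m1 + m2) m3))
     | Type4 T \<Rightarrow> (\<Sum>\<alpha>\<in>UNIV. \<Sum>\<beta>\<in>UNIV. \<Sum>\<rho>\<in>UNIV. \<Sum>\<sigma>\<in>UNIV. T \<rho> * of_real (\<Gamma> 1 \<alpha> \<beta> \<sigma> *
         (\<Sum>(m1, m2, m3)\<in>{(m1, m2, m3). m1 + m2 + m3 + 1 = n}.
            (- 1)^(m1 + m2) * h 1 m1 \<alpha> \<beta> * h (1 + m1) m2 \<rho> \<sigma> * v (1 + m1 + m2) m3)))
     | Type5 T \<Rightarrow> (\<Sum>\<alpha>\<in>UNIV. \<Sum>\<beta>\<in>UNIV. \<Sum>\<theta>\<in>UNIV. \<Sum>\<rho>\<in>UNIV. \<Sum>\<sigma>\<in>UNIV. \<Sum>\<xi>\<in>UNIV.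
         T \<rho> \<sigma> \<xi> * of_real (\<Gamma> 1 \<alpha> \<beta> \<theta> *
         (\<Sum>(m1, m2, m3, m4)\<in>{(m1, m2, m3, m4). m1 + m2 + m3 + m4 + 1 = n}.
            (- 1)^(m1 + m2 + m3) * h 1 m1 \<alpha> \<beta> * h (1 + m1) m2 \<rho> \<sigma> * h (1 + m1 + m2) m3 \<xi> \<theta>
            * v (1 + m1 + m2 + m3) m4)))
     | Type6 T \<Rightarrow> (\<Sum>\<alpha>\<in>UNIV. \<Sum>\<beta>\<in>UNIV. \<Sum>\<theta>\<in>UNIV. \<Sum>\<rho>\<in>UNIV. \<Sum>\<sigma>\<in>UNIV. \<Sum>\<tau>\<in>UNIV. \<Sum>\<xi>\<in>UNIV. \<Sum>\<zeta>\<in>UNIV.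
         T \<xi> \<zeta> * of_real (\<Gamma> 1 \<alpha> \<beta> \<theta> * \<Gamma> 2 \<rho> \<sigma> \<tau> *
         (\<Sum>(m1, m2, m3, m4, m5)\<in>{(m1, m2, m3, m4, m5). m1 + m2 + m3 + m4 + m5 + 2 = n}.
            (- 1)^(m1 + m2 + m3 + m4) * h 2 m1 \<alpha> \<beta> * h (2 + m1) m2 \<rho> \<sigma>
            * h (2 + m1 + m2) m3 \<xi> \<theta> * h (2 + m1 + m2 + m3) m4 \<zeta> \<tau>
            * v (2 + m1 + m2 + m3 + m4) m5)))
     | Type7 T \<Rightarrow> (\<Sum>a\<in>UNIV. T a * of_real
         (\<Sum>(m1, m2)\<in>{(m1, m2). m1 + m2 = n}.
            ((1/2) gchoose m1) * (\<Sum>\<upsilon>\<in>UNIV. \<eta> $ 0 $ \<upsilon> * h 0 m1 \<upsilon> a) * v m1 m2))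
     | Type8 T \<Rightarrow> (\<Sum>a\<in>UNIV. \<Sum>\<rho>\<in>UNIV. \<Sum>r\<in>UNIV. T a \<rho> r * of_real
         (\<Sum>(m1, m2, m3)\<in>{(m1, m2, m3). m1 + m2 + m3 = n}.
            ((1/2) gchoose m1) * ((- 1/2) gchoose m2)
            * (\<Sum>\<upsilon>\<in>UNIV. \<eta> $ 0 $ \<upsilon> * h 0 m1 \<upsilon> a) * h m1 m2 \<rho> r * v (m1 + m2) m3))
     | Type9 T \<Rightarrow> (\<Sum>a\<in>UNIV. \<Sum>r\<in>UNIV. \<Sum>s\<in>UNIV. \<Sum>t\<in>UNIV. \<Sum>\<rho>\<in>UNIV. \<Sum>\<sigma>\<in>UNIV.
         T a r s t * of_real
         (\<Sum>(m1, m2, m3, m4, m5)\<in>{(m1, m2, m3, m4, m5). m1 + m2 + m3 + m4 + m5 = n}.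
            ((1/2) gchoose m1) * ((- 1/2) gchoose m2) * ((- 1/2) gchoose m3) * ((1/2) gchoose m4)
            * (\<Sum>\<upsilon>\<in>UNIV. \<eta> $ 0 $ \<upsilon> * h 0 m1 \<upsilon> a) * h m1 m2 \<rho> r * h (m1 + m2) m3 \<sigma> s
            * (\<Sum>\<tau>\<in>UNIV. \<eta> $ \<sigma> $ \<tau> * h' (m1 + m2 + m3) m4 \<rho> \<tau> t)
            * v (m1 + m2 + m3 + m4) m5))
     | Type10 T \<Rightarrow> (\<Sum>a\<in>UNIV. \<Sum>r\<in>UNIV. \<Sum>s\<in>UNIV. \<Sum>t\<in>UNIV. \<Sum>\<rho>\<in>UNIV. \<Sum>\<sigma>\<in>UNIV. \<Sum>\<tau>\<in>UNIV.
         T a r s t * of_real (\<Gamma> 1 \<rho> \<sigma> \<tau> *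
         (\<Sum>(m1, m2, m3, m4, m5)\<in>{(m1, m2, m3, m4, m5). m1 + m2 + m3 + m4 + m5 + 1 = n}.
            ((1/2) gchoose m1) * ((- 1/2) gchoose m2) * ((- 1/2) gchoose m3) * ((- 1/2) gchoose m4)
            * (\<Sum>\<upsilon>\<in>UNIV. \<eta> $ 0 $ \<upsilon> * h 1 m1 \<upsilon> a) * h (1 + m1) m2 \<rho> r * h (1 + m1 + m2) m3 \<sigma> s
            * h (1 + m1 + m2 + m3) m4 \<tau> t
            * v (1 + m1 + m2 + m3 + m4) m5))))"

text \<open>A choice of the index pairs to be exchanged is the set \<open>X\<close> of the gravitons concerned.\<close>

definition swap_idx :: "nat set \<Rightarrow> (nat \<Rightarrow> 4) \<Rightarrow> (nat \<Rightarrow> 4) \<Rightarrow> nat \<Rightarrow> 4" where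
  "swap_idx X \<mu> \<nu> i = (if i \<in> X then \<nu> i else \<mu> i)"

end

theory Submission
  imports Defs "HOL-Complex_Analysis.Complex_Analysis"
begin

text \<open>The eigenvalue bound keeps \<open>det (1 + z \<eta> h)\<close> free of zeros on a complex disc of radius
  \<open>R > \<bar>\<kappa>\<bar>\<close>. Hence the resolvent and the square root of the determinant are holomorphic there,
  which gives the power series of the inverse metric, the vielbein and the volume density; the
  coefficients of the latter are those of the formal square root of \<open>1 + e\<^sub>1 + e\<^sub>2 + e\<^sub>3 + e\<^sub>4\<close>.

  On a superposition of \<open>n\<close> plane waves the order-\<open>\<kappa>\<^sup>n\<close> part of a density is a sum over words of length
  \<open>n\<close>, whose letters are the gravitons with or without exchange of their two indices. Multiplication of
  power series is concatenation of words, so the factors of the density occupy consecutive blocks of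
  letters. The \<open>n\<close>-fold functional derivative at the zero field keeps the words in which every graviton
  occurs exactly once, that is, a permutation together with the set of exchanged index pairs. All these
  words have the total momentum of the gravitons, and only the matter momentum \<open>Q\<close> remains.\<close>

section \<open>Power series in the coupling constant\<close>

text \<open>The superposed plane waves are real exponentials and unbounded, so no positive radius of
  convergence serves all points at once. The order parts behind the Feynman rule are therefore read
  off point by point from the germ at coupling 0, whereas the expansion of the density of
  \<open>h\<close> is a convergence statement at the given coupling. For the inverse metric and the
  volume density, convergence and coefficients are obtained separately: analyticity supplies a
  series on the whole disc, and an algebraic identity (the resolvent equation, the square of the
  root) determines it. A norm estimate of the Neumann series would not reach the radius that the
  eigenvalues allow. The passage from series to blocks is compositional. Every factor is paired with
  a functional of words for each offset and length, and this pairing respects sums and Cauchy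
  products; the order of multiplication fixes the order of the blocks. Letters are gravitons rather
  than momenta, so coinciding momenta need no separate treatment.\<close>

no_notation fps_nth (infixl "$" 75)

text \<open>The variable is real because \<open>order_part\<close> tests real couplings only; the
  coefficients are complex because the matter fields are.\<close>

definition powser_on :: "real \<Rightarrow> (real \<Rightarrow> complex) \<Rightarrow> complex fps \<Rightarrow> bool" where
  "powser_on R f F \<longleftrightarrow> (\<forall>k. \<bar>k\<bar> < R \<longrightarrow> (\<lambda>m. fps_nth F m * of_real k ^ m) sums f k)"

lemma powser_on_const: "powser_on R (\<lambda>_. c) (fps_const c)"
  unfolding powser_on_def
proof (intro allI impI)
  fix k :: real
  have "(\<lambda>m. if m = 0 then c else 0) sums c" by (rule sums_single)
  then show "(\<lambda>m. fps_nth (fps_const c) m * complex_of_real k ^ m) sums c"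
    by (rule sums_cong[THEN iffD1, rotated]) auto
qed

lemma powser_on_X: "powser_on R of_real fps_X"
  unfolding powser_on_def
proof (intro allI impI)
  fix k :: real
  have "(\<lambda>m. if m = 1 then of_real k else 0) sums complex_of_real k" by (rule sums_single)
  then show "(\<lambda>m. fps_nth fps_X m * complex_of_real k ^ m) sums of_real k"
    by (rule sums_cong[THEN iffD1, rotated]) auto
qed

lemma powser_on_add:
  "powser_on R f F \<Longrightarrow> powser_on R g G \<Longrightarrow> powser_on R (\<lambda>k. f k + g k) (F + G)"
  unfolding powser_on_def by (auto simp: distrib_right intro: sums_add)

lemma powser_on_sum:
  "finite A \<Longrightarrow> (\<And>i. i \<in> A \<Longrightarrow> powser_on R (f i) (F i)) \<Longrightarrow>
     powser_on R (\<lambda>k. \<Sum>i\<in>A. f i k) (\<Sum>i\<in>A. F i)"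
  by (induction A rule: finite_induct)
     (use powser_on_const[of R 0] in \<open>auto intro: powser_on_add\<close>)

text \<open>The interval is open, so the series also converges at some \<open>K\<close> beyond |k|,
  and a power series converges absolutely strictly inside any point of convergence.\<close>

lemma powser_on_summable_norm:
  assumes "powser_on R f F" "\<bar>k\<bar> < R"
  shows "summable (\<lambda>m. norm (fps_nth F m * of_real k ^ m))"
proof -
  obtain K where K: "\<bar>k\<bar> < K" "K < R" using assms(2) dense by blast
  then have "summable (\<lambda>m. fps_nth F m * of_real K ^ m)"
    using assms(1) unfolding powser_on_def by (auto dest!: spec[of _ K] simp: sums_iff)
  then show ?thesis by (rule powser_insidea) (use K in auto)
qed

lemma powser_on_mult:
  assumes F: "powser_on R f F" and G: "powser_on R g G"
  shows "powser_on R (\<lambda>k. f k * g k) (F * G)"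
  unfolding powser_on_def
proof (intro allI impI)
  fix k :: real assume k: "\<bar>k\<bar> < R"
  have *: "(\<Sum>m. fps_nth F m * of_real k ^ m) = f k" "(\<Sum>m. fps_nth G m * of_real k ^ m) = g k"
    using F G k by (auto simp: powser_on_def sums_iff)
  have "(\<lambda>m. \<Sum>i\<le>m. (fps_nth F i * of_real k ^ i) * (fps_nth G (m - i) * of_real k ^ (m - i))) sums (f k * g k)"
    using Cauchy_product_sums[OF powser_on_summable_norm[OF F k] powser_on_summable_norm[OF G k]] *
    by simp
  moreover have "(\<Sum>i\<le>m. (fps_nth F i * of_real k ^ i) * (fps_nth G (m - i) * of_real k ^ (m - i))) =
      fps_nth (F * G) m * of_real k ^ m" for m
    unfolding fps_mult_nth sum_distrib_right atLeast0AtMost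
    by (intro sum.cong refl) (simp add: power_add[symmetric] ac_simps flip: power_add)
  ultimately show "(\<lambda>m. fps_nth (F * G) m * complex_of_real k ^ m) sums (f k * g k)" by simp
qed

lemma powser_on_mono: "powser_on R f F \<Longrightarrow> r \<le> R \<Longrightarrow> powser_on r f F"
  unfolding powser_on_def by auto

lemma powser_on_cong:
  "powser_on R f F \<Longrightarrow> (\<And>k. \<bar>k\<bar> < R \<Longrightarrow> f k = g k) \<Longrightarrow> powser_on R g F"
  unfolding powser_on_def by auto

text \<open>A nonzero coefficient of positive index would keep the sum away from 0 on a punctured
  neighbourhood of 0. The constant coefficient is the value at 0 and is treated apart.\<close>

lemma real_powser_zero:
  fixes a :: "nat \<Rightarrow> real"
  assumes R: "R > 0" and s: "\<And>k. \<bar>k\<bar> < R \<Longrightarrow> (\<lambda>m. a m * k ^ m) sums 0"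
  shows "a m = 0"
proof (cases "m = 0")
  case True
  have "(\<lambda>m. a m * 0 ^ m) sums a 0" by (rule powser_sums_zero)
  then show ?thesis using s[of 0] R True by (auto dest: sums_unique2)
next
  case False
  show ?thesis
  proof (rule ccontr)
    assume "a m \<noteq> 0"
    have "\<exists>s>0. \<forall>z\<in>cball 0 s - {0::real}. (0::real) \<noteq> 0"
      using powser_0_nonzero[of R 0 a "\<lambda>_. 0" m] R s False \<open>a m \<noteq> 0\<close> by (metis diff_zero real_norm_def gr0I)
    then obtain s :: real where "0 < s" "\<forall>z\<in>cball 0 s - {0::real}. (0::real) \<noteq> 0" by blast
    then show False by (metis abs_of_pos less_eq_real_def less_irrefl mem_cball_0 real_norm_def Diff_iff singletonD)
  qed
qed

text \<open>At a real argument the real and imaginary parts of the difference series are power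
  series with real coefficients, so the real identity theorem applies to each.\<close>

lemma powser_on_unique:
  assumes F: "powser_on R f F" and G: "powser_on R f G" and R: "R > 0"
  shows "F = G"
proof (rule fps_ext)
  fix m
  have s: "(\<lambda>m. (fps_nth F m - fps_nth G m) * of_real k ^ m) sums 0" if "\<bar>k\<bar> < R" for k
    using sums_diff[of "\<lambda>m. fps_nth F m * of_real k ^ m" "f k" "\<lambda>m. fps_nth G m * of_real k ^ m" "f k"] F G that
    by (simp add: powser_on_def left_diff_distrib)
  have "Re (fps_nth F m - fps_nth G m) = 0"
    by (rule real_powser_zero[OF R, of "\<lambda>m. Re (fps_nth F m - fps_nth G m)"])
       (use sums_Re[OF s] in \<open>simp flip: of_real_power\<close>)
  moreover have "Im (fps_nth F m - fps_nth G m) = 0"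
    by (rule real_powser_zero[OF R, of "\<lambda>m. Im (fps_nth F m - fps_nth G m)"])
       (use sums_Im[OF s] in \<open>simp flip: of_real_power\<close>)
  ultimately show "fps_nth F m = fps_nth G m" by (simp add: complex_eq_iff)
qed

text \<open>The definite description in \<open>order_part\<close> is legitimate because any
  competing series represents the same function on the smaller of the two intervals.\<close>

lemma order_part_powser_on:
  assumes F: "powser_on R f F" and R: "R > 0"
  shows "order_part f n \<kappa> = fps_nth F n * of_real \<kappa> ^ n"
proof -
  have "(THE c. \<exists>R>0. \<forall>k. \<bar>k\<bar> < R \<longrightarrow> (\<lambda>m. c m * of_real k ^ m) sums f k) = fps_nth F"
  proof (rule the_equality)
    show "\<exists>R>0. \<forall>k. \<bar>k\<bar> < R \<longrightarrow> (\<lambda>m. fps_nth F m * of_real k ^ m) sums f k"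
      using F R by (auto simp: powser_on_def)
  next
    fix c assume "\<exists>R>0. \<forall>k. \<bar>k\<bar> < R \<longrightarrow> (\<lambda>m. c m * of_real k ^ m) sums f k"
    then obtain R' where R': "R' > 0" "powser_on R' f (Abs_fps c)" by (auto simp: powser_on_def)
    have "Abs_fps c = F"
      by (rule powser_on_unique[of "min R R'" f])
         (use R' F R in \<open>auto elim: powser_on_mono\<close>)
    then show "c = fps_nth F" by auto
  qed
  then show ?thesis unfolding order_part_def by simp
qed

section \<open>Determinant and resolvent of the metric\<close>

text \<open>In the type \<open>4\<close> the numeral 4 equals 0, so the indices 1 to 4 exhaust the
  type. The 24 permutations arise by composing with one transposition at a time, and each proper
  transposition flips the sign.\<close>

lemma det_4:
  "det (A::'a::comm_ring_1^4^4) =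
    A$1$1 * A$2$2*A$3$3*A$4$4 - A$1$1 * A$2$2*A$3$4*A$4$3
  - A$1$1 * A$2$3*A$3$2*A$4$4 + A$1$1 *A$2$3* A$3$4*A$4$2
  + A$1$1 * A$2$4*A$3$2*A$4$3 - A$1$1 * A$2$4* A$3$3*A$4$2
  - A$1$2 * A$2$1*A$3$3*A$4$4 + A$1$2 * A$2$1*A$3$4*A$4$3
  + A$1$2 * A$2$3*A$3$1*A$4$4 - A$1$2 * A$2$3*A$3$4*A$4$1
  - A$1$2 * A$2$4*A$3$1*A$4$3 + A$1$2 * A$2$4*A$3$3*A$4$1
  + A$1$3 * A$2$1*A$3$2*A$4$4 - A$1$3 * A$2$1*A$3$4*A$4$2
  - A$1$3 * A$2$2*A$3$1*A$4$4 + A$1$3 * A$2$2*A$3$4*A$4$1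
  + A$1$3 * A$2$4*A$3$1*A$4$2 - A$1$3 * A$2$4*A$3$2*A$4$1
  - A$1$4 * A$2$1*A$3$2*A$4$3 + A$1$4 * A$2$1*A$3$3*A$4$2
  + A$1$4 * A$2$2*A$3$1*A$4$3 - A$1$4 * A$2$2*A$3$3*A$4$1
  - A$1$4 * A$2$3*A$3$1*A$4$2 + A$1$4 * A$2$3*A$3$2*A$4$1"
proof -
  have f1: "finite {2::4, 3, 4}" "1 \<notin> {2::4, 3, 4}" by auto
  have f2: "finite {3::4, 4}" "2 \<notin> {3::4, 4}" by auto
  have f3: "finite {4::4}" "3 \<notin> {4::4}" by auto
  have f: "prod f {1::4,2,3,4} = f 1 * (f 2 * (f 3 * f 4))" for f :: "4 \<Rightarrow> 'a" by simp
  have s: "sum f {1::4,2,3,4} = f 1 + (f 2 + (f 3 + f 4))" "sum f {2::4,3,4} = f 2 + (f 3 + f 4)"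
     "sum f {3::4,4} = (f 3 + f 4)" for f :: "4 \<Rightarrow> 'a" by simp_all
  have n: "(1::4) \<noteq> 2" "(1::4) \<noteq> 3" "(1::4) \<noteq> 4" "(2::4) \<noteq> 3" "(2::4) \<noteq> 4" "(3::4) \<noteq> 4"
    by simp_all
  note n' = n n[symmetric]
  have sg: "sign (Transposition.transpose a b \<circ> q) = (if a = b then sign q else - sign q)" if "permutation q" for a b :: 4 and q
    using that by (auto simp: sign_compose permutation_swap_id sign_swap_id)
  have pm: "permutation (Transposition.transpose a b \<circ> q)" if "permutation q" for a b :: 4 and q
    using that by (intro permutation_compose permutation_swap_id)
  have sum1: "sum g {p. p permutes {4::4}} = g id" for g :: "(4 \<Rightarrow> 4) \<Rightarrow> 'a"
    by (simp only: permutes_sing) simp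
  have d: "det A = (\<Sum>p\<in>{p. p permutes {1::4,2,3,4}}. of_int (sign p) * (A$1$p 1 * (A$2$p 2 * (A$3$p 3 * A$4$p 4))))"
    unfolding det_def UNIV_4 f ..
  show ?thesis
    unfolding d
    apply (simp only: sum_over_permutations_insert[OF f1] sum_over_permutations_insert[OF f2]
      sum_over_permutations_insert[OF f3] sum1 s)
    apply (simp only: sg pm permutation_id if_True if_False n' refl sign_id)
    apply (simp only: o_apply id_apply Transposition.transpose_def)
    apply (simp only: if_True if_False n' refl simp_thms)
    apply (simp only: of_int_minus of_int_1 mult_minus_left mult_1_left minus_minus)
    apply (simp add: algebra_simps)
    done
qed

text \<open>Newton's identities for four eigenvalues: the coefficients are elementary symmetric
  functions written in power traces. The factor 24 clears all denominators and leaves a polynomial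
  identity in the 16 entries.\<close>

lemma det_one_plus:
  fixes A :: "'a::field_char_0^4^4"
  defines "t1 \<equiv> trace A" and "t2 \<equiv> trace (A ** A)" and "t3 \<equiv> trace (A ** A ** A)"
    and "t4 \<equiv> trace (A ** A ** A ** A)"
  shows "24 * det (\<chi> i j. (if i = j then 1 else 0) + z * A$i$j) =
    24 + 24 * z * t1 + 12 * z^2 * (t1^2 - t2) + 4 * z^3 * (t1^3 - 3 * t1 * t2 + 2 * t3)
    + z^4 * (t1^4 - 6 * t1^2 * t2 + 3 * t2^2 + 8 * t1 * t3 - 6 * t4)"
proof -
  have n: "(1::4) \<noteq> 2" "(1::4) \<noteq> 3" "(1::4) \<noteq> 4" "(2::4) \<noteq> 3" "(2::4) \<noteq> 4" "(3::4) \<noteq> 4"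
    by simp_all
  show ?thesis
    unfolding det_4 t1_def t2_def t3_def t4_def trace_def matrix_matrix_mult_def
    apply (simp only: sum_4 vec_lambda_beta n n[symmetric] if_True if_False refl add_0_left)
    apply algebra
    done
qed

definition cmat :: "real^4^4 \<Rightarrow> complex^4^4" where
  "cmat A = (\<chi> i j. of_real (A $ i $ j))"

definition pencil :: "real^4^4 \<Rightarrow> complex \<Rightarrow> complex^4^4" where
  "pencil A z = (\<chi> i j. (if i = j then 1 else 0) + z * cmat A $ i $ j)"

text \<open>The disc is complex although the coupling is real: complex zeros of the determinant also
  limit the radius of convergence.\<close>

definition regular :: "real \<Rightarrow> real^4^4 \<Rightarrow> bool" where
  "regular R A \<longleftrightarrow> (\<forall>z. cmod z < R \<longrightarrow> det (pencil A z) \<noteq> 0)"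

primrec mpow :: "'a::semiring_1^'n^'n \<Rightarrow> nat \<Rightarrow> 'a^'n^'n" where
  "mpow A 0 = mat 1"
| "mpow A (Suc m) = A ** mpow A m"

lemma mpow_add: "mpow A (m + n) = mpow A m ** mpow A n"
  by (induction m) (simp_all add: matrix_mul_assoc)

lemma mpow_Suc_right: "mpow A (Suc m) = mpow A m ** A"
  using mpow_add[of A m 1] by simp

lemma cmat_mult: "cmat (A ** B) = cmat A ** cmat B"
  by (simp add: cmat_def matrix_matrix_mult_def vec_eq_iff)

lemma trace_cmat: "trace (cmat A) = of_real (trace A)"
  by (simp add: cmat_def trace_def)

lemma det_cmat: "det (cmat A) = of_real (det A)"
  unfolding det_def cmat_def by simp

lemma cmat_mat_1: "cmat (mat 1) = mat 1"
  by (simp add: cmat_def vec_eq_iff mat_def)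

text \<open>This is det(1 + zA) when \<open>t m\<close> is the trace of the m-th power of A. The
  argument is an arbitrary sequence, so the formal expansion can be studied without a
  matrix.\<close>

definition e_poly :: "(nat \<Rightarrow> real) \<Rightarrow> real poly" where
  "e_poly t = [:1, t 1, (t 1 ^ 2 - t 2) / 2, (t 1 ^ 3 - 3 * t 1 * t 2 + 2 * t 3) / 6,
     (t 1 ^ 4 - 6 * t 1 ^ 2 * t 2 + 3 * t 2 ^ 2 + 8 * t 1 * t 3 - 6 * t 4) / 24:]"

definition power_traces :: "real^4^4 \<Rightarrow> nat \<Rightarrow> real" where
  "power_traces A m = trace (mpow A m)"

lemma det_pencil: "det (pencil A z) = poly (map_poly of_real (e_poly (power_traces A))) z"
proof -
  have t: "trace (cmat A) = of_real (power_traces A 1)"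
    "trace (cmat A ** cmat A) = of_real (power_traces A 2)"
    "trace (cmat A ** cmat A ** cmat A) = of_real (power_traces A 3)"
    "trace (cmat A ** cmat A ** cmat A ** cmat A) = of_real (power_traces A 4)"
    by (simp_all add: power_traces_def numeral_eq_Suc trace_cmat matrix_mul_assoc flip: cmat_mult)
  \<comment> \<open>The polynomial evaluates in Horner form; with the fractions named
    \<open>e2\<close>, \<open>e3\<close>, \<open>e4\<close> and their denominators cleared, the
    comparison is polynomial.\<close>
  have h: "24 * (1 + z * (c1 + z * (e2 + z * (e3 + z * e4)))) =
      24 + 24 * z * c1 + 12 * z^2 * (c1^2 - c2) + 4 * z^3 * (c1^3 - 3 * c1 * c2 + 2 * c3)
      + z^4 * (c1^4 - 6 * c1^2 * c2 + 3 * c2^2 + 8 * c1 * c3 - 6 * c4)"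
    if "2 * e2 = c1^2 - c2" "6 * e3 = c1^3 - 3 * c1 * c2 + 2 * c3"
      "24 * e4 = c1^4 - 6 * c1^2 * c2 + 3 * c2^2 + 8 * c1 * c3 - 6 * c4"
    for c1 c2 c3 c4 e2 e3 e4 :: complex
    using that by algebra
  have p: "poly (map_poly of_real (e_poly t)) z = 1 + z * (of_real (t 1) +
      z * (of_real ((t 1 ^ 2 - t 2) / 2) + z * (of_real ((t 1 ^ 3 - 3 * t 1 * t 2 + 2 * t 3) / 6) +
      z * of_real ((t 1 ^ 4 - 6 * t 1 ^ 2 * t 2 + 3 * t 2 ^ 2 + 8 * t 1 * t 3 - 6 * t 4) / 24))))"
    for t :: "nat \<Rightarrow> real"
    by (simp add: e_poly_def map_poly_pCons)
  have "24 * poly (map_poly of_real (e_poly (power_traces A))) z = 24 * det (pencil A z)"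
    unfolding det_one_plus[of z "cmat A", unfolded t, folded pencil_def] p
    by (rule h) simp_all
  then show ?thesis by simp
qed

section \<open>Eigenvalues and the zeros of the determinant\<close>

lemma holomorphic_det:
  assumes "\<And>i j. (\<lambda>z. A z $ i $ j) holomorphic_on S"
  shows "(\<lambda>z. det (A z :: complex^'n^'n)) holomorphic_on S"
  unfolding det_def using assms by (intro holomorphic_intros) auto

lemma holomorphic_pencil: "(\<lambda>z. pencil A z $ i $ j) holomorphic_on S"
  unfolding pencil_def by (auto intro!: holomorphic_intros)

text \<open>A kernel vector v of a singular pencil satisfies v + zAv = 0, so it is an eigenvector
  for -1/z; at z = 0 the pencil is the identity and cannot be singular.\<close>

lemma EW_imp_pencil:
  assumes "det (pencil (\<eta> ** H) z) = 0"
  shows "z \<noteq> 0 \<and> - (1 / z) \<in> EW H"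
proof -
  have "z \<noteq> 0"
  proof
    assume "z = 0"
    then have "pencil (\<eta> ** H) z = mat 1" by (simp add: pencil_def mat_def vec_eq_iff)
    with assms show False by simp
  qed
  have "\<not> invertible (pencil (\<eta> ** H) z)" using assms by (simp add: invertible_det_nz)
  then obtain v where v: "pencil (\<eta> ** H) z *v v = 0" "v \<noteq> 0"
    unfolding invertible_left_inverse matrix_left_invertible_ker by blast
  have "z * (cmat (\<eta> ** H) *v v) $ i = - v $ i" for i
  proof -
    have "0 = (pencil (\<eta> ** H) z *v v) $ i" using v by simp
    also have "\<dots> = (\<Sum>j\<in>UNIV. (if i = j then v $ j else 0) + z * (cmat (\<eta> ** H) $ i $ j * v $ j))"
      unfolding matrix_vector_mult_def pencil_def by (auto intro!: sum.cong simp: algebra_simps)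
    also have "\<dots> = v $ i + z * (cmat (\<eta> ** H) *v v) $ i"
      by (simp add: sum.distrib matrix_vector_mult_def sum_distrib_left)
    finally show ?thesis by (simp add: eq_neg_iff_add_eq_0 add.commute)
  qed
  then have "cmat (\<eta> ** H) *v v = - (1 / z) *s v"
    using \<open>z \<noteq> 0\<close> by (simp add: vec_eq_iff field_simps)
  then show ?thesis using \<open>z \<noteq> 0\<close> v unfolding EW_def cmat_def by auto
qed

lemma pencil_imp_EW:
  assumes "c \<in> EW H" "c \<noteq> 0"
  shows "det (pencil (\<eta> ** H) (- (1 / c))) = 0"
proof -
  obtain v where v: "v \<noteq> 0" "cmat (\<eta> ** H) *v v = c *s v"
    using assms unfolding EW_def cmat_def by auto
  have "(pencil (\<eta> ** H) (- (1 / c)) *v v) $ i = 0" for i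
  proof -
    have "(pencil (\<eta> ** H) (- (1 / c)) *v v) $ i =
        (\<Sum>j\<in>UNIV. (if i = j then v $ j else 0) - 1 / c * (cmat (\<eta> ** H) $ i $ j * v $ j))"
      unfolding matrix_vector_mult_def pencil_def by (auto intro!: sum.cong simp: algebra_simps)
    also have "\<dots> = v $ i - 1 / c * (cmat (\<eta> ** H) *v v) $ i"
      by (simp add: sum_subtractf matrix_vector_mult_def sum_distrib_left)
    also have "\<dots> = 0" using v assms by simp
    finally show ?thesis .
  qed
  then have "pencil (\<eta> ** H) (- (1 / c)) *v v = 0" by (simp add: vec_eq_iff)
  then have "\<not> invertible (pencil (\<eta> ** H) (- (1 / c)))"
    unfolding invertible_left_inverse matrix_left_invertible_ker using v by blast
  then show ?thesis by (simp add: invertible_det_nz)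
qed

text \<open>Finiteness makes \<open>Max\<close> in the eigenvalue bound an actual maximum. Nonzero
  eigenvalues are negative reciprocals of roots of a polynomial with constant coefficient 1, which
  is therefore not the zero polynomial.\<close>

lemma finite_EW: "finite (EW H)"
proof -
  let ?p = "map_poly complex_of_real (e_poly (power_traces (\<eta> ** H)))"
  have "coeff ?p 0 = 1" by (simp add: e_poly_def coeff_map_poly)
  then have "?p \<noteq> 0" by (metis coeff_0 zero_neq_one)
  then have "finite {z. poly ?p z = 0}" by (rule poly_roots_finite)
  moreover have "EW H \<subseteq> insert 0 ((\<lambda>z. - (1 / z)) ` {z. poly ?p z = 0})"
  proof
    fix c assume "c \<in> EW H"
    then show "c \<in> insert 0 ((\<lambda>z. - (1 / z)) ` {z. poly ?p z = 0})"
      using pencil_imp_EW[of c H] det_pencil[of "\<eta> ** H" "- (1 / c)"]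
      by (cases "c = 0") (auto intro!: image_eqI[of _ _ "- (1 / c)"])
  qed
  ultimately show ?thesis using finite_subset by blast
qed

lemma small_imp_regular:
  assumes "\<bar>k\<bar> * Max (cmod ` EW H) < 1"
  shows "\<exists>R>\<bar>k\<bar>. regular R (\<eta> ** H)"
proof -
  \<comment> \<open>The outer maximum gives M \<ge> 0 without first showing that an eigenvalue
    exists.\<close>
  define M where "M = max 0 (Max (cmod ` EW H))"
  have M: "M \<ge> 0" "\<bar>k\<bar> * M < 1" using assms by (auto simp: M_def max_def)
  \<comment> \<open>The increment over |k| is chosen so that R M \<le> 1; the denominator M + 1
    keeps it positive and well defined even for M = 0.\<close>
  define R where "R = \<bar>k\<bar> + (1 - \<bar>k\<bar> * M) / (M + 1)"
  have "R > \<bar>k\<bar>" using M by (simp add: R_def)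
  have "(1 - \<bar>k\<bar> * M) * M \<le> (1 - \<bar>k\<bar> * M) * (M + 1)" using M by (intro mult_left_mono) auto
  then have "(1 - \<bar>k\<bar> * M) * M / (M + 1) \<le> 1 - \<bar>k\<bar> * M" using M by (simp add: field_simps)
  then have RM: "R * M \<le> 1" by (simp add: R_def algebra_simps)
  have "regular R (\<eta> ** H)"
    unfolding regular_def
  proof (intro allI impI notI)
    fix z assume z: "cmod z < R" "det (pencil (\<eta> ** H) z) = 0"
    then have "z \<noteq> 0" "- (1 / z) \<in> EW H" using EW_imp_pencil by auto
    then have "cmod (- (1 / z)) \<le> Max (cmod ` EW H)"
      using finite_EW by (intro Max_ge finite_imageI imageI)
    then have "1 / cmod z \<le> M" by (simp add: norm_divide M_def)
    then have "1 \<le> M * cmod z" using \<open>z \<noteq> 0\<close> by (simp add: field_simps)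
    also have "\<dots> \<le> M * R" using z M by (intro mult_left_mono) auto
    \<comment> \<open>The chain 1 \<le> M |z| \<le> M R \<le> 1 forces equality, which contradicts
      |z| < R once M > 0.\<close>
    finally have "M > 0" "M * R = 1" using RM M \<open>1 \<le> M * cmod z\<close>
      by (auto simp: mult.commute) (metis less_eq_real_def mult_zero_left not_one_le_zero)
    then have "M * cmod z < M * R" using z(1) mult_strict_left_mono by blast
    with \<open>1 \<le> M * cmod z\<close> \<open>M * R = 1\<close> show False by simp
  qed
  with \<open>R > \<bar>k\<bar>\<close> show ?thesis by blast
qed

section \<open>Inverse matrices and the resolvent\<close>

lemma matrix_inv_eqI:
  fixes A B :: "'a::field^'n^'n"
  assumes "A ** B = mat 1"
  shows "matrix_inv A = B"
proof -
  have BA: "B ** A = mat 1" using assms matrix_left_right_inverse by blast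
  have "A ** matrix_inv A = mat 1 \<and> matrix_inv A ** A = mat 1"
    unfolding matrix_inv_def by (rule someI[of _ B]) (use assms BA in auto)
  then show ?thesis by (metis BA matrix_mul_assoc matrix_mul_lid matrix_mul_rid)
qed

lemma matrix_inv_works:
  fixes A :: "'a::field^'n^'n"
  assumes "det A \<noteq> 0"
  shows "A ** matrix_inv A = mat 1" "matrix_inv A ** A = mat 1"
proof -
  obtain B where "A ** B = mat 1" using assms by (auto simp: invertible_def simp flip: invertible_det_nz)
  then show "A ** matrix_inv A = mat 1" "matrix_inv A ** A = mat 1"
    using matrix_inv_eqI[of A B] matrix_left_right_inverse by auto
qed

lemma holomorphic_imp_powser_on:
  assumes "f holomorphic_on ball 0 R"
  obtains F where "powser_on R (\<lambda>k. f (of_real k)) F"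
proof
  show "powser_on R (\<lambda>k. f (of_real k)) (Abs_fps (\<lambda>n. (deriv ^^ n) f 0 / fact n))"
    unfolding powser_on_def using holomorphic_power_series[OF assms] by auto
qed

text \<open>Cramer's rule makes the entries of the inverse holomorphic on the zero-free disc, so
  they have series there. The equation (1 + zA) F = 1 then forces the coefficients to be those of
  the Neumann series, although no norm of A is assumed small.\<close>

lemma resolvent_series:
  assumes reg: "regular R A" and R: "R > 0"
  shows "powser_on R (\<lambda>k. matrix_inv (pencil A (of_real k)) $ i $ j)
     (Abs_fps (\<lambda>m. of_real ((- 1) ^ m * mpow A m $ i $ j)))"
proof -
  define f where "f i j z = matrix_inv (pencil A z) $ i $ j" for i j z
  have "(f i j) holomorphic_on ball 0 R" for i j
  proof -
    \<comment> \<open>Column j of the inverse solves the linear system with right-hand side the j-th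
      unit vector.\<close>
    have "f i j z = det (\<chi> a b. if b = i then (if a = j then 1 else 0) else pencil A z $ a $ b) / det (pencil A z)"
      if "z \<in> ball 0 R" for z
    proof -
      have nz: "det (pencil A z) \<noteq> 0" using that reg by (auto simp: regular_def)
      have "pencil A z *v (\<chi> i. f i j z) = axis j 1"
        using arg_cong[OF matrix_inv_works(1)[OF nz], of "\<lambda>M. column j M"]
        by (simp add: f_def vec_eq_iff matrix_vector_mult_def matrix_matrix_mult_def column_def mat_def axis_def)
      from arg_cong[OF iffD1[OF cramer[OF nz] this], of "\<lambda>v. v $ i"]
      show ?thesis by (simp add: axis_def cong: if_cong)
    qed
    moreover have hol: "(\<lambda>z. (\<chi> a b. if b = i then (if a = j then 1 else 0) else pencil A z $ a $ b) $ a $ b)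
        holomorphic_on ball 0 R" for a b
      by (cases "b = i"; cases "a = j") (auto intro: holomorphic_pencil)
    moreover have "(\<lambda>z. det (\<chi> a b. if b = i then (if a = j then 1 else 0) else pencil A z $ a $ b) /
        det (pencil A z)) holomorphic_on ball 0 R"
      using reg unfolding regular_def
      by (intro holomorphic_on_divide holomorphic_det hol)
         (auto intro: holomorphic_pencil)
    ultimately show ?thesis using holomorphic_transform by fastforce
  qed
  then have "\<forall>i j. \<exists>F. powser_on R (\<lambda>k. f i j (of_real k)) F"
    using holomorphic_imp_powser_on by metis
  then obtain F where F: "\<And>i j. powser_on R (\<lambda>k. f i j (of_real k)) (F i j)" by metis
  \<comment> \<open>Read coefficient by coefficient, this is the recursion F(m+1) = -A F(m) with
    F(0) = 1.\<close>
  have eq: "F i j + fps_X * (\<Sum>l\<in>UNIV. fps_const (cmat A $ i $ l) * F l j) = fps_const (if i = j then 1 else 0)"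
    for i j
  proof (rule powser_on_unique[OF _ powser_on_const R])
    have *: "f i j z + z * (\<Sum>l\<in>UNIV. cmat A $ i $ l * f l j z) = (if i = j then 1 else 0)"
      if "cmod z < R" for z
    proof -
      have nz: "det (pencil A z) \<noteq> 0" using that reg by (auto simp: regular_def)
      have "(if i = j then 1 else 0) = (pencil A z ** matrix_inv (pencil A z)) $ i $ j"
        by (simp add: matrix_inv_works(1)[OF nz] mat_def)
      also have "\<dots> = (\<Sum>l\<in>UNIV. (if i = l then f l j z else 0) + z * (cmat A $ i $ l * f l j z))"
        unfolding matrix_matrix_mult_def pencil_def[of A z] f_def
        by (auto intro!: sum.cong simp: algebra_simps)
      finally show ?thesis by (simp add: sum.distrib sum_distrib_left)
    qed
    show "powser_on R (\<lambda>_. if i = j then 1 else 0)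
       (F i j + fps_X * (\<Sum>l\<in>UNIV. fps_const (cmat A $ i $ l) * F l j))"
      by (rule powser_on_cong[of _ "\<lambda>k. f i j (of_real k) + of_real k * (\<Sum>l\<in>UNIV. cmat A $ i $ l * f l j (of_real k))"])
         (auto intro!: powser_on_add powser_on_mult powser_on_X powser_on_sum powser_on_const F simp: *)
  qed
  have "fps_nth (F i j) m = of_real ((- 1) ^ m * mpow A m $ i $ j)" for m i j
  proof (induction m arbitrary: i j)
    case 0
    show ?case using arg_cong[OF eq[of i j], of "\<lambda>F. fps_nth F 0"] by (auto simp: mat_def)
  next
    case (Suc m)
    have "fps_nth (F i j) (Suc m) = - (\<Sum>l\<in>UNIV. cmat A $ i $ l * fps_nth (F l j) m)"
      using arg_cong[OF eq[of i j], of "\<lambda>F. fps_nth F (Suc m)"]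
      by (simp add: fps_sum_nth eq_neg_iff_add_eq_0)
    also have "\<dots> = of_real ((- 1) ^ Suc m * mpow A (Suc m) $ i $ j)"
      by (simp add: Suc matrix_matrix_mult_def cmat_def sum_distrib_left sum_negf[symmetric] algebra_simps)
    finally show ?case .
  qed
  then have "F i j = Abs_fps (\<lambda>m. of_real ((- 1) ^ m * mpow A m $ i $ j))" by (intro fps_ext) simp
  with F[of i j] show ?thesis by (simp add: f_def)
qed

text \<open>Absolute convergence of the resolvent series bounds the powers of A in terms of its
  eigenvalues; this takes the place of a spectral radius formula.\<close>

lemma summable_mpow:
  assumes "regular R A" "0 \<le> r" "r < R"
  shows "summable (\<lambda>m. \<bar>mpow A m $ i $ j\<bar> * r ^ m)"
proof -
  have "R > 0" using assms by simp
  from powser_on_summable_norm[OF resolvent_series[OF assms(1) this], of r i j] assms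
  show ?thesis by (simp add: norm_mult norm_power power_abs)
qed

section \<open>Series of the volume density and the vielbein\<close>

definition cfps :: "real fps \<Rightarrow> complex fps" where
  "cfps F = Abs_fps (\<lambda>m. of_real (fps_nth F m))"

lemma cfps_nth [simp]: "fps_nth (cfps F) m = of_real (fps_nth F m)"
  by (simp add: cfps_def)

lemma cfps_mult: "cfps (F * G) = cfps F * cfps G"
  by (rule fps_ext) (simp add: fps_mult_nth)

lemma powser_on_poly: "powser_on R (\<lambda>k. poly p (of_real k)) (fps_of_poly p)"
proof (induction p)
  case 0
  show ?case using powser_on_const[of R 0] by simp
next
  case (pCons a p)
  then show ?case
    using powser_on_add[OF powser_on_const[of R a] powser_on_mult[OF powser_on_X pCons.IH]]
    by (simp add: fps_of_poly_pCons mult.commute)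
qed

text \<open>The binomial series of (1 + X)^(1/2) composed with e1 X + e2 X^2 + e3 X^3 + e4 X^4. The
  inner series has constant term 0, so the composition is purely formal.\<close>

definition vol_fps :: "(nat \<Rightarrow> real) \<Rightarrow> real fps" where
  "vol_fps t = fps_binomial (1/2) oo (fps_of_poly (e_poly t) - 1)"

lemma vol_fps_square: "vol_fps t * vol_fps t = fps_of_poly (e_poly t)"
proof -
  have 0: "fps_nth (fps_of_poly (e_poly t) - 1) 0 = 0" by (simp add: e_poly_def)
  have "vol_fps t * vol_fps t = (fps_binomial (1/2) * fps_binomial (1/2)) oo (fps_of_poly (e_poly t) - 1)"
    unfolding vol_fps_def by (rule fps_compose_mult_distrib[OF 0, symmetric])
  also have "fps_binomial (1/2) * fps_binomial (1/2) = (1 + fps_X :: real fps)"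
    by (simp flip: fps_binomial_add_mult add: fps_binomial_1)
  also have "(1 + fps_X) oo (fps_of_poly (e_poly t) - 1) = fps_of_poly (e_poly t)"
    using 0 by (simp add: fps_compose_add_distrib)
  finally show ?thesis .
qed

lemma vol_fps_0: "fps_nth (vol_fps t) 0 = 1"
  by (simp add: vol_fps_def)

text \<open>In the integral domain of formal series (F - G)(F + G) = 0, and F + G has constant
  coefficient 2.\<close>

lemma fps_square_unique:
  fixes F G :: "complex fps"
  assumes "F * F = G * G" "fps_nth F 0 = 1" "fps_nth G 0 = 1"
  shows "F = G"
proof -
  have "(F - G) * (F + G) = 0" using assms(1) by (simp add: algebra_simps)
  moreover have "fps_nth (F + G) 0 \<noteq> 0" using assms by simp
  then have "F + G \<noteq> 0" by (metis fps_zero_nth)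
  ultimately show ?thesis by simp
qed

lemma pencil_of_real: "pencil A (of_real k) = cmat (mat 1 + k *\<^sub>R A)"
  by (simp add: pencil_def cmat_def mat_def vec_eq_iff)

text \<open>The determinant is 1 at coupling 0 and has no real zero in the interval, so the
  intermediate value theorem fixes its sign.\<close>

lemma regular_det_pos:
  assumes reg: "regular R A" and k: "\<bar>k\<bar> < R"
  shows "det (mat 1 + k *\<^sub>R A) > 0"
proof (rule ccontr)
  define D where "D k = det (mat 1 + k *\<^sub>R A)" for k
  assume "\<not> det (mat 1 + k *\<^sub>R A) > 0"
  then have Dk: "D k \<le> 0" by (simp add: D_def)
  have cont: "continuous_on S D" for S
    unfolding D_def det_def by (auto intro!: continuous_intros)
  have "connected (D ` {-R<..<R})" using cont by (intro connected_continuous_image) auto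
  moreover have "D 0 \<in> D ` {-R<..<R}" "D k \<in> D ` {-R<..<R}"
    using k by (auto simp: abs_less_iff intro!: imageI)
  moreover have "D 0 = 1" by (simp add: D_def)
  ultimately have "0 \<in> D ` {-R<..<R}" using Dk connectedD_interval[of _ "D k" "D 0" 0] by simp
  then obtain k' where k': "\<bar>k'\<bar> < R" "D k' = 0" by (force simp: abs_less_iff)
  then show False using reg by (auto simp: regular_def D_def pencil_of_real det_cmat dest!: spec[of _ "of_real k'"])
qed

text \<open>A zero-free holomorphic function on a disc has a holomorphic square root there, which
  yields a series with the full radius. Its coefficients are determined by its square and its value
  1 at 0.\<close>

lemma sqrt_det_series:
  assumes reg: "regular R A" and R: "R > 0"
  shows "powser_on R (\<lambda>k. of_real (sqrt (det (mat 1 + k *\<^sub>R A)))) (cfps (vol_fps (power_traces A)))"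
proof -
  define D where "D k = det (mat 1 + k *\<^sub>R A)" for k
  have D: "det (pencil A (of_real k)) = of_real (D k)" for k
    by (simp add: pencil_of_real det_cmat D_def)
  have Dpos: "D k > 0" if "\<bar>k\<bar> < R" for k
    using regular_det_pos[OF reg that] by (simp add: D_def)
  have D0: "D 0 = 1" by (simp add: D_def)
  have "(\<lambda>z. det (pencil A z)) holomorphic_on ball 0 R"
    by (intro holomorphic_det holomorphic_pencil)
  then obtain g where g: "g holomorphic_on ball 0 R" "\<And>z. z \<in> ball 0 R \<Longrightarrow> det (pencil A z) = g z ^ 2"
    using contractible_imp_holomorphic_sqrt[of _ "ball 0 R"] reg convex_imp_contractible[OF convex_ball]
    by (metis mem_ball_0 regular_def)
  have g0: "g 0 ^ 2 = 1" using g(2)[of 0] D[of 0] D0 R by simp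
  then have g0': "g 0 \<noteq> 0" by auto
  define f where "f z = g z / g 0" for z
  \<comment> \<open>A square root is fixed only up to sign; since \<open>g 0\<close> squares to 1,
    dividing by it selects the branch with value 1 at 0.\<close>
  have holf: "f holomorphic_on ball 0 R"
    unfolding f_def using g(1) g0' by (intro holomorphic_intros) auto
  have f2: "f (of_real k) ^ 2 = of_real (D k)" if "\<bar>k\<bar> < R" for k
    using g(2)[of "of_real k"] that by (simp add: f_def power_divide g0 D)
  have f0: "f 0 = 1" using g0' by (simp add: f_def)
  \<comment> \<open>The quotient of the holomorphic and the real root is continuous with values in
    {1, -1}, hence constant on the interval, and it equals 1 at 0.\<close>
  define q where "q k = f (of_real k) / of_real (sqrt (D k))" for k
  have "q constant_on {-R<..<R}"
  proof (rule continuous_finite_range_constant)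
    have "continuous_on {-R<..<R} (\<lambda>k. f (of_real k))"
      using holomorphic_on_imp_continuous_on[OF holf]
      by (rule continuous_on_compose2) (auto intro!: continuous_intros)
    moreover have "continuous_on S D" for S
      unfolding D_def det_def by (auto intro!: continuous_intros)
    ultimately show "continuous_on {-R<..<R} q"
      unfolding q_def using Dpos
      by (intro continuous_intros) (force simp: abs_less_iff)+
    have "q k = 1 \<or> q k = -1" if "\<bar>k\<bar> < R" for k
    proof -
      have "q k ^ 2 = 1"
        using Dpos[OF that] by (simp add: q_def power_divide f2[OF that] flip: of_real_power)
      then show ?thesis by (simp add: power2_eq_1_iff)
    qed
    then have "q ` {-R<..<R} \<subseteq> {1, -1}" by (auto simp: abs_less_iff) (metis minus_less_iff)
    then show "finite (q ` {-R<..<R})" by (rule finite_subset) auto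
  qed auto
  then have "q k = q 0" if "\<bar>k\<bar> < R" for k
    using that R unfolding constant_on_def by (metis abs_less_iff greaterThanLessThan_iff neg_less_0_iff_less minus_less_iff)
  then have "q k = 1" if "\<bar>k\<bar> < R" for k using that by (simp add: q_def f0 D0)
  then have f: "f (of_real k) = of_real (sqrt (D k))" if "\<bar>k\<bar> < R" for k
    using that Dpos[OF that] by (simp add: q_def field_simps)
  obtain F where F: "powser_on R (\<lambda>k. f (of_real k)) F" using holomorphic_imp_powser_on[OF holf] .
  have "F = cfps (vol_fps (power_traces A))"
  proof (rule fps_square_unique)
    have "powser_on R (\<lambda>k. f (of_real k) * f (of_real k)) (fps_of_poly (map_poly of_real (e_poly (power_traces A))))"
      using powser_on_poly
      by (rule powser_on_cong) (use D f2 in \<open>simp add: power2_eq_square det_pencil[symmetric]\<close>)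
    then have "F * F = fps_of_poly (map_poly of_real (e_poly (power_traces A)))"
      using powser_on_unique[OF powser_on_mult[OF F F] _ R] by blast
    also have "\<dots> = cfps (fps_of_poly (e_poly (power_traces A)))"
      by (rule fps_ext) (simp add: coeff_map_poly)
    finally show "F * F = cfps (vol_fps (power_traces A)) * cfps (vol_fps (power_traces A))"
      by (simp add: vol_fps_square flip: cfps_mult)
    have "(\<lambda>m. fps_nth F m * 0 ^ m) sums 1" using F R f0 by (auto simp: powser_on_def dest: spec[of _ 0])
    then show "fps_nth F 0 = 1" using powser_sums_zero sums_unique2 by blast
    show "fps_nth (cfps (vol_fps (power_traces A))) 0 = 1" by (simp add: vol_fps_0)
  qed
  with F show ?thesis
    by (auto intro: powser_on_cong simp: f[unfolded D_def])
qed

section \<open>Series of the inverse metric, the volume density and the vielbein\<close>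

lemma eta_component: "\<eta> $ i $ j = (if i = j then if i = 0 then 1 else -1 else 0)"
  by (simp add: \<eta>_def)

lemma matrix_mult_eta: "(M ** \<eta>) $ i $ j = M $ i $ j * \<eta> $ j $ j"
proof -
  have "(M ** \<eta>) $ i $ j = (\<Sum>l\<in>UNIV. if l = j then M $ i $ j * \<eta> $ j $ j else 0)"
    unfolding matrix_matrix_mult_def vec_lambda_beta
    by (rule sum.cong) (auto simp: eta_component cong: if_cong)
  then show ?thesis by simp
qed

lemma eta_mult_eta: "\<eta> ** \<eta> = mat 1"
  by (simp add: vec_eq_iff matrix_mult_eta) (simp add: eta_component mat_def)

lemma det_eta: "det \<eta> = - 1"
  by (simp add: det_4 eta_component)

lemma hpow_eq: "hpow H m = mpow (\<eta> ** H) m ** \<eta>"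
  by (induction m) (simp_all add: mpow_Suc_right matrix_mul_assoc del: mpow.simps(2))

lemma abs_hpow: "\<bar>hpow H m $ i $ j\<bar> = \<bar>mpow (\<eta> ** H) m $ i $ j\<bar>"
  by (simp add: hpow_eq matrix_mult_eta abs_mult eta_component)

lemma metric_eq: "metric k h x = \<eta> ** (mat 1 + k *\<^sub>R (\<eta> ** h x))"
proof -
  have "\<eta> ** (k *\<^sub>R M) = k *\<^sub>R (\<eta> ** M)" for M :: "real^4^4"
    by (simp add: matrix_matrix_mult_def vec_eq_iff sum_distrib_left algebra_simps)
  then show ?thesis
    by (simp add: metric_def matrix_add_ldistrib matrix_mul_assoc eta_mult_eta)
qed

text \<open>The quotient of consecutive coefficients has modulus |a - m| / (m + 1) \<le> 1. Hence
  the exponents 1/2 and -1/2 do not reduce the radius of convergence.\<close>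

lemma abs_gbinomial_le_1:
  assumes "\<bar>a\<bar> \<le> (1::real)"
  shows "\<bar>a gchoose m\<bar> \<le> 1"
proof (induction m)
  case (Suc m)
  have "of_nat (Suc m) * (a gchoose Suc m) = (a - of_nat m) * (a gchoose m)"
    using gbinomial_mult_1[of a m] by (simp add: algebra_simps)
  then have "real (Suc m) * \<bar>a gchoose Suc m\<bar> = \<bar>a - real m\<bar> * \<bar>a gchoose m\<bar>"
    by (metis abs_mult abs_of_nat)
  also have "\<dots> \<le> real (Suc m) * 1" using assms Suc by (intro mult_mono) auto
  finally show ?case by (simp only: mult_le_cancel_left_pos of_nat_0_less_iff zero_less_Suc)
qed auto

lemma matrix_inv_cmat:
  assumes "det M \<noteq> 0"
  shows "matrix_inv (cmat M) = cmat (matrix_inv M)"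
  by (rule matrix_inv_eqI) (simp add: matrix_inv_works[OF assms] cmat_mat_1 flip: cmat_mult)

definition ginv_fps :: "real^4^4 \<Rightarrow> 4 \<Rightarrow> 4 \<Rightarrow> real fps" where
  "ginv_fps H i j = Abs_fps (\<lambda>m. (- 1) ^ m * hpow H m $ i $ j)"

text \<open>The metric is \<open>\<eta>\<close> times 1 + k\<open>\<eta>\<close>h, so its inverse is
  the resolvent times \<open>\<eta>\<close>; the right factor \<open>\<eta>\<close> turns
  \<open>mpow\<close> into \<open>hpow\<close>.\<close>

lemma inverse_metric_series:
  assumes reg: "regular R (\<eta> ** h x)" and R: "R > 0"
  shows "powser_on R (\<lambda>k. of_real (inverse_metric k h x $ i $ j)) (cfps (ginv_fps (h x) i j))"
proof (rule powser_on_cong)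
  let ?A = "\<eta> ** h x"
  have "powser_on R (\<lambda>k. matrix_inv (pencil ?A (of_real k)) $ i $ j * of_real (\<eta> $ j $ j))
     (Abs_fps (\<lambda>m. of_real ((- 1) ^ m * mpow ?A m $ i $ j)) * fps_const (of_real (\<eta> $ j $ j)))"
    by (intro powser_on_mult powser_on_const resolvent_series[OF reg R])
  also have "Abs_fps (\<lambda>m. of_real ((- 1) ^ m * mpow ?A m $ i $ j)) * fps_const (of_real (\<eta> $ j $ j)) =
      cfps (ginv_fps (h x) i j)"
    by (rule fps_ext) (simp add: ginv_fps_def hpow_eq matrix_mult_eta)
  finally show "powser_on R (\<lambda>k. matrix_inv (pencil ?A (of_real k)) $ i $ j * of_real (\<eta> $ j $ j))
     (cfps (ginv_fps (h x) i j))" .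
next
  fix k :: real assume k: "\<bar>k\<bar> < R"
  let ?M = "mat 1 + k *\<^sub>R (\<eta> ** h x)"
  have nz: "det ?M \<noteq> 0" using regular_det_pos[OF reg k] by simp
  have "metric k h x ** (matrix_inv ?M ** \<eta>) = \<eta> ** (?M ** matrix_inv ?M) ** \<eta>"
    by (simp only: metric_eq matrix_mul_assoc)
  then have "inverse_metric k h x = matrix_inv ?M ** \<eta>"
    unfolding inverse_metric_def
    by (intro matrix_inv_eqI) (simp add: matrix_inv_works(1)[OF nz] eta_mult_eta)
  then show "matrix_inv (pencil (\<eta> ** h x) (of_real k)) $ i $ j * of_real (\<eta> $ j $ j) =
      of_real (inverse_metric k h x $ i $ j)"
    by (simp add: pencil_of_real matrix_inv_cmat[OF nz] matrix_mult_eta) (simp add: cmat_def)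
qed

text \<open>The Lorentzian sign det \<open>\<eta>\<close> = -1 absorbs the minus sign under the
  root.\<close>

lemma volume_series:
  assumes reg: "regular R (\<eta> ** h x)" and R: "R > 0"
  shows "powser_on R (\<lambda>k. of_real (sqrt (- det (metric k h x)))) (cfps (vol_fps (power_traces (\<eta> ** h x))))"
  using sqrt_det_series[OF reg R] by (simp add: metric_eq det_mul det_eta)

lemma summable_binomial:
  assumes reg: "regular R (\<eta> ** H)" and a: "\<bar>a\<bar> \<le> 1" and k: "\<bar>k\<bar> < R"
  shows "summable (\<lambda>m. k ^ m * (a gchoose m) * hpow H m $ i $ j)"
proof (rule summable_comparison_test')
  show "summable (\<lambda>m. \<bar>mpow (\<eta> ** H) m $ i $ j\<bar> * \<bar>k\<bar> ^ m)"
    using summable_mpow[OF reg, of "\<bar>k\<bar>" i j] k by simp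
  fix m :: nat
  have "\<bar>a gchoose m\<bar> * (\<bar>k\<bar> ^ m * \<bar>hpow H m $ i $ j\<bar>) \<le> 1 * (\<bar>k\<bar> ^ m * \<bar>hpow H m $ i $ j\<bar>)"
    using abs_gbinomial_le_1[OF a] by (intro mult_right_mono) auto
  then show "norm (k ^ m * (a gchoose m) * hpow H m $ i $ j) \<le> \<bar>mpow (\<eta> ** H) m $ i $ j\<bar> * \<bar>k\<bar> ^ m"
    by (simp add: abs_mult abs_hpow power_abs ac_simps)
qed

lemma powser_on_of_real:
  assumes "\<And>k. \<bar>k\<bar> < R \<Longrightarrow> (\<lambda>m. k ^ m * c m) sums f k"
  shows "powser_on R (\<lambda>k. of_real (f k)) (cfps (Abs_fps c))"
  unfolding powser_on_def
proof (intro allI impI)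
  fix k :: real assume "\<bar>k\<bar> < R"
  from sums_of_real[OF assms[OF this], where ?'a = complex]
  show "(\<lambda>m. fps_nth (cfps (Abs_fps c)) m * complex_of_real k ^ m) sums of_real (f k)"
    by (simp add: ac_simps)
qed

lemma eta_sum: "(\<Sum>\<nu>\<in>UNIV. \<eta> $ \<mu> $ \<nu> * f \<nu>) = \<eta> $ \<mu> $ \<mu> * f \<mu>"
proof -
  have "(\<Sum>\<nu>\<in>UNIV. \<eta> $ \<mu> $ \<nu> * f \<nu>) = (\<Sum>\<nu>\<in>UNIV. if \<nu> = \<mu> then \<eta> $ \<mu> $ \<mu> * f \<mu> else 0)"
    by (rule sum.cong) (auto simp: eta_component)
  then show ?thesis by simp
qed

definition viel_fps :: "real^4^4 \<Rightarrow> 4 \<Rightarrow> 4 \<Rightarrow> real fps" where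
  "viel_fps H i j = Abs_fps (\<lambda>m. ((1/2) gchoose m) * (\<Sum>\<nu>\<in>UNIV. \<eta> $ i $ \<nu> * hpow H m $ \<nu> $ j))"

definition iviel_fps :: "real^4^4 \<Rightarrow> 4 \<Rightarrow> 4 \<Rightarrow> real fps" where
  "iviel_fps H i j = Abs_fps (\<lambda>m. ((- 1/2) gchoose m) * hpow H m $ i $ j)"

lemma inverse_vielbein_series:
  assumes reg: "regular R (\<eta> ** h x)"
  shows "powser_on R (\<lambda>k. of_real (inverse_vielbein k h x $ i $ j)) (cfps (iviel_fps (h x) i j))"
  unfolding iviel_fps_def
proof (rule powser_on_of_real)
  fix k :: real assume "\<bar>k\<bar> < R"
  from summable_sums[OF summable_binomial[OF reg _ this, of "-1/2" i j]]
  show "(\<lambda>m. k ^ m * (((- 1/2) gchoose m) * hpow (h x) m $ i $ j)) sums inverse_vielbein k h x $ i $ j"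
    by (simp add: inverse_vielbein_def ac_simps)
qed

lemma vielbein_sums:
  assumes reg: "regular R (\<eta> ** h x)" and k: "\<bar>k\<bar> < R"
  shows "(\<lambda>m. k ^ m * (((1/2) gchoose m) * (\<Sum>\<nu>\<in>UNIV. \<eta> $ i $ \<nu> * hpow (h x) m $ \<nu> $ j))) sums
    (vielbein k h x $ i $ j)"
proof -
  have "summable (\<lambda>m. \<eta> $ i $ i * (k ^ m * ((1/2) gchoose m) * hpow (h x) m $ i $ j))"
    by (intro summable_mult summable_binomial[OF reg _ k]) simp
  from summable_sums[OF this] show ?thesis by (simp add: vielbein_def eta_sum ac_simps)
qed

lemma vielbein_series:
  assumes reg: "regular R (\<eta> ** h x)"
  shows "powser_on R (\<lambda>k. of_real (vielbein k h x $ i $ j)) (cfps (viel_fps (h x) i j))"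
  unfolding viel_fps_def by (intro powser_on_of_real vielbein_sums[where h = h and x = x, OF reg])

subsection \<open>Differentiation of the vielbein\<close>

text \<open>The entrywise 1-norm dominates every entry, is submultiplicative, and passes to limits
  as a finite sum of entries.\<close>

definition mnorm :: "real^'n^'n \<Rightarrow> real" where
  "mnorm M = (\<Sum>i\<in>UNIV. \<Sum>j\<in>UNIV. \<bar>M $ i $ j\<bar>)"

lemma mnorm_nonneg: "mnorm M \<ge> 0"
  unfolding mnorm_def by (intro sum_nonneg) auto

lemma component_le_mnorm: "\<bar>M $ i $ j\<bar> \<le> mnorm M"
proof -
  have "\<bar>M $ i $ j\<bar> \<le> (\<Sum>j\<in>UNIV. \<bar>M $ i $ j\<bar>)" by (rule member_le_sum) auto
  also have "\<dots> \<le> mnorm M" unfolding mnorm_def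
    by (rule member_le_sum) (auto intro: sum_nonneg)
  finally show ?thesis .
qed

lemma mnorm_add: "mnorm (M + N) \<le> mnorm M + mnorm N"
  unfolding mnorm_def sum.distrib[symmetric] by (intro sum_mono) (simp add: abs_triangle_ineq)

lemma mnorm_mult: "mnorm (M ** N) \<le> mnorm M * mnorm N"
proof -
  have "mnorm (M ** N) \<le> (\<Sum>i\<in>UNIV. \<Sum>j\<in>UNIV. \<Sum>l\<in>UNIV. \<bar>M $ i $ l\<bar> * \<bar>N $ l $ j\<bar>)"
    unfolding mnorm_def matrix_matrix_mult_def
    by (intro sum_mono) (simp add: abs_mult[symmetric])
  also have "\<dots> = (\<Sum>i\<in>UNIV. \<Sum>l\<in>UNIV. \<bar>M $ i $ l\<bar> * (\<Sum>j\<in>UNIV. \<bar>N $ l $ j\<bar>))"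
    by (subst sum.swap) (simp add: sum_distrib_left)
  also have "\<dots> \<le> (\<Sum>i\<in>UNIV. \<Sum>l\<in>UNIV. \<bar>M $ i $ l\<bar> * mnorm N)"
    unfolding mnorm_def by (intro sum_mono mult_left_mono member_le_sum) (auto intro: sum_nonneg)
  also have "\<dots> = mnorm M * mnorm N"
    by (simp add: mnorm_def[of M] sum_distrib_right)
  finally show ?thesis .
qed

lemma mnorm_scaleR: "mnorm (c *\<^sub>R M) = \<bar>c\<bar> * mnorm M"
  by (simp add: mnorm_def abs_mult sum_distrib_left)

lemma mpow_scaleR: "mpow (c *\<^sub>R M) m = c ^ m *\<^sub>R mpow M m" for M :: "real^'n^'n"
proof (induction m)
  case (Suc m)
  then show ?case
    by (simp add: vec_eq_iff matrix_matrix_mult_def sum_distrib_left ac_simps)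
qed simp

text \<open>Split off N factors as long as possible; each such step costs a factor of at most 1, and
  fewer than N factors remain. The criterion involves only \<open>X\<close> and one of its powers,
  so it is stable under small perturbations.\<close>

lemma mpow_bounded:
  fixes X :: "real^'n^'n"
  assumes N: "mnorm (mpow X N) \<le> 1" "N > 0" and K: "mnorm X \<le> K" "1 \<le> K"
  shows "mnorm (mpow X m) \<le> mnorm (mat 1 :: real^'n^'n) * K ^ N"
proof (induction m rule: less_induct)
  case (less m)
  show ?case
  proof (cases "m < N")
    case True
    have "mnorm (mpow X m) \<le> mnorm (mat 1 :: real^'n^'n) * K ^ m"
    proof (induction m)
      case (Suc m)
      have "mnorm (mpow X (Suc m)) \<le> mnorm X * mnorm (mpow X m)" by (simp add: mnorm_mult)
      also have "\<dots> \<le> K * (mnorm (mat 1 :: real^'n^'n) * K ^ m)"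
        using Suc K by (intro mult_mono mnorm_nonneg) auto
      finally show ?case by (simp add: ac_simps)
    qed simp
    also have "\<dots> \<le> mnorm (mat 1 :: real^'n^'n) * K ^ N"
      using True K by (intro mult_left_mono power_increasing mnorm_nonneg) auto
    finally show ?thesis .
  next
    case False
    then have "mpow X m = mpow X N ** mpow X (m - N)" by (simp flip: mpow_add)
    then have "mnorm (mpow X m) \<le> mnorm (mpow X N) * mnorm (mpow X (m - N))" by (simp add: mnorm_mult)
    also have "\<dots> \<le> 1 * mnorm (mpow X (m - N))" using N by (intro mult_right_mono mnorm_nonneg)
    also have "\<dots> \<le> mnorm (mat 1 :: real^'n^'n) * K ^ N" using less[of "m - N"] False N by simp
    finally show ?thesis .
  qed
qed

lemma matrix_diff_mult_left: "(A - B) ** C = A ** C - B ** C" for A B C :: "real^'n^'n"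
  by (simp add: matrix_matrix_mult_def vec_eq_iff sum_subtractf algebra_simps)

lemma matrix_diff_mult_right: "A ** (B - C) = A ** B - A ** C" for A B C :: "real^'n^'n"
  by (simp add: matrix_matrix_mult_def vec_eq_iff sum_subtractf algebra_simps)

text \<open>The difference of m-th powers telescopes into m terms of the form Y^a (Y - Z) Z^b with a
  + b + 1 = m. Each outer power is controlled by \<open>C\<close>, and the middle factor uses up one
  power of \<open>r\<close>.\<close>

lemma mpow_diff_bound:
  fixes Y Z :: "real^'n^'n"
  assumes C: "\<And>m. mnorm (mpow Y m) * r ^ m \<le> C" "\<And>m. mnorm (mpow Z m) * r ^ m \<le> C" and r: "r \<ge> 0"
  shows "mnorm (mpow Y m - mpow Z m) * r ^ m \<le> real m * (C\<^sup>2 * r * mnorm (Y - Z))"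
proof -
  have C0: "C \<ge> 0" using C(1)[of 0] mnorm_nonneg[of "mpow Y 0"] by simp
  \<comment> \<open>The additional factor \<open>mpow Z l\<close> collects the powers of Z split off
    on the right, which makes the induction close.\<close>
  have "mnorm ((mpow Y m - mpow Z m) ** mpow Z l) * r ^ (m + l) \<le> real m * (C\<^sup>2 * r * mnorm (Y - Z))" for l
  proof (induction m arbitrary: l)
    case 0
    then show ?case by (simp add: mnorm_def matrix_matrix_mult_def)
  next
    case (Suc m)
    have "(mpow Y (Suc m) - mpow Z (Suc m)) ** mpow Z l =
        mpow Y m ** (Y - Z) ** mpow Z l + (mpow Y m - mpow Z m) ** mpow Z (Suc l)"
      unfolding mpow_Suc_right[of Y] mpow_Suc_right[of Z m]
      by (simp add: matrix_diff_mult_left matrix_diff_mult_right matrix_mul_assoc)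
    then have "mnorm ((mpow Y (Suc m) - mpow Z (Suc m)) ** mpow Z l) * r ^ (Suc m + l) \<le>
        (mnorm (mpow Y m ** (Y - Z) ** mpow Z l) + mnorm ((mpow Y m - mpow Z m) ** mpow Z (Suc l))) * r ^ (Suc m + l)"
      using r by (simp only:) (intro mult_right_mono mnorm_add zero_le_power)
    also have "\<dots> = mnorm (mpow Y m ** (Y - Z) ** mpow Z l) * r ^ (Suc m + l) +
        mnorm ((mpow Y m - mpow Z m) ** mpow Z (Suc l)) * r ^ (m + Suc l)"
      by (simp add: distrib_right)
    also have "mnorm (mpow Y m ** (Y - Z) ** mpow Z l) * r ^ (Suc m + l) \<le>
        (mnorm (mpow Y m) * mnorm (Y - Z) * mnorm (mpow Z l)) * r ^ (Suc m + l)"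
      using r by (intro mult_right_mono order_trans[OF mnorm_mult] mnorm_mult mnorm_nonneg zero_le_power)
    also have "\<dots> = (mnorm (mpow Y m) * r ^ m) * (mnorm (mpow Z l) * r ^ l) * (r * mnorm (Y - Z))"
      by (simp add: power_add ac_simps)
    also have "\<dots> \<le> C * C * (r * mnorm (Y - Z))"
      using C C0 r by (intro mult_right_mono mult_mono mult_nonneg_nonneg mnorm_nonneg zero_le_power)
    also have "mnorm ((mpow Y m - mpow Z m) ** mpow Z (Suc l)) * r ^ (m + Suc l) \<le>
        real m * (C\<^sup>2 * r * mnorm (Y - Z))" by (rule Suc)
    finally show ?case by (simp add: power2_eq_square algebra_simps)
  qed
  from this[of 0] show ?thesis by simp
qed

lemma mpow_tendsto:
  fixes B :: "'a \<Rightarrow> real^'n^'n"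
  assumes "(B \<longlongrightarrow> B0) F"
  shows "((\<lambda>s. mpow (B s) m $ i $ j) \<longlongrightarrow> mpow B0 m $ i $ j) F"
proof (induction m arbitrary: i j)
  case (Suc m)
  have "((\<lambda>s. B s $ i $ l) \<longlongrightarrow> B0 $ i $ l) F" for l
    by (intro tendsto_vec_nth assms)
  then show ?case using Suc by (auto simp: matrix_matrix_mult_def intro!: tendsto_sum tendsto_mult)
qed simp

lemma mnorm_mpow_tendsto:
  fixes B :: "'a \<Rightarrow> real^'n^'n"
  assumes "(B \<longlongrightarrow> B0) F"
  shows "((\<lambda>s. mnorm (mpow (B s) m)) \<longlongrightarrow> mnorm (mpow B0 m)) F"
  unfolding mnorm_def by (intro tendsto_sum tendsto_rabs mpow_tendsto assms)

lemma matrix_component_derivative: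
  fixes B :: "real \<Rightarrow> real^'n^'m"
  assumes "(B has_vector_derivative B') (at s)"
  shows "((\<lambda>s. B s $ i $ j) has_real_derivative B' $ i $ j) (at s)"
  using bounded_linear.has_vector_derivative[OF bounded_linear_vec_nth, OF
      bounded_linear.has_vector_derivative[OF bounded_linear_vec_nth, OF assms]]
  by (simp add: has_real_derivative_iff_has_vector_derivative)

lemma mpow_differentiable:
  fixes B :: "real \<Rightarrow> real^'n^'n"
  assumes "(B has_vector_derivative B') (at 0)"
  shows "\<exists>d. ((\<lambda>s. mpow (B s) m $ i $ j) has_real_derivative d) (at 0)"
proof (induction m arbitrary: i j)
  case 0
  show ?case by (auto intro: exI[of _ 0])
next
  case (Suc m)
  note B = matrix_component_derivative[OF assms, of i]
  have "\<forall>l. \<exists>d. ((\<lambda>s. mpow (B s) m $ l $ j) has_real_derivative d) (at 0)" using Suc by simp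
  from choice[OF this]
  obtain d where d: "\<And>l. ((\<lambda>s. mpow (B s) m $ l $ j) has_real_derivative d l) (at 0)" by blast
  have "((\<lambda>s. mpow (B s) (Suc m) $ i $ j) has_real_derivative
      (\<Sum>l\<in>UNIV. B' $ i $ l * mpow (B 0) m $ l $ j + d l * B 0 $ i $ l)) (at 0)"
    unfolding mpow.simps matrix_matrix_mult_def vec_lambda_beta by (intro DERIV_sum DERIV_mult B d)
  then show ?case by blast
qed

text \<open>The powers of r B(0) tend to 0, so one of them has norm below 1. This strict inequality
  and a bound on the matrix itself persist near 0, and \<open>mpow_bounded\<close> turns them into a
  bound uniform in the exponent.\<close>

lemma eventually_mpow_bounded:
  assumes reg: "regular R (B 0)" and B: "(B \<longlongrightarrow> B 0) (at 0)" and r: "0 < r" "r < R"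
  shows "\<exists>C. \<forall>\<^sub>F s in at 0. \<forall>m. mnorm (mpow (B s) m) * r ^ m \<le> C"
proof -
  define X where "X s = r *\<^sub>R B s" for s
  have X: "mnorm (mpow (B s) m) * r ^ m = mnorm (mpow (X s) m)" for s m
    using r by (simp add: X_def mpow_scaleR mnorm_scaleR)
  have tX: "(X \<longlongrightarrow> X 0) (at 0)" unfolding X_def by (intro tendsto_scaleR tendsto_const B)
  have "summable (\<lambda>m. \<Sum>i\<in>UNIV. \<Sum>j\<in>UNIV. \<bar>mpow (B 0) m $ i $ j\<bar> * r ^ m)"
    using r by (intro summable_sum summable_mpow[OF reg]) auto
  then have "(\<lambda>m. mnorm (mpow (X 0) m)) \<longlonglongrightarrow> 0"
    unfolding X[symmetric] by (simp add: mnorm_def sum_distrib_right summable_LIMSEQ_zero)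
  then have "\<forall>\<^sub>F m in sequentially. mnorm (mpow (X 0) m) < 1" by (rule order_tendstoD) simp
  then obtain N0 where "\<And>m. m \<ge> N0 \<Longrightarrow> mnorm (mpow (X 0) m) < 1"
    unfolding eventually_sequentially by blast
  \<comment> \<open>The successor of \<open>N0\<close> is taken because the exponent must be
    positive.\<close>
  then obtain N where N: "mnorm (mpow (X 0) N) < 1" "N > 0"
    using that[of "Suc N0"] by (meson le_SucI order_refl zero_less_Suc)
  define K where "K = mnorm (X 0) + 1"
  have "\<forall>\<^sub>F s in at 0. mnorm (mpow (X s) N) < 1"
    by (rule order_tendstoD(2)[OF mnorm_mpow_tendsto[OF tX] N(1)])
  moreover have "\<forall>\<^sub>F s in at 0. mnorm (mpow (X s) 1) < K"
    by (rule order_tendstoD(2)[OF mnorm_mpow_tendsto[OF tX]]) (simp add: K_def)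
  ultimately have "\<forall>\<^sub>F s in at 0. \<forall>m. mnorm (mpow (B s) m) * r ^ m \<le> mnorm (mat 1 :: real^4^4) * K ^ N"
    unfolding X
  proof eventually_elim
    case (elim s)
    then show ?case
      using N mnorm_nonneg[of "X 0"] by (intro allI mpow_bounded) (auto simp: K_def)
  qed
  then show ?thesis by blast
qed

text \<open>The curve is only assumed to be differentiable at 0, so the derivatives of the terms need
  not be bounded near 0. Therefore the limit of the difference quotient is exchanged with the sum,
  instead of differentiating termwise.\<close>

lemma matrix_series_derivative:
  fixes B :: "real \<Rightarrow> real^4^4"
  assumes reg: "regular R (B 0)" and B: "(B has_vector_derivative B') (at 0)" and k: "\<bar>k\<bar> < R"
    and c: "\<And>m. \<bar>c m\<bar> \<le> 1"
  shows "(\<lambda>m. k ^ m * (c m * deriv (\<lambda>s. mpow (B s) m $ i $ j) 0)) sums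
    deriv (\<lambda>s. \<Sum>m. k ^ m * (c m * mpow (B s) m $ i $ j)) 0"
proof -
  \<comment> \<open>The gap below R bounds the powers uniformly near 0, and the gap above |k| yields
    the geometric factor \<open>q\<close>.\<close>
  obtain r where r: "\<bar>k\<bar> < r" "r < R" using k dense by blast
  then have r0: "r > 0" by simp
  define q where "q = \<bar>k\<bar> / r"
  have q: "0 \<le> q" "q < 1" using r r0 by (auto simp: q_def)
  have tB: "(B \<longlongrightarrow> B 0) (at 0)"
    using has_vector_derivative_continuous[OF B] by (simp add: continuous_within)
  obtain C where C: "\<forall>\<^sub>F s in at 0. \<forall>m. mnorm (mpow (B s) m) * r ^ m \<le> C"
    using eventually_mpow_bounded[OF reg tB r0 r(2)] by blast
  \<comment> \<open>The filter \<open>at 0\<close> excludes the point 0 itself, so the bound there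
    is recovered as a limit.\<close>
  have C0: "mnorm (mpow (B 0) m) * r ^ m \<le> C" for m
    using C by (intro tendsto_le[OF _ tendsto_const tendsto_mult_right[OF mnorm_mpow_tendsto[OF tB]]])
      (auto elim: eventually_mono)
  have Cpos: "C \<ge> 0" using C0[of 0] mnorm_nonneg[of "mpow (B 0) 0"] by simp
  have quot: "((\<lambda>s. (B s - B 0) /\<^sub>R s) \<longlongrightarrow> B') (at 0)"
  proof (intro vec_tendstoI)
    fix i j
    show "((\<lambda>s. ((B s - B 0) /\<^sub>R s) $ i $ j) \<longlongrightarrow> B' $ i $ j) (at 0)"
      using matrix_component_derivative[OF B, of i j] by (simp add: DERIV_def divide_inverse mult.commute)
  qed
  define L where "L = mnorm B' + 1"
  have "((\<lambda>s. mnorm (mpow ((B s - B 0) /\<^sub>R s) 1)) \<longlongrightarrow> mnorm (mpow B' 1)) (at 0)"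
    by (rule mnorm_mpow_tendsto[OF quot])
  then have L: "\<forall>\<^sub>F s in at 0. mnorm ((B s - B 0) /\<^sub>R s) < L"
    using order_tendstoD(2)[of _ "mnorm B'" _ L] by (simp add: L_def)
  define d where "d m = deriv (\<lambda>s. mpow (B s) m $ i $ j) 0" for m
  have d: "((\<lambda>s. mpow (B s) m $ i $ j) has_real_derivative d m) (at 0)" for m
    using mpow_differentiable[OF B, of m i j] by (auto simp: d_def DERIV_imp_deriv)
  define a where "a m s = k ^ m * (c m * ((mpow (B s) m $ i $ j - mpow (B 0) m $ i $ j) / s))" for m s
  \<comment> \<open>The linear factor is the number of telescoping terms; \<open>Suc m\<close>
    matches the derivative of the geometric series, which shows summability.\<close>
  define M where "M m = real (Suc m) * q ^ m * (C\<^sup>2 * r * L)" for m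
  have summ: "summable (\<lambda>m. k ^ m * (c m * mpow (B s) m $ i $ j))"
    if "\<And>m. mnorm (mpow (B s) m) * r ^ m \<le> C" for s
  proof (rule summable_comparison_test')
    show "summable (\<lambda>m. q ^ m * C)" using q by (intro summable_mult2 summable_geometric) auto
    fix m
    have "\<bar>c m * (k ^ m * mpow (B s) m $ i $ j)\<bar> \<le> 1 * (\<bar>k\<bar> ^ m * mnorm (mpow (B s) m))"
      unfolding abs_mult power_abs by (intro mult_mono[OF c] component_le_mnorm mult_left_mono) auto
    also have "\<dots> = q ^ m * (mnorm (mpow (B s) m) * r ^ m)"
      using r0 by (simp add: q_def power_divide)
    also have "\<dots> \<le> q ^ m * C" using that q by (intro mult_left_mono) auto
    finally show "norm (k ^ m * (c m * mpow (B s) m $ i $ j)) \<le> q ^ m * C" by (simp add: ac_simps)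
  qed
  \<comment> \<open>Dominated convergence for series: the bound on the difference quotients is
    summable and independent of \<open>s\<close> near 0.\<close>
  have "eventually (\<lambda>s. summable (\<lambda>m. norm (a m s))) (at 0) \<and>
      summable (\<lambda>m. norm (k ^ m * (c m * d m))) \<and>
      ((\<lambda>s. \<Sum>m. a m s) \<longlongrightarrow> (\<Sum>m. k ^ m * (c m * d m))) (at 0)"
  proof (rule tannerys_theorem)
    show "(a m \<longlongrightarrow> k ^ m * (c m * d m)) (at 0)" for m
      using d[of m] unfolding a_def by (intro tendsto_mult tendsto_const) (simp add: DERIV_def)
    have "\<bar>a m s\<bar> \<le> M m"
      if s: "\<And>m. mnorm (mpow (B s) m) * r ^ m \<le> C" "mnorm ((B s - B 0) /\<^sub>R s) < L" for m s
    proof -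
      have "\<bar>mpow (B s) m $ i $ j - mpow (B 0) m $ i $ j\<bar> \<le> mnorm (mpow (B s) m - mpow (B 0) m)"
        using component_le_mnorm[of "mpow (B s) m - mpow (B 0) m" i j] by simp
      then have "\<bar>c m * (k ^ m * ((mpow (B s) m $ i $ j - mpow (B 0) m $ i $ j) / s))\<bar> \<le>
          1 * (\<bar>k\<bar> ^ m * (mnorm (mpow (B s) m - mpow (B 0) m) / \<bar>s\<bar>))"
        unfolding abs_mult power_abs abs_divide
        by (intro mult_mono[OF c] mult_left_mono divide_right_mono) auto
      also have "\<dots> = q ^ m * (mnorm (mpow (B s) m - mpow (B 0) m) * r ^ m / \<bar>s\<bar>)"
        using r0 by (simp add: q_def power_divide)
      also have "\<dots> \<le> q ^ m * (real m * (C\<^sup>2 * r * mnorm (B s - B 0)) / \<bar>s\<bar>)"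
        using q r0 by (intro mult_left_mono divide_right_mono mpow_diff_bound s C0) auto
      also have "\<dots> = real m * q ^ m * (C\<^sup>2 * r * mnorm ((B s - B 0) /\<^sub>R s))"
        by (simp add: mnorm_scaleR divide_inverse ac_simps)
      also have "\<dots> \<le> M m"
        unfolding M_def
      proof (intro mult_mono)
        show "0 \<le> C\<^sup>2 * r * mnorm ((B s - B 0) /\<^sub>R s)"
          by (intro mult_nonneg_nonneg mnorm_nonneg) (use r0 in auto)
      qed (use s(2) q r0 in \<open>auto simp: mnorm_nonneg\<close>)
      finally show ?thesis by (simp add: a_def ac_simps)
    qed
    then show "\<forall>\<^sub>F (m, s) in at_top \<times>\<^sub>F at 0. norm (a m s) \<le> M m"
      unfolding eventually_prod_filter using eventually_conj[OF C L]
      by (intro exI[of _ "\<lambda>_. True"] conjI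
          exI[of _ "\<lambda>s. (\<forall>m. mnorm (mpow (B s) m) * r ^ m \<le> C) \<and> mnorm ((B s - B 0) /\<^sub>R s) < L"]
          eventually_True allI impI) simp_all
    show "summable M"
      unfolding M_def using geometric_deriv_sums[of q] q
      by (intro summable_mult2) (auto simp: sums_iff)
  qed simp
  note * = this
  have "((\<lambda>s. ((\<Sum>m. k ^ m * (c m * mpow (B s) m $ i $ j)) - (\<Sum>m. k ^ m * (c m * mpow (B 0) m $ i $ j))) / s)
      \<longlongrightarrow> (\<Sum>m. k ^ m * (c m * d m))) (at 0)"
  proof (rule Lim_transform_eventually)
    show "((\<lambda>s. \<Sum>m. a m s) \<longlongrightarrow> (\<Sum>m. k ^ m * (c m * d m))) (at 0)" using * by blast
    show "\<forall>\<^sub>F s in at 0. (\<Sum>m. a m s) = ((\<Sum>m. k ^ m * (c m * mpow (B s) m $ i $ j)) -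
        (\<Sum>m. k ^ m * (c m * mpow (B 0) m $ i $ j))) / s"
      using C
    proof eventually_elim
      case (elim s)
      have "(\<Sum>m. a m s) = (\<Sum>m. (k ^ m * (c m * mpow (B s) m $ i $ j) - k ^ m * (c m * mpow (B 0) m $ i $ j)) / s)"
        unfolding a_def by (intro suminf_cong) (simp add: right_diff_distrib diff_divide_distrib)
      also have "\<dots> = ((\<Sum>m. k ^ m * (c m * mpow (B s) m $ i $ j)) - (\<Sum>m. k ^ m * (c m * mpow (B 0) m $ i $ j))) / s"
        using summ[of s] summ[of 0] elim C0
        by (simp only: suminf_divide[OF summable_diff] suminf_diff)
      finally show ?case .
    qed
  qed
  then have "((\<lambda>s. \<Sum>m. k ^ m * (c m * mpow (B s) m $ i $ j)) has_real_derivative (\<Sum>m. k ^ m * (c m * d m))) (at 0)"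
    by (simp add: DERIV_def)
  moreover have "(\<lambda>m. k ^ m * (c m * d m)) sums (\<Sum>m. k ^ m * (c m * d m))"
    using summable_norm_cancel[of "\<lambda>m. k ^ m * (c m * d m)"] * by (intro summable_sums) simp
  ultimately show ?thesis by (simp add: DERIV_imp_deriv d_def)
qed

section \<open>The series of the Lagrange density\<close>

definition chr1 :: "(real^4 \<Rightarrow> real^4^4) \<Rightarrow> real^4 \<Rightarrow> 4 \<Rightarrow> 4 \<Rightarrow> 4 \<Rightarrow> real" where
  "chr1 h x \<mu> \<nu> \<rho> = 1/2 * (partial \<mu> (\<lambda>y. h y $ \<nu> $ \<rho>) x + partial \<nu> (\<lambda>y. h y $ \<rho> $ \<mu>) x
     - partial \<rho> (\<lambda>y. h y $ \<mu> $ \<nu>) x)"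

text \<open>The background metric is constant, so the lowered Christoffel symbol is exactly linear
  in the coupling: hence a single factor \<open>fps_X\<close>.\<close>

definition chr1_fps :: "(real^4 \<Rightarrow> real^4^4) \<Rightarrow> real^4 \<Rightarrow> 4 \<Rightarrow> 4 \<Rightarrow> 4 \<Rightarrow> real fps" where
  "chr1_fps h x \<mu> \<nu> \<rho> = fps_X * fps_const (chr1 h x \<mu> \<nu> \<rho>)"

definition dviel_fps :: "(real^4 \<Rightarrow> real^4^4) \<Rightarrow> real^4 \<Rightarrow> 4 \<Rightarrow> 4 \<Rightarrow> 4 \<Rightarrow> real fps" where
  "dviel_fps h x \<rho> i j = Abs_fps (\<lambda>m. ((1/2) gchoose m) *
     (\<Sum>\<nu>\<in>UNIV. \<eta> $ i $ \<nu> * partial \<rho> (\<lambda>y. hpow (h y) m $ \<nu> $ j) x))"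

lemma line_derivative:
  fixes h :: "real^4 \<Rightarrow> real^4^4"
  assumes "h differentiable (at x)"
  obtains D where "((\<lambda>s. h (x + s *\<^sub>R v)) has_vector_derivative D) (at 0)"
proof -
  obtain h' where h': "(h has_derivative h') (at x)" using assms by (auto simp: differentiable_def)
  have "((\<lambda>s. x + s *\<^sub>R v) has_vector_derivative v) (at 0)"
    by (auto intro!: derivative_eq_intros)
  then have "((h \<circ> (\<lambda>s. x + s *\<^sub>R v)) has_vector_derivative h' v) (at 0)"
    using h' by (intro vector_derivative_diff_chain_within) (auto intro: has_derivative_at_withinI)
  then show ?thesis using that by (simp add: o_def)
qed

lemma partial_metric:
  assumes "h differentiable (at x)"
  shows "partial \<mu> (\<lambda>y. metric k h y $ i $ j) x = k * partial \<mu> (\<lambda>y. h y $ i $ j) x"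
proof -
  obtain D where "((\<lambda>s. h (x + s *\<^sub>R axis \<mu> 1)) has_vector_derivative D) (at 0)"
    using line_derivative[OF assms] .
  from matrix_component_derivative[OF this, of i j]
  have d: "((\<lambda>s. h (x + s *\<^sub>R axis \<mu> 1) $ i $ j) has_real_derivative D $ i $ j) (at 0)" .
  then have "((\<lambda>s. metric k h (x + s *\<^sub>R axis \<mu> 1) $ i $ j) has_real_derivative k * D $ i $ j) (at 0)"
    unfolding metric_def by (auto intro!: derivative_eq_intros)
  with d show ?thesis by (simp add: partial_def DERIV_imp_deriv)
qed

lemma Christoffel1_series:
  assumes "h differentiable (at x)"
  shows "powser_on R (\<lambda>k. of_real (Christoffel1 k h x \<mu> \<nu> \<rho>)) (cfps (chr1_fps h x \<mu> \<nu> \<rho>))"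
proof -
  have "powser_on R (\<lambda>k. of_real k * of_real (chr1 h x \<mu> \<nu> \<rho>)) (fps_X * fps_const (of_real (chr1 h x \<mu> \<nu> \<rho>)))"
    by (intro powser_on_mult powser_on_X powser_on_const)
  also have "fps_X * fps_const (of_real (chr1 h x \<mu> \<nu> \<rho>)) = cfps (chr1_fps h x \<mu> \<nu> \<rho>)"
    by (rule fps_ext) (simp add: chr1_fps_def)
  finally show ?thesis
    by (rule powser_on_cong)
       (simp add: Christoffel1_def chr1_def partial_metric[OF assms] algebra_simps)
qed

lemma partial_vielbein_series:
  assumes reg: "regular R (\<eta> ** h x)" and h: "h differentiable (at x)"
  shows "powser_on R (\<lambda>k. of_real (partial \<rho> (\<lambda>y. vielbein k h y $ i $ j) x)) (cfps (dviel_fps h x \<rho> i j))"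
  unfolding dviel_fps_def
proof (rule powser_on_of_real)
  fix k :: real assume k: "\<bar>k\<bar> < R"
  define B where "B s = \<eta> ** h (x + s *\<^sub>R axis \<rho> 1)" for s
  \<comment> \<open>The signs come from lowering the first index and from the trailing
    \<open>\<eta>\<close> of \<open>hpow\<close>; absorbed into the coefficient they preserve its
    bound by 1.\<close>
  define c where "c m = \<eta> $ i $ i * \<eta> $ j $ j * ((1/2) gchoose m)" for m
  obtain D where D: "((\<lambda>s. h (x + s *\<^sub>R axis \<rho> 1)) has_vector_derivative D) (at 0)"
    using line_derivative[OF h] .
  have "linear ((**) \<eta> :: real^4^4 \<Rightarrow> real^4^4)"
    by (rule linearI) (simp_all add: matrix_add_ldistrib matrix_matrix_mult_def vec_eq_iff sum_distrib_left sum.distrib algebra_simps)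
  then have "bounded_linear ((**) \<eta> :: real^4^4 \<Rightarrow> real^4^4)" by (simp add: linear_conv_bounded_linear)
  from bounded_linear.has_vector_derivative[OF this D]
  have B: "(B has_vector_derivative \<eta> ** D) (at 0)" by (simp add: B_def[abs_def])
  have c1: "\<bar>c m\<bar> \<le> 1" for m
    using abs_gbinomial_le_1[of "1/2" m] by (simp add: c_def abs_mult eta_component)
  have "(\<lambda>m. k ^ m * (c m * deriv (\<lambda>s. mpow (B s) m $ i $ j) 0)) sums
      deriv (\<lambda>s. \<Sum>m. k ^ m * (c m * mpow (B s) m $ i $ j)) 0"
    by (rule matrix_series_derivative[OF _ B k c1]) (simp add: B_def reg)
  also have "(\<lambda>s. \<Sum>m. k ^ m * (c m * mpow (B s) m $ i $ j)) = (\<lambda>s. vielbein k h (x + s *\<^sub>R axis \<rho> 1) $ i $ j)"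
    by (simp add: vielbein_def eta_sum c_def B_def hpow_eq matrix_mult_eta ac_simps)
  also have "(\<lambda>m. k ^ m * (c m * deriv (\<lambda>s. mpow (B s) m $ i $ j) 0)) =
      (\<lambda>m. k ^ m * (((1/2) gchoose m) * (\<Sum>\<nu>\<in>UNIV. \<eta> $ i $ \<nu> * partial \<rho> (\<lambda>y. hpow (h y) m $ \<nu> $ j) x)))"
  proof
    fix m
    obtain d where d: "((\<lambda>s. mpow (B s) m $ i $ j) has_real_derivative d) (at 0)"
      using mpow_differentiable[OF B] by blast
    then have "((\<lambda>s. mpow (B s) m $ i $ j * \<eta> $ j $ j) has_real_derivative d * \<eta> $ j $ j) (at 0)"
      by (rule DERIV_cmult_right)
    then have "partial \<rho> (\<lambda>y. hpow (h y) m $ i $ j) x = d * \<eta> $ j $ j"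
      by (simp add: partial_def hpow_eq matrix_mult_eta B_def DERIV_imp_deriv)
    with d show "k ^ m * (c m * deriv (\<lambda>s. mpow (B s) m $ i $ j) 0) =
      k ^ m * (((1/2) gchoose m) * (\<Sum>\<nu>\<in>UNIV. \<eta> $ i $ \<nu> * partial \<rho> (\<lambda>y. hpow (h y) m $ \<nu> $ j) x))"
      by (simp add: eta_sum c_def DERIV_imp_deriv)
  qed
  finally show "(\<lambda>m. k ^ m * (((1/2) gchoose m) *
      (\<Sum>\<nu>\<in>UNIV. \<eta> $ i $ \<nu> * partial \<rho> (\<lambda>y. hpow (h y) m $ \<nu> $ j) x))) sums
      partial \<rho> (\<lambda>y. vielbein k h y $ i $ j) x"
    by (simp add: partial_def)
qed

section \<open>Contraction of the vielbein with the inverse metric\<close>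

lemma hpow_add: "hpow H (m + n) = hpow H m ** \<eta> ** hpow H n"
proof -
  have "hpow H m ** \<eta> ** hpow H n = mpow (\<eta> ** H) m ** (\<eta> ** \<eta>) ** (mpow (\<eta> ** H) n ** \<eta>)"
    by (simp only: hpow_eq matrix_mul_assoc)
  then show ?thesis by (simp add: eta_mult_eta hpow_eq mpow_add matrix_mul_assoc)
qed

lemma transpose_eta: "transpose \<eta> = \<eta>"
  by (simp add: vec_eq_iff transpose_def eta_component)

lemma transpose_hpow:
  assumes "transpose H = H"
  shows "transpose (hpow H m) = hpow H m"
proof (induction m)
  case 0
  show ?case by (simp add: transpose_eta)
next
  case (Suc m)
  \<comment> \<open>The recursion appends factors on the right, but transposition reverses the
    product, so a factor has to be split off on the left.\<close>
  have "hpow H (Suc m) = hpow H 1 ** \<eta> ** hpow H m" using hpow_add[of H 1 m] by simp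
  also have "\<dots> = \<eta> ** H ** hpow H m"
    by (simp add: matrix_mul_assoc[symmetric] eta_mult_eta)
  finally show ?case
    by (simp add: matrix_transpose_mul Suc assms transpose_eta matrix_mul_assoc)
qed

text \<open>In the type 10 density this merges the vielbein and the inverse metric of the Christoffel symbol
  into one inverse vielbein.\<close>

lemma vielbein_inverse_metric:
  assumes H: "transpose H = H"
  shows "(\<Sum>\<tau>\<in>UNIV. viel_fps H \<tau> t * ginv_fps H \<tau> l) = iviel_fps H l t"
proof (rule fps_ext)
  fix m
  have "fps_nth (\<Sum>\<tau>\<in>UNIV. viel_fps H \<tau> t * ginv_fps H \<tau> l) m =
      (\<Sum>\<tau>\<in>UNIV. \<Sum>i=0..m. ((1/2) gchoose i) * (- 1) ^ (m - i) *
         (hpow H (m - i) $ l $ \<tau> * (\<eta> $ \<tau> $ \<tau> * hpow H i $ \<tau> $ t)))"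
  proof -
    \<comment> \<open>Exchanging the indices of the inverse metric makes the sum over \<tau> a
      matrix product.\<close>
    have sym: "hpow H j $ a $ b = hpow H j $ b $ a" for j a b
      using arg_cong[OF transpose_hpow[OF H, of j], of "\<lambda>M. M $ b $ a"] by (simp add: transpose_def)
    show ?thesis
      unfolding fps_sum_nth fps_mult_nth viel_fps_def ginv_fps_def fps_nth_Abs_fps eta_sum
      by (intro sum.cong refl) (simp only: sym[of _ _ l] ac_simps)
  qed
  also have "\<dots> = (\<Sum>i=0..m. ((1/2) gchoose i) * (- 1) ^ (m - i) *
      (\<Sum>\<tau>\<in>UNIV. hpow H (m - i) $ l $ \<tau> * (\<eta> $ \<tau> $ \<tau> * hpow H i $ \<tau> $ t)))"
    by (subst sum.swap) (simp add: sum_distrib_left)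
  also have "\<dots> = (\<Sum>i=0..m. ((1/2) gchoose i) * (- 1) ^ (m - i)) * hpow H m $ l $ t"
    unfolding sum_distrib_right
  proof (intro sum.cong refl)
    fix i assume i: "i \<in> {0..m}"
    have "hpow H m $ l $ t = (hpow H (m - i) ** \<eta> ** hpow H i) $ l $ t"
      using i hpow_add[of H "m - i" i] by simp
    also have "\<dots> = (\<Sum>\<tau>\<in>UNIV. hpow H (m - i) $ l $ \<tau> * (\<eta> $ \<tau> $ \<tau> * hpow H i $ \<tau> $ t))"
      unfolding matrix_matrix_mult_def[of "hpow H (m - i) ** \<eta>"] by (simp add: matrix_mult_eta ac_simps)
    finally show "((1/2) gchoose i) * (- 1) ^ (m - i) *
        (\<Sum>\<tau>\<in>UNIV. hpow H (m - i) $ l $ \<tau> * (\<eta> $ \<tau> $ \<tau> * hpow H i $ \<tau> $ t)) =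
        ((1/2) gchoose i) * (- 1) ^ (m - i) * hpow H m $ l $ t" by simp
  qed
  \<comment> \<open>Coefficient comparison in (1 + X)^(1/2) (1 + X)^(-1) = (1 + X)^(-1/2).\<close>
  also have "(\<Sum>i=0..m. ((1/2) gchoose i) * (- 1) ^ (m - i)) = ((- 1/2 :: real) gchoose m)"
  proof -
    have m1: "((- 1 :: real) gchoose j) = (- 1) ^ j" for j
    proof -
      have "((- 1 :: real) gchoose j) = (- 1) ^ j * (of_nat j gchoose j)"
        using gbinomial_minus[of "1::real" j] by simp
      then show ?thesis by (simp flip: binomial_gbinomial)
    qed
    have "fps_binomial (- 1/2 :: real) = fps_binomial (1/2) * fps_binomial (- 1)"
      by (simp flip: fps_binomial_add_mult)
    from arg_cong[OF this, of "\<lambda>F. fps_nth F m"] show ?thesis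
      by (simp only: fps_mult_nth fps_binomial_nth m1)
  qed
  finally show "fps_nth (\<Sum>\<tau>\<in>UNIV. viel_fps H \<tau> t * ginv_fps H \<tau> l) m = fps_nth (iviel_fps H l t) m"
    by (simp add: iviel_fps_def)
qed

text \<open>The contraction pattern over an arbitrary commutative ring: complex numbers give the
  density, formal series its expansion. Factors are nested to the right in the order of the blocks,
  Christoffel symbols first and the volume density last.\<close>

definition vertex_sum ::
  "(4 \<Rightarrow> 4 \<Rightarrow> 'a) \<Rightarrow> (4 \<Rightarrow> 4 \<Rightarrow> 4 \<Rightarrow> 'a) \<Rightarrow> (4 \<Rightarrow> 'a) \<Rightarrow> (4 \<Rightarrow> 4 \<Rightarrow> 'a) \<Rightarrow> (4 \<Rightarrow> 4 \<Rightarrow> 4 \<Rightarrow> 'a) \<Rightarrow> 'a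
     \<Rightarrow> 'a matter \<Rightarrow> 'a::comm_ring_1" where
  "vertex_sum g c e E d v T = (case T of
      Type1 T \<Rightarrow> T * v
    | Type2 T \<Rightarrow> (\<Sum>\<alpha>\<in>UNIV. \<Sum>\<beta>\<in>UNIV. T \<alpha> \<beta> * (g \<alpha> \<beta> * v))
    | Type3 T \<Rightarrow> (\<Sum>\<alpha>\<in>UNIV. \<Sum>\<beta>\<in>UNIV. \<Sum>\<rho>\<in>UNIV. \<Sum>\<sigma>\<in>UNIV. T \<alpha> \<beta> \<rho> \<sigma> * (g \<alpha> \<beta> * (g \<rho> \<sigma> * v)))
    | Type4 T \<Rightarrow> (\<Sum>\<alpha>\<in>UNIV. \<Sum>\<beta>\<in>UNIV. \<Sum>\<rho>\<in>UNIV. \<Sum>\<sigma>\<in>UNIV. T \<rho> * (c \<alpha> \<beta> \<sigma> * (g \<alpha> \<beta> * (g \<rho> \<sigma> * v))))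
    | Type5 T \<Rightarrow> (\<Sum>\<alpha>\<in>UNIV. \<Sum>\<beta>\<in>UNIV. \<Sum>\<theta>\<in>UNIV. \<Sum>\<rho>\<in>UNIV. \<Sum>\<sigma>\<in>UNIV. \<Sum>\<xi>\<in>UNIV.
        T \<rho> \<sigma> \<xi> * (c \<alpha> \<beta> \<theta> * (g \<alpha> \<beta> * (g \<rho> \<sigma> * (g \<xi> \<theta> * v)))))
    | Type6 T \<Rightarrow> (\<Sum>\<alpha>\<in>UNIV. \<Sum>\<beta>\<in>UNIV. \<Sum>\<theta>\<in>UNIV. \<Sum>\<rho>\<in>UNIV. \<Sum>\<sigma>\<in>UNIV. \<Sum>\<tau>\<in>UNIV. \<Sum>\<xi>\<in>UNIV. \<Sum>\<zeta>\<in>UNIV.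
        T \<xi> \<zeta> * (c \<alpha> \<beta> \<theta> * (c \<rho> \<sigma> \<tau> * (g \<alpha> \<beta> * (g \<rho> \<sigma> * (g \<xi> \<theta> * (g \<zeta> \<tau> * v)))))))
    | Type7 T \<Rightarrow> (\<Sum>a\<in>UNIV. T a * (e a * v))
    | Type8 T \<Rightarrow> (\<Sum>a\<in>UNIV. \<Sum>\<rho>\<in>UNIV. \<Sum>r\<in>UNIV. T a \<rho> r * (e a * (E \<rho> r * v)))
    | Type9 T \<Rightarrow> (\<Sum>a\<in>UNIV. \<Sum>r\<in>UNIV. \<Sum>s\<in>UNIV. \<Sum>t\<in>UNIV. \<Sum>\<rho>\<in>UNIV. \<Sum>\<sigma>\<in>UNIV.
        T a r s t * (e a * (E \<rho> r * (E \<sigma> s * (d \<rho> \<sigma> t * v)))))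
    | Type10 T \<Rightarrow> (\<Sum>a\<in>UNIV. \<Sum>r\<in>UNIV. \<Sum>s\<in>UNIV. \<Sum>t\<in>UNIV. \<Sum>\<rho>\<in>UNIV. \<Sum>\<sigma>\<in>UNIV. \<Sum>\<tau>\<in>UNIV.
        T a r s t * (c \<rho> \<sigma> \<tau> * (e a * (E \<rho> r * (E \<sigma> s * (E \<tau> t * v)))))))"

lemma sum_past2:
  "(\<Sum>b\<in>B. \<Sum>c\<in>C. \<Sum>l\<in>L. f b c l) = (\<Sum>l\<in>L. \<Sum>b\<in>B. \<Sum>c\<in>C. f b c l)" for f :: "_ \<Rightarrow> _ \<Rightarrow> _ \<Rightarrow> 'a::comm_monoid_add"
proof -
  have "(\<Sum>b\<in>B. \<Sum>c\<in>C. \<Sum>l\<in>L. f b c l) = (\<Sum>b\<in>B. \<Sum>l\<in>L. \<Sum>c\<in>C. f b c l)"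
    by (intro sum.cong refl sum.swap)
  also have "\<dots> = (\<Sum>l\<in>L. \<Sum>b\<in>B. \<Sum>c\<in>C. f b c l)" by (rule sum.swap)
  finally show ?thesis .
qed

lemma sum_past3:
  "(\<Sum>a\<in>A. \<Sum>b\<in>B. \<Sum>c\<in>C. \<Sum>l\<in>L. f a b c l) = (\<Sum>l\<in>L. \<Sum>a\<in>A. \<Sum>b\<in>B. \<Sum>c\<in>C. f a b c l)"
  for f :: "_ \<Rightarrow> _ \<Rightarrow> _ \<Rightarrow> _ \<Rightarrow> 'a::comm_monoid_add"
proof -
  have "(\<Sum>a\<in>A. \<Sum>b\<in>B. \<Sum>c\<in>C. \<Sum>l\<in>L. f a b c l) = (\<Sum>a\<in>A. \<Sum>l\<in>L. \<Sum>b\<in>B. \<Sum>c\<in>C. f a b c l)"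
    by (rule sum.cong[OF refl], rule sum_past2)
  also have "\<dots> = (\<Sum>l\<in>L. \<Sum>a\<in>A. \<Sum>b\<in>B. \<Sum>c\<in>C. f a b c l)" by (rule sum.swap)
  finally show ?thesis .
qed

lemma sum_past4:
  "(\<Sum>a\<in>A. \<Sum>b\<in>B. \<Sum>c\<in>C. \<Sum>d\<in>D. \<Sum>l\<in>L. f a b c d l) = (\<Sum>l\<in>L. \<Sum>a\<in>A. \<Sum>b\<in>B. \<Sum>c\<in>C. \<Sum>d\<in>D. f a b c d l)"
  for f :: "_ \<Rightarrow> _ \<Rightarrow> _ \<Rightarrow> _ \<Rightarrow> _ \<Rightarrow> 'a::comm_monoid_add"
proof -
  have "(\<Sum>a\<in>A. \<Sum>b\<in>B. \<Sum>c\<in>C. \<Sum>d\<in>D. \<Sum>l\<in>L. f a b c d l) =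
      (\<Sum>a\<in>A. \<Sum>l\<in>L. \<Sum>b\<in>B. \<Sum>c\<in>C. \<Sum>d\<in>D. f a b c d l)"
    by (rule sum.cong[OF refl], rule sum_past3)
  also have "\<dots> = (\<Sum>l\<in>L. \<Sum>a\<in>A. \<Sum>b\<in>B. \<Sum>c\<in>C. \<Sum>d\<in>D. f a b c d l)" by (rule sum.swap)
  finally show ?thesis .
qed

text \<open>Raising the index of a Christoffel symbol creates a new innermost sum. Types 5, 6 and 10
  need it moved outwards; in type 10 this isolates the contraction to which \<open>compat\<close>
  applies.\<close>

lemma lagrangian_eq:
  assumes compat: "\<And>t l. (\<Sum>\<tau>\<in>UNIV. vielbein k h x $ \<tau> $ t * inverse_metric k h x $ \<tau> $ l) = inverse_vielbein k h x $ l $ t"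
  shows "lagrangian k T h x = vertex_sum (\<lambda>i j. of_real (inverse_metric k h x $ i $ j))
    (\<lambda>i j l. of_real (Christoffel1 k h x i j l)) (\<lambda>a. of_real (vielbein k h x $ 0 $ a))
    (\<lambda>i j. of_real (inverse_vielbein k h x $ i $ j))
    (\<lambda>\<rho> \<sigma> t. of_real (partial \<rho> (\<lambda>y. vielbein k h y $ \<sigma> $ t) x))
    (of_real (sqrt (- det (metric k h x)))) (map_matter (\<lambda>f. f x) T)"
proof -
  define g where "g i j = complex_of_real (inverse_metric k h x $ i $ j)" for i j
  define c where "c i j l = complex_of_real (Christoffel1 k h x i j l)" for i j l
  define e where "e i j = complex_of_real (vielbein k h x $ i $ j)" for i j
  define E where "E i j = complex_of_real (inverse_vielbein k h x $ i $ j)" for i j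
  define d where "d i j l = complex_of_real (partial i (\<lambda>y. vielbein k h y $ j $ l) x)" for i j l
  define v where "v = complex_of_real (sqrt (- det (metric k h x)))"
  have C: "complex_of_real (Christoffel k h x i j l) = (\<Sum>\<sigma>\<in>UNIV. g l \<sigma> * c i j \<sigma>)" for i j l
    by (simp add: Christoffel_def g_def c_def)
  have comp: "(\<Sum>\<tau>\<in>UNIV. e \<tau> t * g \<tau> l) = E l t" for l t
    unfolding e_def g_def E_def compat[symmetric] by simp
  note defs = g_def[symmetric] c_def[symmetric] e_def[symmetric] E_def[symmetric] d_def[symmetric] v_def[symmetric]
  show ?thesis
  proof (cases T)
    case (Type5 F)
    have "lagrangian k T h x = (\<Sum>\<alpha>\<in>UNIV. \<Sum>\<beta>\<in>UNIV. \<Sum>\<rho>\<in>UNIV. \<Sum>\<sigma>\<in>UNIV. \<Sum>\<xi>\<in>UNIV. \<Sum>\<theta>\<in>UNIV.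
        F \<rho> \<sigma> \<xi> x * (c \<alpha> \<beta> \<theta> * (g \<alpha> \<beta> * (g \<rho> \<sigma> * (g \<xi> \<theta> * v)))))"
      by (simp only: Type5 lagrangian_def Let_def matter.case of_real_mult C defs
        sum_distrib_left sum_distrib_right ac_simps)
    also have "\<dots> = (\<Sum>\<alpha>\<in>UNIV. \<Sum>\<beta>\<in>UNIV. \<Sum>\<theta>\<in>UNIV. \<Sum>\<rho>\<in>UNIV. \<Sum>\<sigma>\<in>UNIV. \<Sum>\<xi>\<in>UNIV.
        F \<rho> \<sigma> \<xi> x * (c \<alpha> \<beta> \<theta> * (g \<alpha> \<beta> * (g \<rho> \<sigma> * (g \<xi> \<theta> * v)))))"
      by (rule sum.cong[OF refl], rule sum.cong[OF refl], rule sum_past3)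
    finally show ?thesis
      by (simp only: Type5 vertex_sum_def matter.case matter.map o_apply defs)
  next
    case (Type6 F)
    \<comment> \<open>The raised symbols stay opaque until they stand next to each other, so that
      their two sums can be multiplied out together.\<close>
    define Ga where "Ga i j l = complex_of_real (Christoffel k h x i j l)" for i j l
    have "lagrangian k T h x = (\<Sum>\<alpha>\<in>UNIV. \<Sum>\<beta>\<in>UNIV. \<Sum>\<rho>\<in>UNIV. \<Sum>\<sigma>\<in>UNIV. \<Sum>\<xi>\<in>UNIV. \<Sum>\<zeta>\<in>UNIV.
        (F \<xi> \<zeta> x * (g \<alpha> \<beta> * (g \<rho> \<sigma> * v))) * (Ga \<alpha> \<beta> \<xi> * Ga \<rho> \<sigma> \<zeta>))"
      by (simp only: Type6 lagrangian_def Let_def matter.case of_real_mult defs Ga_def[symmetric]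
        sum_distrib_left sum_distrib_right ac_simps)
    also have "\<dots> = (\<Sum>\<alpha>\<in>UNIV. \<Sum>\<beta>\<in>UNIV. \<Sum>\<rho>\<in>UNIV. \<Sum>\<sigma>\<in>UNIV. \<Sum>\<xi>\<in>UNIV. \<Sum>\<zeta>\<in>UNIV. \<Sum>\<theta>\<in>UNIV. \<Sum>\<tau>\<in>UNIV.
        F \<xi> \<zeta> x * (c \<alpha> \<beta> \<theta> * (c \<rho> \<sigma> \<tau> * (g \<alpha> \<beta> * (g \<rho> \<sigma> * (g \<xi> \<theta> * (g \<zeta> \<tau> * v)))))))"
      unfolding Ga_def C sum_product unfolding sum_distrib_left by (simp only: ac_simps)
    also have "\<dots> = (\<Sum>\<alpha>\<in>UNIV. \<Sum>\<beta>\<in>UNIV. \<Sum>\<theta>\<in>UNIV. \<Sum>\<rho>\<in>UNIV. \<Sum>\<sigma>\<in>UNIV. \<Sum>\<xi>\<in>UNIV. \<Sum>\<zeta>\<in>UNIV. \<Sum>\<tau>\<in>UNIV.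
        F \<xi> \<zeta> x * (c \<alpha> \<beta> \<theta> * (c \<rho> \<sigma> \<tau> * (g \<alpha> \<beta> * (g \<rho> \<sigma> * (g \<xi> \<theta> * (g \<zeta> \<tau> * v)))))))"
      by (rule sum.cong[OF refl], rule sum.cong[OF refl], rule sum_past4)
    also have "\<dots> = (\<Sum>\<alpha>\<in>UNIV. \<Sum>\<beta>\<in>UNIV. \<Sum>\<theta>\<in>UNIV. \<Sum>\<rho>\<in>UNIV. \<Sum>\<sigma>\<in>UNIV. \<Sum>\<tau>\<in>UNIV. \<Sum>\<xi>\<in>UNIV. \<Sum>\<zeta>\<in>UNIV.
        F \<xi> \<zeta> x * (c \<alpha> \<beta> \<theta> * (c \<rho> \<sigma> \<tau> * (g \<alpha> \<beta> * (g \<rho> \<sigma> * (g \<xi> \<theta> * (g \<zeta> \<tau> * v)))))))"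
      by (rule sum.cong[OF refl], rule sum.cong[OF refl], rule sum.cong[OF refl], rule sum.cong[OF refl],
          rule sum.cong[OF refl], rule sum_past2)
    finally show ?thesis
      by (simp only: Type6 vertex_sum_def matter.case matter.map o_apply defs)
  next
    case (Type10 F)
    have "lagrangian k T h x = (\<Sum>a\<in>UNIV. \<Sum>r\<in>UNIV. \<Sum>s\<in>UNIV. \<Sum>t\<in>UNIV. \<Sum>\<rho>\<in>UNIV. \<Sum>\<sigma>\<in>UNIV. \<Sum>\<tau>\<in>UNIV. \<Sum>l\<in>UNIV.
        F a r s t x * (c \<rho> \<sigma> l * (e 0 a * (E \<rho> r * (E \<sigma> s * ((e \<tau> t * g \<tau> l) * v))))))"
      by (simp only: Type10 lagrangian_def Let_def matter.case of_real_mult C defs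
        sum_distrib_left sum_distrib_right ac_simps)
    also have "\<dots> = (\<Sum>a\<in>UNIV. \<Sum>r\<in>UNIV. \<Sum>s\<in>UNIV. \<Sum>t\<in>UNIV. \<Sum>\<rho>\<in>UNIV. \<Sum>\<sigma>\<in>UNIV. \<Sum>l\<in>UNIV. \<Sum>\<tau>\<in>UNIV.
        F a r s t x * (c \<rho> \<sigma> l * (e 0 a * (E \<rho> r * (E \<sigma> s * ((e \<tau> t * g \<tau> l) * v))))))"
      by (rule sum.cong[OF refl], rule sum.cong[OF refl], rule sum.cong[OF refl], rule sum.cong[OF refl],
          rule sum.cong[OF refl], rule sum.cong[OF refl], rule sum.swap)
    also have "\<dots> = (\<Sum>a\<in>UNIV. \<Sum>r\<in>UNIV. \<Sum>s\<in>UNIV. \<Sum>t\<in>UNIV. \<Sum>\<rho>\<in>UNIV. \<Sum>\<sigma>\<in>UNIV. \<Sum>l\<in>UNIV.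
        F a r s t x * (c \<rho> \<sigma> l * (e 0 a * (E \<rho> r * (E \<sigma> s * ((\<Sum>\<tau>\<in>UNIV. e \<tau> t * g \<tau> l) * v))))))"
      by (simp only: sum_distrib_left sum_distrib_right)
    finally show ?thesis
      by (simp only: comp Type10 vertex_sum_def matter.case matter.map o_apply defs)
  qed (simp_all only: lagrangian_def vertex_sum_def Let_def matter.case matter.map o_apply of_real_mult C defs
        sum_distrib_left sum_distrib_right ac_simps)
qed

lemma powser_on_vertex_sum:
  assumes "\<And>i j. powser_on R (\<lambda>k. g k i j) (G i j)" "\<And>i j l. powser_on R (\<lambda>k. c k i j l) (C i j l)"
    "\<And>a. powser_on R (\<lambda>k. e k a) (e' a)" "\<And>i j. powser_on R (\<lambda>k. E k i j) (E' i j)"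
    "\<And>i j l. powser_on R (\<lambda>k. d k i j l) (D i j l)" "powser_on R v V"
  shows "powser_on R (\<lambda>k. vertex_sum (g k) (c k) (e k) (E k) (d k) (v k) T)
    (vertex_sum G C e' E' D V (map_matter fps_const T))"
  by (cases T; simp only: vertex_sum_def matter.case matter.map o_apply;
      intro powser_on_sum powser_on_mult powser_on_const assms finite)

definition lagr_fps :: "(real^4 \<Rightarrow> complex) matter \<Rightarrow> (real^4 \<Rightarrow> real^4^4) \<Rightarrow> real^4 \<Rightarrow> complex fps" where
  "lagr_fps T h x = vertex_sum (\<lambda>i j. cfps (ginv_fps (h x) i j)) (\<lambda>i j l. cfps (chr1_fps h x i j l))
    (\<lambda>a. cfps (viel_fps (h x) 0 a)) (\<lambda>i j. cfps (iviel_fps (h x) i j)) (\<lambda>\<rho> \<sigma> t. cfps (dviel_fps h x \<rho> \<sigma> t))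
    (cfps (vol_fps (power_traces (\<eta> ** h x)))) (map_matter (\<lambda>f. fps_const (f x)) T)"

text \<open>The numerical compatibility of vielbein and inverse metric needed for type 10 follows
  from the formal one, since both sides are sums of the same series inside the radius.\<close>

lemma lagrangian_series:
  assumes reg: "regular R (\<eta> ** h x)" and R: "R > 0" and h: "h differentiable (at x)"
    and sym: "transpose (h x) = h x"
  shows "powser_on R (\<lambda>k. lagrangian k T h x) (lagr_fps T h x)"
proof (rule powser_on_cong)
  note g = inverse_metric_series[where h = h and x = x, OF reg R]
  note c = Christoffel1_series[OF h]
  note e = vielbein_series[where h = h and x = x, OF reg]
  note E = inverse_vielbein_series[where h = h and x = x, OF reg]
  note d = partial_vielbein_series[where h = h and x = x, OF reg h]
  note v = volume_series[where h = h and x = x, OF reg R]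
  show "powser_on R (\<lambda>k. vertex_sum (\<lambda>i j. of_real (inverse_metric k h x $ i $ j))
    (\<lambda>i j l. of_real (Christoffel1 k h x i j l)) (\<lambda>a. of_real (vielbein k h x $ 0 $ a))
    (\<lambda>i j. of_real (inverse_vielbein k h x $ i $ j))
    (\<lambda>\<rho> \<sigma> t. of_real (partial \<rho> (\<lambda>y. vielbein k h y $ \<sigma> $ t) x))
    (of_real (sqrt (- det (metric k h x)))) (map_matter (\<lambda>f. f x) T)) (lagr_fps T h x)"
    unfolding lagr_fps_def matter.map_comp[symmetric, of fps_const "\<lambda>f. f x", unfolded o_def]
    by (intro powser_on_vertex_sum g c e E d v)
next
  note g = inverse_metric_series[where h = h and x = x, OF reg R]
  note e = vielbein_series[where h = h and x = x, OF reg]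
  note E = inverse_vielbein_series[where h = h and x = x, OF reg]
  fix k :: real assume k: "\<bar>k\<bar> < R"
  have "(\<Sum>\<tau>\<in>UNIV. vielbein k h x $ \<tau> $ t * inverse_metric k h x $ \<tau> $ l) = inverse_vielbein k h x $ l $ t" for t l
  proof -
    have "powser_on R (\<lambda>k. \<Sum>\<tau>\<in>UNIV. of_real (vielbein k h x $ \<tau> $ t) * of_real (inverse_metric k h x $ \<tau> $ l))
      (\<Sum>\<tau>\<in>UNIV. cfps (viel_fps (h x) \<tau> t) * cfps (ginv_fps (h x) \<tau> l))"
      by (intro powser_on_sum powser_on_mult finite g e)
    also have "(\<Sum>\<tau>\<in>UNIV. cfps (viel_fps (h x) \<tau> t) * cfps (ginv_fps (h x) \<tau> l)) = cfps (iviel_fps (h x) l t)"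
      unfolding vielbein_inverse_metric[OF sym, symmetric]
      by (rule fps_ext) (simp add: fps_sum_nth flip: cfps_mult)
    finally have "complex_of_real (\<Sum>\<tau>\<in>UNIV. vielbein k h x $ \<tau> $ t * inverse_metric k h x $ \<tau> $ l) =
        of_real (inverse_vielbein k h x $ l $ t)"
      using E[of l t] k sums_unique2 unfolding powser_on_def by fastforce
    then show ?thesis by (simp only: of_real_eq_iff)
  qed
  then show "vertex_sum (\<lambda>i j. of_real (inverse_metric k h x $ i $ j))
    (\<lambda>i j l. of_real (Christoffel1 k h x i j l)) (\<lambda>a. of_real (vielbein k h x $ 0 $ a))
    (\<lambda>i j. of_real (inverse_vielbein k h x $ i $ j))
    (\<lambda>\<rho> \<sigma> t. of_real (partial \<rho> (\<lambda>y. vielbein k h y $ \<sigma> $ t) x))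
    (of_real (sqrt (- det (metric k h x)))) (map_matter (\<lambda>f. f x) T) = lagrangian k T h x"
    by (rule lagrangian_eq[symmetric])
qed

section \<open>Sums over words\<close>

text \<open>Words are total functions on the naturals. Dependence on the positions in
  \<open>S\<close> alone plays the role of independence for functionals on disjoint blocks.\<close>

definition local_on :: "nat set \<Rightarrow> ((nat \<Rightarrow> 'l) \<Rightarrow> 'b) \<Rightarrow> bool" where
  "local_on S \<phi> \<longleftrightarrow> (\<forall>w w'. (\<forall>j\<in>S. w j = w' j) \<longrightarrow> \<phi> w = \<phi> w')"

lemma local_onI: "(\<And>w w'. (\<And>j. j \<in> S \<Longrightarrow> w j = w' j) \<Longrightarrow> \<phi> w = \<phi> w') \<Longrightarrow> local_on S \<phi>"
  unfolding local_on_def by blast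

lemma local_onD: "local_on S \<phi> \<Longrightarrow> (\<And>j. j \<in> S \<Longrightarrow> w j = w' j) \<Longrightarrow> \<phi> w = \<phi> w'"
  unfolding local_on_def by blast

lemma local_on_mono: "local_on S \<phi> \<Longrightarrow> S \<subseteq> S' \<Longrightarrow> local_on S' \<phi>"
  unfolding local_on_def by blast

lemma local_on_mult: "local_on S \<phi> \<Longrightarrow> local_on S \<psi> \<Longrightarrow> local_on S (\<lambda>w. \<phi> w * \<psi> w)"
  unfolding local_on_def by metis

lemma local_on_sum: "(\<And>i. i \<in> I \<Longrightarrow> local_on S (\<phi> i)) \<Longrightarrow> local_on S (\<lambda>w. \<Sum>i\<in>I. \<phi> i w)"
  by (intro local_onI sum.cong refl) (rule local_onD)

lemma local_on_prod: "(\<And>i. i \<in> I \<Longrightarrow> local_on S (\<phi> i)) \<Longrightarrow> local_on S (\<lambda>w. \<Prod>i\<in>I. \<phi> i w)"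
  by (intro local_onI prod.cong refl) (rule local_onD)

lemma local_on_const: "local_on S (\<lambda>_. c)"
  unfolding local_on_def by simp

text \<open>The expansion of a product of fields, one for each position in \<open>S\<close>:
  \<open>f\<close> is the amplitude of a letter and \<phi> the tensor coefficient of the word.
  Positions outside \<open>S\<close> hold \<open>undefined\<close>, so \<phi> is meant to be
  local.\<close>

definition word_sum :: "'l set \<Rightarrow> ('l \<Rightarrow> 'a) \<Rightarrow> nat set \<Rightarrow> ((nat \<Rightarrow> 'l) \<Rightarrow> 'a) \<Rightarrow> 'a::comm_ring_1" where
  "word_sum L f S \<phi> = (\<Sum>w\<in>S \<rightarrow>\<^sub>E L. (\<Prod>j\<in>S. f (w j)) * \<phi> w)"

lemma word_sum_empty: "word_sum L f {} \<phi> = \<phi> (\<lambda>_. undefined)"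
  by (simp add: word_sum_def)

lemma word_sum_insert:
  assumes S: "finite S" "j \<notin> S"
  shows "word_sum L f (insert j S) \<phi> = (\<Sum>l\<in>L. f l * word_sum L f S (\<lambda>w. \<phi> (w(j := l))))"
proof -
  have "word_sum L f (insert j S) \<phi> =
      (\<Sum>(l, w)\<in>L \<times> (S \<rightarrow>\<^sub>E L). (\<Prod>i\<in>insert j S. f ((w(j := l)) i)) * \<phi> (w(j := l)))"
    unfolding word_sum_def PiE_insert_eq
    by (subst sum.reindex) (use inj_combinator[OF S(2), of "\<lambda>_. L"] in \<open>simp_all add: case_prod_unfold o_def\<close>)
  also have "\<dots> = (\<Sum>l\<in>L. \<Sum>w\<in>S \<rightarrow>\<^sub>E L. (\<Prod>i\<in>insert j S. f ((w(j := l)) i)) * \<phi> (w(j := l)))"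
    by (simp add: sum.cartesian_product)
  also have "\<dots> = (\<Sum>l\<in>L. f l * word_sum L f S (\<lambda>w. \<phi> (w(j := l))))"
  proof -
    have "(\<Prod>i\<in>insert j S. f ((w(j := l)) i)) = f l * (\<Prod>i\<in>S. f (w i))" for w l
    proof -
      have "(\<Prod>i\<in>S. f ((w(j := l)) i)) = (\<Prod>i\<in>S. f (w i))"
        using S by (intro prod.cong refl) auto
      then show ?thesis using S by simp
    qed
    then show ?thesis by (simp only: word_sum_def sum_distrib_left mult.assoc)
  qed
  finally show ?thesis .
qed

lemma word_sum_singleton: "word_sum L f {j} \<phi> = (\<Sum>l\<in>L. f l * \<phi> ((\<lambda>_. undefined)(j := l)))"
  using word_sum_insert[of "{}" j L f \<phi>] by (simp add: word_sum_empty)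

lemma word_sum_cong: "(\<And>w. \<phi> w = \<psi> w) \<Longrightarrow> word_sum L f S \<phi> = word_sum L f S \<psi>"
  by (simp add: word_sum_def)

lemma word_sum_cmult: "word_sum L f S (\<lambda>w. c * \<phi> w) = c * word_sum L f S \<phi>"
  by (simp add: word_sum_def sum_distrib_left ac_simps)

lemma word_sum_sum: "word_sum L f S (\<lambda>w. \<Sum>i\<in>I. \<phi> i w) = (\<Sum>i\<in>I. word_sum L f S (\<phi> i))"
  unfolding word_sum_def sum_distrib_left by (rule sum.swap)

text \<open>A finite Fubini theorem: a word on a disjoint union is a pair of words, and locality
  lets each functional see only its own half.\<close>

lemma word_sum_Un:
  assumes "finite S1" "finite S2" "S1 \<inter> S2 = {}" "local_on S1 \<phi>" "local_on S2 \<psi>"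
  shows "word_sum L f (S1 \<union> S2) (\<lambda>w. \<phi> w * \<psi> w) = word_sum L f S1 \<phi> * word_sum L f S2 \<psi>"
  using assms
proof (induction S1 arbitrary: \<phi> rule: finite_induct)
  case empty
  have "\<phi> w = \<phi> (\<lambda>_. undefined)" for w by (rule local_onD[OF empty.prems(3)]) auto
  then have "word_sum L f S2 (\<lambda>w. \<phi> w * \<psi> w) = word_sum L f S2 (\<lambda>w. \<phi> (\<lambda>_. undefined) * \<psi> w)"
    by (intro word_sum_cong arg_cong2[where f = times] refl)
  then show ?case by (simp add: word_sum_empty word_sum_cmult)
next
  case (insert j S1)
  have j: "j \<notin> S1 \<union> S2" using insert by auto
  have \<psi>: "\<psi> (w(j := l)) = \<psi> w" for w l
    by (rule local_onD[OF insert.prems(4)]) (use insert.prems(2) in auto)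
  have loc: "local_on S1 (\<lambda>w. \<phi> (w(j := l)))" for l
    by (rule local_onI, rule local_onD[OF insert.prems(3)]) auto
  have "word_sum L f (insert j S1 \<union> S2) (\<lambda>w. \<phi> w * \<psi> w) =
      (\<Sum>l\<in>L. f l * word_sum L f (S1 \<union> S2) (\<lambda>w. \<phi> (w(j := l)) * \<psi> w))"
    using word_sum_insert[of "S1 \<union> S2" j L f "\<lambda>w. \<phi> w * \<psi> w"] insert j by (simp add: \<psi>)
  also have "\<dots> = (\<Sum>l\<in>L. f l * (word_sum L f S1 (\<lambda>w. \<phi> (w(j := l))) * word_sum L f S2 \<psi>))"
    using insert loc by (intro sum.cong refl) (auto intro!: insert.IH arg_cong2[where f = times])
  also have "\<dots> = word_sum L f (insert j S1) \<phi> * word_sum L f S2 \<psi>"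
    using insert by (simp add: word_sum_insert sum_distrib_right mult.assoc)
  finally show ?case .
qed

lemma word_sum_UNION:
  assumes "finite X" "\<And>x. x \<in> X \<Longrightarrow> finite (S x)" "\<And>x. x \<in> X \<Longrightarrow> local_on (S x) (\<phi> x)"
    "\<And>x y. x \<in> X \<Longrightarrow> y \<in> X \<Longrightarrow> x \<noteq> y \<Longrightarrow> S x \<inter> S y = {}"
  shows "word_sum L f (\<Union>x\<in>X. S x) (\<lambda>w. \<Prod>x\<in>X. \<phi> x w) = (\<Prod>x\<in>X. word_sum L f (S x) (\<phi> x))"
  using assms
proof (induction X rule: finite_induct)
  case empty
  then show ?case by (simp add: word_sum_empty)
next
  case (insert x X)
  have "local_on (\<Union>x\<in>X. S x) (\<lambda>w. \<Prod>x\<in>X. \<phi> x w)"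
    by (intro local_on_prod local_on_mono[OF insert.prems(2)]) auto
  moreover have "S x \<inter> (\<Union>x\<in>X. S x) = {}" using insert.prems(3) insert.hyps by blast
  ultimately show ?case using insert by (simp add: word_sum_Un)
qed

lemma of_real_word_sum:
  "of_real (word_sum L f S \<phi>) = word_sum L (\<lambda>l. of_real (f l)) S (\<lambda>w. of_real (\<phi> w) :: 'a :: {comm_ring_1, real_algebra_1})"
  by (simp add: word_sum_def)

section \<open>Locality of the building blocks\<close>

lemma local_h_block: "local_on {b + 1..b + m} (\<lambda>w. h_block \<kappa> (\<lambda>j. M (w j)) (\<lambda>j. N (w j)) b m \<alpha> \<beta>)"
proof (rule local_onI)
  fix w w' :: "nat \<Rightarrow> 'a"
  assume *: "\<And>j. j \<in> {b + 1..b + m} \<Longrightarrow> w j = w' j"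
  show "h_block \<kappa> (\<lambda>j. M (w j)) (\<lambda>j. N (w j)) b m \<alpha> \<beta> = h_block \<kappa> (\<lambda>j. M (w' j)) (\<lambda>j. N (w' j)) b m \<alpha> \<beta>"
  proof (cases "m = 0")
    case False
    then have "(\<Prod>x\<in>{1..<m}. \<eta> $ M (w (b + x)) $ N (w (b + x + 1))) =
        (\<Prod>x\<in>{1..<m}. \<eta> $ M (w' (b + x)) $ N (w' (b + x + 1)))"
      by (intro prod.cong refl) (simp add: *)
    with False show ?thesis by (simp add: h_block_def *)
  qed (simp add: h_block_def)
qed

lemma h_block_Suc:
  "h_block \<kappa> \<mu> \<nu> b (Suc m) \<alpha> \<beta> = \<kappa> * h_block \<kappa> \<mu> \<nu> b m \<alpha> (\<nu> (b + Suc m)) * \<eta> $ \<mu> (b + Suc m) $ \<beta>"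
  by (cases m) (simp_all add: h_block_def prod.atLeastLessThan_Suc)

lemma h_block_scale: "h_block \<kappa> \<mu> \<nu> b m \<alpha> \<beta> = \<kappa> ^ m * h_block 1 \<mu> \<nu> b m \<alpha> \<beta>"
  by (simp add: h_block_def)

lemma local_h'_block:
  "local_on {b + 1..b + m} (\<lambda>w. h'_block \<kappa> (\<lambda>j. M (w j)) (\<lambda>j. N (w j)) (\<lambda>j. P (w j)) b m \<rho> \<alpha> \<beta>)"
proof -
  have "local_on {b + 1..b + m} (\<lambda>w. P (w i) $ \<rho>)" if "i \<in> {b + 1..b + m}" for i
    using that by (auto intro!: local_onI)
  then show ?thesis
    unfolding h'_block_def by (intro local_on_mult local_on_sum local_h_block)
qed

lemma local_\<Gamma>_block:
  "local_on {i} (\<lambda>w. \<Gamma>_block \<kappa> (\<lambda>j. M (w j)) (\<lambda>j. N (w j)) (\<lambda>j. P (w j)) i \<alpha> \<beta> \<rho>)"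
  unfolding local_on_def \<Gamma>_block_def by simp

lemma local_E_block:
  assumes "A + 2 * B + 3 * C + 4 * D = m"
  shows "local_on {b + 1..b + m} (\<lambda>w. E_block (\<lambda>j. M (w j)) (\<lambda>j. N (w j)) b A B C D)"
proof -
  have f: "local_on {b + 1..b + m} (\<lambda>w. \<eta> $ f (w (b + x)) $ g (w (b + y)))"
    if "x \<in> {1..m}" "y \<in> {1..m}" for x y f g
    using that by (auto intro!: local_onI)
  show ?thesis
    unfolding E_block_def Let_def
    by (intro local_on_mult local_on_prod f) (use assms in auto)
qed

lemma local_v_block: "local_on {b + 1..b + m} (\<lambda>w. v_block \<kappa> (\<lambda>j. M (w j)) (\<lambda>j. N (w j)) b m)"
proof -
  have E: "local_on {b + 1..b + m} (\<lambda>w. E_block (\<lambda>j. M (w j)) (\<lambda>j. N (w j)) b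
      (i + j + k + l - 2 * p - 2 * q - r - 2 * s - t - u) (p + q - r + s - t + 2 * u - 2 * v) (r + t - u) v)"
    if "i + j + k + l = m" "j \<le> i" "k \<le> j" "l \<le> k" "p \<in> {0..j - k}" "q \<in> {0..k - l}" "r \<in> {0..q}"
      "s \<in> {0..l}" "t \<in> {0..s}" "u \<in> {0..t}" "v \<in> {0..u}" for i j k l p q r s t u v
    by (rule local_E_block) (use that in auto)
  show ?thesis
    unfolding v_block_def case_prod_unfold
    by (intro local_on_mult local_on_sum local_on_const E) auto
qed

lemma eta_sym: "\<eta> $ a $ b = \<eta> $ b $ a"
  by (simp add: eta_component)

text \<open>The field is a superposition of the letters of the alphabet \<open>L\<close>. The letter \<open>l\<close> stands for a
  plane wave of momentum \<open>P l\<close> and amplitude \<open>a l\<close> whose only nonzero component is the one with the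
  indices \<open>N l\<close>, \<open>M l\<close>. Products of fields then become sums over words, and the blocks of the vertex
  are evaluated letter by letter.\<close>

locale plane_waves =
  fixes L :: "'l set" and a :: "'l \<Rightarrow> real" and M N :: "'l \<Rightarrow> 4" and P :: "'l \<Rightarrow> real^4"
    and h :: "real^4 \<Rightarrow> real^4^4"
  assumes finite_L: "finite L"
    and field: "h x $ i $ j = (\<Sum>l\<in>L. a l * exp (P l \<bullet> x) * (kron i (N l) * kron j (M l)))"
    and symmetric: "transpose (h x) = h x"
begin

abbreviation weight :: "real^4 \<Rightarrow> 'l \<Rightarrow> real" where
  "weight x l \<equiv> a l * exp (P l \<bullet> x)"

abbreviation W :: "real^4 \<Rightarrow> nat set \<Rightarrow> ((nat \<Rightarrow> 'l) \<Rightarrow> real) \<Rightarrow> real" where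
  "W x \<equiv> word_sum L (weight x)"

lemma sym: "h x $ i $ j = h x $ j $ i"
  using arg_cong[OF symmetric[of x], of "\<lambda>A. A $ j $ i"] by (simp add: transpose_def)

lemma kron_sum: "(\<Sum>i\<in>UNIV. kron i j * f i) = f j"
  unfolding kron_def by (simp add: if_distrib[of "\<lambda>x. x * _"] cong: if_cong)

text \<open>Each letter has a single nonzero component, so contracting the field with
  \<open>f\<close> amounts to evaluating \<open>f\<close> at the indices of the letters.\<close>

lemma letter_sum: "(\<Sum>l\<in>L. weight x l * f (N l) (M l)) = (\<Sum>i\<in>UNIV. \<Sum>j\<in>UNIV. h x $ i $ j * f i j)"
proof -
  have "(\<Sum>i\<in>UNIV. \<Sum>j\<in>UNIV. h x $ i $ j * f i j) =
      (\<Sum>i\<in>UNIV. \<Sum>j\<in>UNIV. \<Sum>l\<in>L. weight x l * (kron i (N l) * (kron j (M l) * f i j)))"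
    unfolding field sum_distrib_right by (simp only: mult.assoc)
  also have "\<dots> = (\<Sum>l\<in>L. \<Sum>i\<in>UNIV. \<Sum>j\<in>UNIV. weight x l * (kron i (N l) * (kron j (M l) * f i j)))"
    by (rule sum_past2)
  also have "\<dots> = (\<Sum>l\<in>L. weight x l * f (N l) (M l))"
    by (simp only: sum_distrib_left[symmetric] kron_sum)
  finally show ?thesis ..
qed

text \<open>Induction on the last letter: its index \<open>N\<close> closes the chain so far through
  the preceding \<open>\<eta>\<close>, and its index \<open>M\<close> opens the next
  \<open>\<eta>\<close>. Summing over this letter is multiplication by the field.\<close>

lemma hpow_W: "W x {b + 1..b + m} (\<lambda>w. h_block \<kappa> (\<lambda>j. M (w j)) (\<lambda>j. N (w j)) b m \<alpha> \<beta>) = \<kappa> ^ m * hpow (h x) m $ \<alpha> $ \<beta>"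
proof (induction m arbitrary: \<beta>)
  case 0
  show ?case by (simp add: word_sum_empty h_block_def)
next
  case (Suc m)
  have S: "{b + 1..b + Suc m} = insert (b + Suc m) {b + 1..b + m}" by auto
  have loc: "h_block \<kappa> (\<lambda>j. M ((w(b + Suc m := l)) j)) (\<lambda>j. N ((w(b + Suc m := l)) j)) b m \<alpha> \<gamma> =
      h_block \<kappa> (\<lambda>j. M (w j)) (\<lambda>j. N (w j)) b m \<alpha> \<gamma>" for w l \<gamma>
    by (rule local_onD[OF local_h_block]) auto
  have "W x {b + 1..b + Suc m} (\<lambda>w. h_block \<kappa> (\<lambda>j. M (w j)) (\<lambda>j. N (w j)) b (Suc m) \<alpha> \<beta>) =
      (\<Sum>l\<in>L. weight x l * (\<kappa> * \<kappa> ^ m * hpow (h x) m $ \<alpha> $ N l * \<eta> $ M l $ \<beta>))"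
  proof -
    have "W x {b + 1..b + m} (\<lambda>w. h_block \<kappa> (\<lambda>j. M ((w(b + Suc m := l)) j)) (\<lambda>j. N ((w(b + Suc m := l)) j)) b (Suc m) \<alpha> \<beta>) =
        \<kappa> * \<kappa> ^ m * hpow (h x) m $ \<alpha> $ N l * \<eta> $ M l $ \<beta>" for l
    proof -
      have "W x {b + 1..b + m} (\<lambda>w. h_block \<kappa> (\<lambda>j. M ((w(b + Suc m := l)) j)) (\<lambda>j. N ((w(b + Suc m := l)) j)) b (Suc m) \<alpha> \<beta>) =
        W x {b + 1..b + m} (\<lambda>w. (\<kappa> * \<eta> $ M l $ \<beta>) * h_block \<kappa> (\<lambda>j. M (w j)) (\<lambda>j. N (w j)) b m \<alpha> (N l))"
        by (rule word_sum_cong) (simp only: h_block_Suc loc, simp)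
      then show ?thesis by (simp only: word_sum_cmult Suc) (simp add: ac_simps)
    qed
    then show ?thesis unfolding S by (subst word_sum_insert) auto
  qed
  also have "\<dots> = (\<Sum>i\<in>UNIV. \<Sum>j\<in>UNIV. h x $ i $ j * (\<kappa> * \<kappa> ^ m * hpow (h x) m $ \<alpha> $ i * \<eta> $ j $ \<beta>))"
    by (rule letter_sum)
  also have "\<dots> = \<kappa> ^ Suc m * (\<Sum>j\<in>UNIV. (\<Sum>i\<in>UNIV. hpow (h x) m $ \<alpha> $ i * h x $ i $ j) * \<eta> $ j $ \<beta>)"
    by (subst sum.swap) (simp add: sum_distrib_left sum_distrib_right ac_simps)
  also have "\<dots> = \<kappa> ^ Suc m * hpow (h x) (Suc m) $ \<alpha> $ \<beta>"
    by (simp add: matrix_matrix_mult_def)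
  finally show ?case .
qed

text \<open>The weight of a word is one exponential with the total momentum of its letters, so
  differentiation multiplies by the sum of their momenta. This is the origin of the primed
  block.\<close>

lemma W_derivative:
  assumes "finite S"
  shows "((\<lambda>s. W (x + s *\<^sub>R axis \<rho> 1) S \<phi>) has_real_derivative
    W x S (\<lambda>w. (\<Sum>j\<in>S. P (w j) $ \<rho>) * \<phi> w)) (at 0)"
proof -
  have e: "(\<Prod>j\<in>S. weight y (w j)) = (\<Prod>j\<in>S. a (w j)) * exp ((\<Sum>j\<in>S. P (w j)) \<bullet> y)" for w y
    using assms by (simp add: prod.distrib exp_sum inner_sum_left)
  show ?thesis
    unfolding word_sum_def e
    by (auto intro!: derivative_eq_intros DERIV_sum sum.cong simp: inner_add_right inner_axis algebra_simps)
qed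

lemma hpow_partial_W:
  "W x {b + 1..b + m} (\<lambda>w. h'_block \<kappa> (\<lambda>j. M (w j)) (\<lambda>j. N (w j)) (\<lambda>j. P (w j)) b m \<rho> \<alpha> \<beta>) =
    \<kappa> ^ m * partial \<rho> (\<lambda>y. hpow (h y) m $ \<alpha> $ \<beta>) x"
proof -
  have "((\<lambda>s. hpow (h (x + s *\<^sub>R axis \<rho> 1)) m $ \<alpha> $ \<beta>) has_real_derivative
      W x {b + 1..b + m} (\<lambda>w. h'_block 1 (\<lambda>j. M (w j)) (\<lambda>j. N (w j)) (\<lambda>j. P (w j)) b m \<rho> \<alpha> \<beta>)) (at 0)"
    unfolding h'_block_def
    using W_derivative[of "{b + 1..b + m}" x \<rho> "\<lambda>w. h_block 1 (\<lambda>j. M (w j)) (\<lambda>j. N (w j)) b m \<alpha> \<beta>"]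
    unfolding hpow_W by simp
  then have "partial \<rho> (\<lambda>y. hpow (h y) m $ \<alpha> $ \<beta>) x =
      W x {b + 1..b + m} (\<lambda>w. h'_block 1 (\<lambda>j. M (w j)) (\<lambda>j. N (w j)) (\<lambda>j. P (w j)) b m \<rho> \<alpha> \<beta>)"
    by (simp add: partial_def DERIV_imp_deriv)
  then show ?thesis
    unfolding word_sum_cmult[symmetric]
    by (simp add: word_sum_cmult[symmetric]) (simp add: h'_block_def h_block_scale[of \<kappa>] ac_simps)
qed

lemma component_partial: "partial \<rho> (\<lambda>y. h y $ i $ j) x = (\<Sum>l\<in>L. weight x l * (P l $ \<rho> * (kron i (N l) * kron j (M l))))"
proof -
  have "((\<lambda>s. h (x + s *\<^sub>R axis \<rho> 1) $ i $ j) has_real_derivative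
      (\<Sum>l\<in>L. weight x l * (P l $ \<rho> * (kron i (N l) * kron j (M l))))) (at 0)"
    unfolding field
    by (auto intro!: derivative_eq_intros DERIV_sum sum.cong simp: inner_add_right inner_axis algebra_simps)
  then show ?thesis by (simp add: partial_def DERIV_imp_deriv)
qed

lemma field_differentiable: "h differentiable (at x)"
proof -
  define U where "U l = (\<chi> i j. kron i (N l) * kron j (M l))" for l
  have "h = (\<lambda>x. \<Sum>l\<in>L. (a l * exp (P l \<bullet> x)) *\<^sub>R U l)"
    by (intro ext) (simp add: vec_eq_iff field U_def sum_component)
  moreover have "((\<lambda>x. \<Sum>l\<in>L. (a l * exp (P l \<bullet> x)) *\<^sub>R U l) has_derivative
      (\<lambda>v. \<Sum>l\<in>L. (a l * (exp (P l \<bullet> x) * (P l \<bullet> v))) *\<^sub>R U l)) (at x)"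
    by (auto intro!: derivative_eq_intros has_derivative_sum)
  ultimately show ?thesis by (auto simp: differentiable_def)
qed

text \<open>The block has 1/4 where the symbol has 1/2 because it sums over both orders of the index
  pair; for a symmetric field the two orders agree.\<close>

lemma chr1_W:
  "W x {i} (\<lambda>w. \<Gamma>_block \<kappa> (\<lambda>j. M (w j)) (\<lambda>j. N (w j)) (\<lambda>j. P (w j)) i \<alpha> \<beta> \<rho>) = \<kappa> * chr1 h x \<alpha> \<beta> \<rho>"
proof -
  have "W x {i} (\<lambda>w. \<Gamma>_block \<kappa> (\<lambda>j. M (w j)) (\<lambda>j. N (w j)) (\<lambda>j. P (w j)) i \<alpha> \<beta> \<rho>) =
      (\<Sum>l\<in>L. weight x l * (\<kappa> / 4 * (P l $ \<alpha> * (kron \<rho> (M l) * kron \<beta> (N l) + kron \<beta> (M l) * kron \<rho> (N l))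
       + P l $ \<beta> * (kron \<alpha> (M l) * kron \<rho> (N l) + kron \<rho> (M l) * kron \<alpha> (N l))
       - P l $ \<rho> * (kron \<alpha> (M l) * kron \<beta> (N l) + kron \<beta> (M l) * kron \<alpha> (N l)))))"
    by (simp only: word_sum_singleton \<Gamma>_block_def fun_upd_same)
  also have "\<dots> = \<kappa> / 4 * ((partial \<alpha> (\<lambda>y. h y $ \<beta> $ \<rho>) x + partial \<alpha> (\<lambda>y. h y $ \<rho> $ \<beta>) x)
      + (partial \<beta> (\<lambda>y. h y $ \<rho> $ \<alpha>) x + partial \<beta> (\<lambda>y. h y $ \<alpha> $ \<rho>) x)
      - (partial \<rho> (\<lambda>y. h y $ \<beta> $ \<alpha>) x + partial \<rho> (\<lambda>y. h y $ \<alpha> $ \<beta>) x))"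
    unfolding component_partial
    by (simp add: sum_distrib_left sum.distrib sum_subtractf algebra_simps)
  also have "\<dots> = \<kappa> * chr1 h x \<alpha> \<beta> \<rho>"
    unfolding chr1_def sym[of _ \<rho> \<beta>] sym[of _ \<alpha> \<rho>] sym[of _ \<beta> \<alpha>] by (simp add: algebra_simps)
  finally show ?thesis .
qed

lemma chain_sum:
  "(\<Sum>l\<in>L. weight x l * (\<eta> $ u $ N l * X $ M l $ v)) = (\<eta> ** h x ** X) $ u $ v"
proof -
  have "(\<Sum>l\<in>L. weight x l * (\<eta> $ u $ N l * X $ M l $ v)) =
      (\<Sum>i\<in>UNIV. \<Sum>j\<in>UNIV. h x $ i $ j * (\<eta> $ u $ i * X $ j $ v))"
    by (rule letter_sum)
  also have "\<dots> = (\<eta> ** h x ** X) $ u $ v"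
    by (subst sum.swap) (simp add: matrix_matrix_mult_def sum_distrib_left ac_simps)
  finally show ?thesis .
qed

lemma closed_sum: "(\<Sum>l\<in>L. weight x l * X $ M l $ N l) = trace (X ** h x)"
proof -
  have "(\<Sum>l\<in>L. weight x l * X $ M l $ N l) = (\<Sum>i\<in>UNIV. \<Sum>j\<in>UNIV. h x $ i $ j * X $ j $ i)"
    by (rule letter_sum)
  also have "\<dots> = trace (X ** h x)"
    by (subst sum.swap) (simp add: trace_def matrix_matrix_mult_def ac_simps)
  finally show ?thesis .
qed

text \<open>Symmetry of the field allows the indices to be read in the opposite order. The cycle of
  length 2 requires this, as it pairs \<open>M\<close> with \<open>M\<close> and \<open>N\<close>
  with \<open>N\<close>.\<close>

lemma closed_sum': "(\<Sum>l\<in>L. weight x l * X $ N l $ M l) = trace (X ** h x)"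
proof -
  have "(\<Sum>l\<in>L. weight x l * X $ N l $ M l) = (\<Sum>i\<in>UNIV. \<Sum>j\<in>UNIV. h x $ i $ j * X $ i $ j)"
    by (rule letter_sum)
  also have "\<dots> = trace (X ** h x)"
    by (simp add: trace_def matrix_matrix_mult_def sym ac_simps)
  finally show ?thesis .
qed

section \<open>Traces of powers as closed cycles of letters\<close>

lemma trace1_W: "W x {i} (\<lambda>w. \<eta> $ M (w i) $ N (w i)) = power_traces (\<eta> ** h x) 1"
  by (simp add: word_sum_singleton closed_sum[of x \<eta>] power_traces_def)

lemma trace2_W:
  assumes "i \<noteq> j"
  shows "W x {i, j} (\<lambda>w. \<eta> $ M (w i) $ M (w j) * \<eta> $ N (w i) $ N (w j)) = power_traces (\<eta> ** h x) 2"
proof -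
  have "W x {i, j} (\<lambda>w. \<eta> $ M (w i) $ M (w j) * \<eta> $ N (w i) $ N (w j)) =
      (\<Sum>l\<in>L. weight x l * (\<Sum>l'\<in>L. weight x l' * (\<eta> $ N l $ N l' * \<eta> $ M l' $ M l)))"
    using assms by (simp add: word_sum_insert word_sum_singleton eta_sym[of "M _" "M _"] ac_simps)
  also have "\<dots> = trace (\<eta> ** h x ** \<eta> ** h x)" by (simp only: chain_sum closed_sum')
  finally show ?thesis by (simp add: power_traces_def numeral_eq_Suc matrix_mul_assoc)
qed

lemma trace3_W:
  assumes "i \<noteq> j" "j \<noteq> k" "i \<noteq> k"
  shows "W x {i, j, k} (\<lambda>w. \<eta> $ M (w i) $ N (w j) * \<eta> $ M (w j) $ N (w k) * \<eta> $ M (w k) $ N (w i)) =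
    power_traces (\<eta> ** h x) 3"
proof -
  have "W x {i, j, k} (\<lambda>w. \<eta> $ M (w i) $ N (w j) * \<eta> $ M (w j) $ N (w k) * \<eta> $ M (w k) $ N (w i)) =
      (\<Sum>l\<in>L. weight x l * (\<Sum>l'\<in>L. weight x l' * (\<Sum>l''\<in>L. weight x l'' *
        (\<eta> $ M l $ N l' * \<eta> $ M l' $ N l'' * \<eta> $ M l'' $ N l))))"
    using assms by (simp add: word_sum_insert word_sum_singleton)
  also have "\<dots> = (\<Sum>l\<in>L. weight x l * (\<Sum>l'\<in>L. weight x l' * (\<eta> $ M l $ N l' * (\<Sum>l''\<in>L. weight x l'' *
        (\<eta> $ M l' $ N l'' * \<eta> $ M l'' $ N l)))))"
    by (simp add: sum_distrib_left ac_simps)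
  also have "\<dots> = trace (\<eta> ** h x ** (\<eta> ** h x ** \<eta>) ** h x)" by (simp only: chain_sum closed_sum)
  finally show ?thesis by (simp add: power_traces_def numeral_eq_Suc matrix_mul_assoc)
qed

lemma trace4_W:
  assumes "distinct [i, j, k, m]"
  shows "W x {i, j, k, m} (\<lambda>w. \<eta> $ M (w i) $ N (w j) * \<eta> $ M (w j) $ N (w k) * \<eta> $ M (w k) $ N (w m) *
    \<eta> $ M (w m) $ N (w i)) = power_traces (\<eta> ** h x) 4"
proof -
  have "W x {i, j, k, m} (\<lambda>w. \<eta> $ M (w i) $ N (w j) * \<eta> $ M (w j) $ N (w k) * \<eta> $ M (w k) $ N (w m) *
    \<eta> $ M (w m) $ N (w i)) =
      (\<Sum>l\<in>L. weight x l * (\<Sum>l1\<in>L. weight x l1 * (\<Sum>l2\<in>L. weight x l2 * (\<Sum>l3\<in>L. weight x l3 *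
        (\<eta> $ M l $ N l1 * \<eta> $ M l1 $ N l2 * \<eta> $ M l2 $ N l3 * \<eta> $ M l3 $ N l)))))"
    using assms by (simp add: word_sum_insert word_sum_singleton)
  also have "\<dots> = (\<Sum>l\<in>L. weight x l * (\<Sum>l1\<in>L. weight x l1 * (\<eta> $ M l $ N l1 * (\<Sum>l2\<in>L. weight x l2 *
        (\<eta> $ M l1 $ N l2 * (\<Sum>l3\<in>L. weight x l3 * (\<eta> $ M l2 $ N l3 * \<eta> $ M l3 $ N l)))))))"
    by (simp add: sum_distrib_left ac_simps)
  also have "\<dots> = trace (\<eta> ** h x ** (\<eta> ** h x ** (\<eta> ** h x ** \<eta>)) ** h x)" by (simp only: chain_sum closed_sum)
  finally show ?thesis by (simp add: power_traces_def numeral_eq_Suc matrix_mul_assoc)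
qed

end

text \<open>The cycles of one length are interleaved in \<open>E_block\<close>: a cycle occupies
  positions with step \<open>B\<close>, the number of such cycles. Up to a shift these are the
  residue classes modulo \<open>B\<close>, which partition the block.\<close>

lemma strided_Un:
  "(\<Union>x\<in>{c + 1..c + B}. (\<lambda>i. b + (x + i * B)) ` {..<k}) = {b + c + 1..b + c + k * B :: nat}"
proof (intro equalityI subsetI)
  fix y assume "y \<in> (\<Union>x\<in>{c + 1..c + B}. (\<lambda>i. b + (x + i * B)) ` {..<k})"
  then obtain x i where x: "c + 1 \<le> x" "x \<le> c + B" "i < k" "y = b + (x + i * B)" by auto
  from x have "Suc i * B \<le> k * B" by (intro mult_right_mono) auto
  with x show "y \<in> {b + c + 1..b + c + k * B}" by auto
next
  fix y assume y: "y \<in> {b + c + 1..b + c + k * B}"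
  define z where "z = y - (b + c + 1)"
  have z: "z < k * B" "y = b + c + 1 + z" using y by (auto simp: z_def)
  then have B: "B > 0" by (cases B) auto
  have "y = b + ((c + 1 + z mod B) + z div B * B)" using z by (simp add: mult.commute)
  moreover have "z div B < k" using z B by (simp add: less_mult_imp_div_less)
  moreover have "c + 1 + z mod B \<in> {c + 1..c + B}" using B by (simp add: Suc_leI)
  ultimately show "y \<in> (\<Union>x\<in>{c + 1..c + B}. (\<lambda>i. b + (x + i * B)) ` {..<k})" by blast
qed

lemma strided_disjoint:
  assumes "x \<in> {c + 1..c + B}" "y \<in> {c + 1..c + B}" "x \<noteq> y"
  shows "(\<lambda>i. b + (x + i * B)) ` {..<k} \<inter> (\<lambda>i. b + (y + i * B)) ` {..<k} = ({} :: nat set)"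
proof -
  have False if "x + i * B = y + j * B" for i j
  proof -
    define x' y' where "x' = x - (c + 1)" and "y' = y - (c + 1)"
    have "x' < B" "y' < B" "x = x' + (c + 1)" "y = y' + (c + 1)" using assms by (auto simp: x'_def y'_def)
    moreover from this that have "x' + i * B = y' + j * B" by simp
    then have "(x' + i * B) mod B = (y' + j * B) mod B" by simp
    ultimately show False using assms by simp
  qed
  then show ?thesis by auto
qed

context plane_waves
begin

text \<open>The cycles use disjoint positions, so their sums factor; \<open>k\<close> is their
  length, \<open>B\<close> their number, and each contributes the same trace
  \<open>t\<close>.\<close>

lemma W_cycles:
  assumes loc: "\<And>y. local_on ((\<lambda>i. b + (y + i * B)) ` {..<k}) (\<phi> y)"
    and val: "\<And>y. y \<in> {c + 1..c + B} \<Longrightarrow> W x ((\<lambda>i. b + (y + i * B)) ` {..<k}) (\<phi> y) = t"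
  shows "W x {b + c + 1..b + c + k * B} (\<lambda>w. \<Prod>y\<in>{c + 1..c + B}. \<phi> y w) = t ^ B"
    and "local_on {b + c + 1..b + c + k * B} (\<lambda>w. \<Prod>y\<in>{c + 1..c + B}. \<phi> y w)"
proof -
  have "W x (\<Union>y\<in>{c + 1..c + B}. (\<lambda>i. b + (y + i * B)) ` {..<k}) (\<lambda>w. \<Prod>y\<in>{c + 1..c + B}. \<phi> y w) =
      (\<Prod>y\<in>{c + 1..c + B}. W x ((\<lambda>i. b + (y + i * B)) ` {..<k}) (\<phi> y))"
    by (rule word_sum_UNION) (use loc strided_disjoint in auto)
  also have "\<dots> = t ^ B" by (simp add: val)
  finally show "W x {b + c + 1..b + c + k * B} (\<lambda>w. \<Prod>y\<in>{c + 1..c + B}. \<phi> y w) = t ^ B"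
    unfolding strided_Un .
  show "local_on {b + c + 1..b + c + k * B} (\<lambda>w. \<Prod>y\<in>{c + 1..c + B}. \<phi> y w)"
    unfolding strided_Un[symmetric] by (intro local_on_prod local_on_mono[OF loc]) auto
qed

lemma E_block_W:
  assumes m: "A + 2 * B + 3 * C + 4 * D = m"
  shows "W x {b + 1..b + m} (\<lambda>w. E_block (\<lambda>j. M (w j)) (\<lambda>j. N (w j)) b A B C D) =
    power_traces (\<eta> ** h x) 1 ^ A * power_traces (\<eta> ** h x) 2 ^ B *
    power_traces (\<eta> ** h x) 3 ^ C * power_traces (\<eta> ** h x) 4 ^ D"
proof -
  \<comment> \<open>The redundant zeros make the range an instance of the general pattern with c =
    0.\<close>
  define F1 where "F1 w = (\<Prod>y\<in>{0 + 1..0 + A}. \<eta> $ M (w (b + y)) $ N (w (b + y)))" for w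
  define F2 where "F2 w = (\<Prod>y\<in>{A + 1..A + B}. \<eta> $ M (w (b + y)) $ M (w (b + (y + B))) *
    \<eta> $ N (w (b + y)) $ N (w (b + (y + B))))" for w
  define F3 where "F3 w = (\<Prod>y\<in>{A + 2 * B + 1..A + 2 * B + C}. \<eta> $ M (w (b + y)) $ N (w (b + (y + C))) *
    \<eta> $ M (w (b + (y + C))) $ N (w (b + (y + 2 * C))) * \<eta> $ M (w (b + (y + 2 * C))) $ N (w (b + y)))" for w
  define F4 where "F4 w = (\<Prod>y\<in>{A + 2 * B + 3 * C + 1..A + 2 * B + 3 * C + D}.
    \<eta> $ M (w (b + y)) $ N (w (b + (y + D))) * \<eta> $ M (w (b + (y + D))) $ N (w (b + (y + 2 * D))) *
    \<eta> $ M (w (b + (y + 2 * D))) $ N (w (b + (y + 3 * D))) * \<eta> $ M (w (b + (y + 3 * D))) $ N (w (b + y)))" for w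
  have k1: "(\<lambda>i. b + (y + i * A)) ` {..<1} = {b + y}" for y by auto
  have k2: "(\<lambda>i. b + (y + i * B)) ` {..<2} = {b + y, b + (y + B)}" for y
    by (auto simp: numeral_eq_Suc lessThan_Suc)
  have k3: "(\<lambda>i. b + (y + i * C)) ` {..<3} = {b + y, b + (y + C), b + (y + 2 * C)}" for y
    by (auto simp: numeral_eq_Suc lessThan_Suc)
  have k4: "(\<lambda>i. b + (y + i * D)) ` {..<4} = {b + y, b + (y + D), b + (y + 2 * D), b + (y + 3 * D)}" for y
    by (auto simp: numeral_eq_Suc lessThan_Suc)
  note W1 = W_cycles[where k = 1 and B = A and c = 0 and b = b and x = x, unfolded k1]
  have F1: "W x {b + 0 + 1..b + 0 + 1 * A} F1 = power_traces (\<eta> ** h x) 1 ^ A" "local_on {b + 0 + 1..b + 0 + 1 * A} F1"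
    unfolding F1_def by (rule W1; (rule trace1_W | auto intro!: local_onI))+
  note W2 = W_cycles[where k = 2 and B = B and c = A and b = b and x = x, unfolded k2]
  have F2: "W x {b + A + 1..b + A + 2 * B} F2 = power_traces (\<eta> ** h x) 2 ^ B" "local_on {b + A + 1..b + A + 2 * B} F2"
    unfolding F2_def by (rule W2; auto intro!: local_onI trace2_W)+
  note W3 = W_cycles[where k = 3 and B = C and c = "A + 2 * B" and b = b and x = x, unfolded k3]
  have F3: "W x {b + (A + 2 * B) + 1..b + (A + 2 * B) + 3 * C} F3 = power_traces (\<eta> ** h x) 3 ^ C"
    "local_on {b + (A + 2 * B) + 1..b + (A + 2 * B) + 3 * C} F3"
    unfolding F3_def by (rule W3; auto intro!: local_onI trace3_W)+
  note W4 = W_cycles[where k = 4 and B = D and c = "A + 2 * B + 3 * C" and b = b and x = x, unfolded k4]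
  have F4: "W x {b + (A + 2 * B + 3 * C) + 1..b + (A + 2 * B + 3 * C) + 4 * D} F4 = power_traces (\<eta> ** h x) 4 ^ D"
    "local_on {b + (A + 2 * B + 3 * C) + 1..b + (A + 2 * B + 3 * C) + 4 * D} F4"
    unfolding F4_def by (rule W4; auto intro!: local_onI trace4_W)+
  let ?S1 = "{b + 0 + 1..b + 0 + 1 * A}" and ?S2 = "{b + A + 1..b + A + 2 * B}"
    and ?S3 = "{b + (A + 2 * B) + 1..b + (A + 2 * B) + 3 * C}"
    and ?S4 = "{b + (A + 2 * B + 3 * C) + 1..b + (A + 2 * B + 3 * C) + 4 * D}"
  have S: "{b + 1..b + m} = ?S1 \<union> (?S2 \<union> (?S3 \<union> ?S4))" using m by auto
  have "W x {b + 1..b + m} (\<lambda>w. E_block (\<lambda>j. M (w j)) (\<lambda>j. N (w j)) b A B C D) =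
      W x (?S1 \<union> (?S2 \<union> (?S3 \<union> ?S4))) (\<lambda>w. F1 w * (F2 w * (F3 w * F4 w)))"
    unfolding S by (rule word_sum_cong) (simp add: E_block_def Let_def F1_def F2_def F3_def F4_def mult.assoc)
  also have "\<dots> = W x ?S1 F1 * (W x ?S2 F2 * (W x ?S3 F3 * W x ?S4 F4))"
    by (subst word_sum_Un; (intro local_on_mult local_on_mono[OF F2(2)] local_on_mono[OF F3(2)] local_on_mono[OF F4(2)]
          F1(2) F2(2) F3(2) F4(2) finite_UnI finite_atLeastAtMost)?; (auto; fail)?)+
  finally show ?thesis unfolding F1 F2 F3 F4 by (simp add: mult.assoc)
qed

end

section \<open>Expansion of the volume density in traces\<close>

lemma fps_power_const_X: "(fps_const c * fps_X ^ d) ^ n = fps_const (c ^ n :: real) * fps_X ^ (d * n)"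
  by (simp add: power_mult_distrib fps_const_power power_mult)

text \<open>Three nested binomial theorems: among i factors, i - j are e1, j - k are e2, k - l are
  e3 and l are e4, of total degree (i - j) + 2(j - k) + 3(k - l) + 4l = i + j + k + l.\<close>

lemma fps_polynomial_power_nth:
  fixes e1 e2 e3 e4 :: real
  shows "fps_nth ((fps_const e1 * fps_X ^ 1 + (fps_const e2 * fps_X ^ 2 + (fps_const e3 * fps_X ^ 3 + fps_const e4 * fps_X ^ 4))) ^ i) m =
    (\<Sum>j\<le>i. \<Sum>k\<le>j. \<Sum>l\<le>k. if i + j + k + l = m then
       of_nat (i choose j) * of_nat (j choose k) * of_nat (k choose l) *
       (e1 ^ (i - j) * e2 ^ (j - k) * e3 ^ (k - l) * e4 ^ l) else 0)"
proof -
  have "(fps_const e1 * fps_X ^ 1 + (fps_const e2 * fps_X ^ 2 + (fps_const e3 * fps_X ^ 3 + fps_const e4 * fps_X ^ 4))) ^ i =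
    (\<Sum>j\<le>i. of_nat (i choose j) * (\<Sum>k\<le>j. of_nat (j choose k) * (\<Sum>l\<le>k. of_nat (k choose l) *
       (fps_const e4 * fps_X ^ 4) ^ l * (fps_const e3 * fps_X ^ 3) ^ (k - l)) *
       (fps_const e2 * fps_X ^ 2) ^ (j - k)) * (fps_const e1 * fps_X ^ 1) ^ (i - j))"
    unfolding add.commute[of "fps_const e1 * fps_X ^ 1"] add.commute[of "fps_const e2 * fps_X ^ 2"]
      add.commute[of "fps_const e3 * fps_X ^ 3"] binomial_ring ..
  also have "\<dots> = (\<Sum>j\<le>i. \<Sum>k\<le>j. \<Sum>l\<le>k.
      fps_const (of_nat (i choose j) * of_nat (j choose k) * of_nat (k choose l) *
        (e1 ^ (i - j) * e2 ^ (j - k) * e3 ^ (k - l) * e4 ^ l)) * fps_X ^ (i + j + k + l))"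
    unfolding sum_distrib_left sum_distrib_right
  proof (intro sum.cong refl)
    fix j k l assume jkl: "j \<in> {..i}" "k \<in> {..j}" "l \<in> {..k}"
    then have e: "i + j + k + l = 4 * l + 3 * (k - l) + 2 * (j - k) + 1 * (i - j)" by auto
    show "of_nat (i choose j) * (of_nat (j choose k) * (of_nat (k choose l) *
       (fps_const e4 * fps_X ^ 4) ^ l * (fps_const e3 * fps_X ^ 3) ^ (k - l)) *
       (fps_const e2 * fps_X ^ 2) ^ (j - k)) * (fps_const e1 * fps_X ^ 1) ^ (i - j) =
      fps_const (of_nat (i choose j) * of_nat (j choose k) * of_nat (k choose l) *
        (e1 ^ (i - j) * e2 ^ (j - k) * e3 ^ (k - l) * e4 ^ l)) * fps_X ^ (i + j + k + l)"
      unfolding fps_power_const_X e power_add fps_const_mult[symmetric] fps_of_nat by (simp only: ac_simps)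
  qed
  finally show ?thesis
    by (simp add: fps_sum_nth fps_X_power_nth cong: if_cong) (auto intro!: sum.cong)
qed

lemma vol_fps_nth_e:
  fixes t :: "nat \<Rightarrow> real"
  defines "e1 \<equiv> t 1" and "e2 \<equiv> (t 1 ^ 2 - t 2) / 2" and "e3 \<equiv> (t 1 ^ 3 - 3 * t 1 * t 2 + 2 * t 3) / 6"
    and "e4 \<equiv> (t 1 ^ 4 - 6 * t 1 ^ 2 * t 2 + 3 * t 2 ^ 2 + 8 * t 1 * t 3 - 6 * t 4) / 24"
  shows "fps_nth (vol_fps t) m = (\<Sum>(i, j, k, l)\<in>{(i, j, k, l). i + j + k + l = m \<and> j \<le> i \<and> k \<le> j \<and> l \<le> k}.
    ((1/2) gchoose i) * of_nat (i choose j) * of_nat (j choose k) * of_nat (k choose l) *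
       (e1 ^ (i - j) * e2 ^ (j - k) * e3 ^ (k - l) * e4 ^ l))"
proof -
  let ?c = "\<lambda>i j k l. of_nat (i choose j) * of_nat (j choose k) * of_nat (k choose l) *
       (e1 ^ (i - j) * e2 ^ (j - k) * e3 ^ (k - l) * e4 ^ l)"
  have "fps_of_poly (e_poly t) - 1 =
      fps_const e1 * fps_X ^ 1 + (fps_const e2 * fps_X ^ 2 + (fps_const e3 * fps_X ^ 3 + fps_const e4 * fps_X ^ 4))"
    unfolding e_poly_def fps_of_poly_pCons e1_def e2_def e3_def e4_def
    by (simp add: algebra_simps numeral_eq_Suc)
  then have "fps_nth (vol_fps t) m = (\<Sum>i=0..m. ((1/2) gchoose i) *
      (\<Sum>j\<le>i. \<Sum>k\<le>j. \<Sum>l\<le>k. if i + j + k + l = m then ?c i j k l else 0))"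
    unfolding vol_fps_def fps_compose_nth by (simp only: fps_polynomial_power_nth fps_binomial_nth)
  also have "\<dots> = (\<Sum>i=0..m. \<Sum>j\<le>i. \<Sum>k\<le>j. \<Sum>l\<le>k. if i + j + k + l = m then ((1/2) gchoose i) * ?c i j k l else 0)"
    by (simp add: sum_distrib_left if_distrib[of "\<lambda>x. _ * x"] cong: if_cong)
  also have "\<dots> = (\<Sum>(i, j, k, l)\<in>(SIGMA i:{0..m}. SIGMA j:{..i}. SIGMA k:{..j}. {..k}).
      if i + j + k + l = m then ((1/2) gchoose i) * ?c i j k l else 0)"
    by (simp add: sum.Sigma)
  also have "\<dots> = (\<Sum>(i, j, k, l)\<in>{(i, j, k, l). i + j + k + l = m \<and> j \<le> i \<and> k \<le> j \<and> l \<le> k}.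
      ((1/2) gchoose i) * ?c i j k l)"
    \<comment> \<open>The range i \<le> m from the composition of series is implied by i + j + k + l
      = m.\<close>
    by (rule sum.mono_neutral_cong_right) (auto split: if_splits)
  finally show ?thesis by (simp only: mult.assoc)
qed

lemma binomial_expand: "(a + b :: real) ^ n = (\<Sum>p\<in>{0..n}. of_nat (n choose p) * (a ^ p * b ^ (n - p)))"
  by (simp add: binomial_ring atLeast0AtMost mult.assoc)

lemma e2_power:
  "((x ^ 2 - y) / 2 :: real) ^ n = (\<Sum>p\<in>{0..n}. of_nat (n choose p) * ((- y) ^ p * (x ^ 2) ^ (n - p) / 2 ^ n))"
proof -
  have "(x ^ 2 - y) / 2 = (- y + x ^ 2) / 2" by simp
  then show ?thesis by (simp only: power_divide binomial_expand sum_divide_distrib times_divide_eq_right)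
qed

lemma e3_power:
  "((x ^ 3 - 3 * x * y + 2 * z) / 6 :: real) ^ n = (\<Sum>q\<in>{0..n}. \<Sum>r\<in>{0..q}. of_nat (n choose q) * of_nat (q choose r) *
     ((2 * z) ^ r * (- (3 * x * y)) ^ (q - r) * (x ^ 3) ^ (n - q) / 6 ^ n))"
proof -
  have "((x ^ 3 - 3 * x * y + 2 * z) / 6) ^ n = ((2 * z + (- (3 * x * y))) + x ^ 3) ^ n / 6 ^ n"
    by (simp add: power_divide algebra_simps)
  also have "\<dots> = (\<Sum>q\<in>{0..n}. of_nat (n choose q) *
      ((\<Sum>r\<in>{0..q}. of_nat (q choose r) * ((2 * z) ^ r * (- (3 * x * y)) ^ (q - r))) * (x ^ 3) ^ (n - q))) / 6 ^ n"
    by (subst binomial_expand) (simp only: binomial_expand[of "2 * z"])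
  finally show ?thesis
    by (simp only: sum_distrib_left sum_distrib_right sum_divide_distrib times_divide_eq_right mult.assoc)
qed

text \<open>Of the n factors, v supply -6w, u - v supply 3y^2, t - u supply 8xz, s - t supply -6x^2
  y, and the remaining n - s supply x^4.\<close>

lemma e4_power:
  "((x ^ 4 - 6 * x ^ 2 * y + 3 * y ^ 2 + 8 * x * z - 6 * w) / 24 :: real) ^ n =
    (\<Sum>s\<in>{0..n}. \<Sum>t\<in>{0..s}. \<Sum>u\<in>{0..t}. \<Sum>v\<in>{0..u}.
       of_nat (n choose s) * of_nat (s choose t) * of_nat (t choose u) * of_nat (u choose v) *
       ((- (6 * w)) ^ v * (3 * y ^ 2) ^ (u - v) * (8 * x * z) ^ (t - u) * (- (6 * x ^ 2 * y)) ^ (s - t) * (x ^ 4) ^ (n - s) / 24 ^ n))"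
proof -
  have "((x ^ 4 - 6 * x ^ 2 * y + 3 * y ^ 2 + 8 * x * z - 6 * w) / 24) ^ n =
      ((((- (6 * w) + 3 * y ^ 2) + 8 * x * z) + (- (6 * x ^ 2 * y))) + x ^ 4) ^ n / 24 ^ n"
    by (simp add: power_divide algebra_simps)
  also have "\<dots> = (\<Sum>s\<in>{0..n}. of_nat (n choose s) *
      ((\<Sum>t\<in>{0..s}. of_nat (s choose t) *
        ((\<Sum>u\<in>{0..t}. of_nat (t choose u) *
          ((\<Sum>v\<in>{0..u}. of_nat (u choose v) * ((- (6 * w)) ^ v * (3 * y ^ 2) ^ (u - v))) * (8 * x * z) ^ (t - u))) *
         (- (6 * x ^ 2 * y)) ^ (s - t))) * (x ^ 4) ^ (n - s))) / 24 ^ n"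
    by (simp only: binomial_expand[of "- (6 * w) + 3 * y ^ 2 + 8 * x * z + (- (6 * x ^ 2 * y))"]
        binomial_expand[of "- (6 * w) + 3 * y ^ 2 + 8 * x * z"] binomial_expand[of "- (6 * w) + 3 * y ^ 2"]
        binomial_expand[of "- (6 * w)"])
  finally show ?thesis
    by (simp only: sum_distrib_left sum_distrib_right sum_divide_distrib times_divide_eq_right mult.assoc)
qed

lemma power_int_sub: "c \<noteq> 0 \<Longrightarrow> c powi (int m - int n) = c ^ m * inverse (c ^ n)" for c :: real
  by (simp add: power_int_diff divide_inverse)

text \<open>The signs, the powers of 2 and 3, and the exponents of the four traces are collected.
  Each index is written as the next smaller one plus a surplus, which removes every truncated
  subtraction.\<close>

lemma monomial_eq:
  fixes x y z w :: real
  assumes "j \<le> i" "k \<le> j" "l \<le> k" "p \<le> j - k" "q \<le> k - l" "r \<le> q" "s \<le> l" "t \<le> s" "u \<le> t" "v \<le> u"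
  shows "x ^ (i - j) * ((- y) ^ p * (x ^ 2) ^ (j - k - p) / 2 ^ (j - k)) *
    ((2 * z) ^ r * (- (3 * x * y)) ^ (q - r) * (x ^ 3) ^ (k - l - q) / 6 ^ (k - l)) *
    ((- (6 * w)) ^ v * (3 * y ^ 2) ^ (u - v) * (8 * x * z) ^ (t - u) * (- (6 * x ^ 2 * y)) ^ (s - t) * (x ^ 4) ^ (l - s) / 24 ^ l) =
    (- 1) powi (int p + int q - int r + int s - int t + int v)
        * 2 powi (- int j - 2 * int l + int r + int s + 2 * int t - 3 * int u + int v)
        * 3 powi (- int k + int q - int r + int s - int t + int u)
    * (x ^ (i + j + k + l - 2 * p - 2 * q - r - 2 * s - t - u) * y ^ (p + q - r + s - t + 2 * u - 2 * v) * z ^ (r + t - u) * w ^ v)"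
proof -
  obtain u' where u: "u = v + u'" using assms le_Suc_ex by blast
  obtain t' where t: "t = u + t'" using assms le_Suc_ex by blast
  obtain s' where s: "s = t + s'" using assms le_Suc_ex by blast
  obtain l' where l: "l = s + l'" using assms le_Suc_ex by blast
  obtain r' where q: "q = r + r'" using assms le_Suc_ex by blast
  obtain q' where "k - l = q + q'" using assms le_Suc_ex by blast
  then have k: "k = l + q + q'" using assms by simp
  obtain p' where "j - k = p + p'" using assms le_Suc_ex by blast
  then have j: "j = k + p + p'" using assms by simp
  obtain i' where i: "i = j + i'" using assms le_Suc_ex by blast
  have 1: "i + j + k + l - 2 * p - 2 * q - r - 2 * s - t - u = i' + 2 * p' + 3 * q' + r' + 4 * l' + 2 * s' + t'"
    using i j k l q s t u by simp
  have 2: "p + q - r + s - t + 2 * u - 2 * v = p + r' + s' + 2 * u'" using i j k l q s t u by simp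
  have 3: "r + t - u = r + t'" using t by simp
  have 4: "int p + int q - int r + int s - int t + int v = int (p + r' + s' + v)" using q s by simp
  have 5: "- int j - 2 * int l + int r + int s + 2 * int t - 3 * int u + int v =
      int (r + s' + 3 * t' + v) - int ((p + p') + (q + q') + 3 * l)" using i j k s t by simp
  have 6: "- int k + int q - int r + int s - int t + int u = int (r' + s' + u' + v) - int ((q + q') + l)"
    using k q s u by simp
  have d: "i - j = i'" "j - k = p + p'" "k - l = q + q'" "q - r = r'"
    "l - s = l'" "s - t = s'" "t - u = t'" "u - v = u'"
    using i j k l q s t u by auto
  have f: "(- y) ^ p = (- 1) ^ p * y ^ p" "(6 :: real) ^ n = 2 ^ n * 3 ^ n" "(24 :: real) ^ n = 2 ^ (3 * n) * 3 ^ n"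
    "(2 * z) ^ r = 2 ^ r * z ^ r" "(- (3 * x * y)) ^ r' = (- 1) ^ r' * 3 ^ r' * x ^ r' * y ^ r'"
    "(- (6 * w)) ^ v = (- 1) ^ v * 2 ^ v * 3 ^ v * w ^ v" "(3 * y ^ 2) ^ u' = 3 ^ u' * y ^ (2 * u')"
    "(8 * x * z) ^ t' = 2 ^ (3 * t') * x ^ t' * z ^ t'"
    "(- (6 * x ^ 2 * y)) ^ s' = (- 1) ^ s' * 2 ^ s' * 3 ^ s' * x ^ (2 * s') * y ^ s'" for n
  proof -
    have six: "(6 :: real) ^ n = 2 ^ n * 3 ^ n" for n
      using power_mult_distrib[of "2 :: real" 3 n] by simp
    have eight: "(8 :: real) ^ n = 2 ^ (3 * n)" for n
      using power_mult[of "2 :: real" 3 n] by simp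
    show "(6 :: real) ^ n = 2 ^ n * 3 ^ n" by (rule six)
    show "(24 :: real) ^ n = 2 ^ (3 * n) * 3 ^ n"
      using power_mult_distrib[of "8 :: real" 3 n] by (simp add: eight)
    show "(- y) ^ p = (- 1) ^ p * y ^ p" by (rule power_minus)
    show "(2 * z) ^ r = 2 ^ r * z ^ r" by (rule power_mult_distrib)
    show "(- (3 * x * y)) ^ r' = (- 1) ^ r' * 3 ^ r' * x ^ r' * y ^ r'"
      unfolding power_minus[of "3 * x * y"] by (simp only: power_mult_distrib mult.assoc)
    show "(- (6 * w)) ^ v = (- 1) ^ v * 2 ^ v * 3 ^ v * w ^ v"
      unfolding power_minus[of "6 * w"] by (simp only: power_mult_distrib six mult.assoc)
    show "(3 * y ^ 2) ^ u' = 3 ^ u' * y ^ (2 * u')" by (simp only: power_mult_distrib power_mult)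
    show "(8 * x * z) ^ t' = 2 ^ (3 * t') * x ^ t' * z ^ t'" by (simp only: power_mult_distrib eight)
    show "(- (6 * x ^ 2 * y)) ^ s' = (- 1) ^ s' * 2 ^ s' * 3 ^ s' * x ^ (2 * s') * y ^ s'"
      unfolding power_minus[of "6 * x ^ 2 * y"] by (simp only: power_mult_distrib six power_mult mult.assoc)
  qed
  show ?thesis
    unfolding 1 2 3 4 5 6 d diff_add_inverse power_int_sub[of 2, simplified] power_int_sub[of 3, simplified] power_int_of_nat
    unfolding f power_mult[symmetric] power_add divide_inverse inverse_mult_distrib
    by (simp only: ac_simps)
qed

lemma e_product_expand:
  fixes x y z w :: real
  assumes "j \<le> i" "k \<le> j" "l \<le> k"
  shows "x ^ (i - j) * ((x ^ 2 - y) / 2) ^ (j - k) * ((x ^ 3 - 3 * x * y + 2 * z) / 6) ^ (k - l) *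
     ((x ^ 4 - 6 * x ^ 2 * y + 3 * y ^ 2 + 8 * x * z - 6 * w) / 24) ^ l =
    (\<Sum>p\<in>{0..j - k}. \<Sum>q\<in>{0..k - l}. \<Sum>r\<in>{0..q}. \<Sum>s\<in>{0..l}. \<Sum>t\<in>{0..s}. \<Sum>u\<in>{0..t}. \<Sum>v\<in>{0..u}.
        of_nat ((j - k) choose p) * of_nat ((k - l) choose q) * of_nat (q choose r)
        * of_nat (l choose s) * of_nat (s choose t) * of_nat (t choose u) * of_nat (u choose v)
        * (- 1) powi (int p + int q - int r + int s - int t + int v)
        * 2 powi (- int j - 2 * int l + int r + int s + 2 * int t - 3 * int u + int v)
        * 3 powi (- int k + int q - int r + int s - int t + int u)
        * (x ^ (i + j + k + l - 2 * p - 2 * q - r - 2 * s - t - u) * y ^ (p + q - r + s - t + 2 * u - 2 * v)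
           * z ^ (r + t - u) * w ^ v))"
proof -
  \<comment> \<open>Naming the summands lets the three expansions be multiplied out one at a time,
    in the order of the summation indices.\<close>
  define a where "a p = real ((j - k) choose p) * ((- y) ^ p * (x ^ 2) ^ (j - k - p) / 2 ^ (j - k))" for p
  define b where "b q r = real ((k - l) choose q) * real (q choose r) *
     ((2 * z) ^ r * (- (3 * x * y)) ^ (q - r) * (x ^ 3) ^ (k - l - q) / 6 ^ (k - l))" for q r
  define c where "c s t u v = real (l choose s) * real (s choose t) * real (t choose u) * real (u choose v) *
       ((- (6 * w)) ^ v * (3 * y ^ 2) ^ (u - v) * (8 * x * z) ^ (t - u) * (- (6 * x ^ 2 * y)) ^ (s - t) * (x ^ 4) ^ (l - s) / 24 ^ l)"
    for s t u v
  define R where "R = (\<Sum>s\<in>{0..l}. \<Sum>t\<in>{0..s}. \<Sum>u\<in>{0..t}. \<Sum>v\<in>{0..u}. c s t u v)"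
  define Q where "Q = (\<Sum>q\<in>{0..k - l}. \<Sum>r\<in>{0..q}. b q r)"
  have "x ^ (i - j) * ((x ^ 2 - y) / 2) ^ (j - k) * ((x ^ 3 - 3 * x * y + 2 * z) / 6) ^ (k - l) *
     ((x ^ 4 - 6 * x ^ 2 * y + 3 * y ^ 2 + 8 * x * z - 6 * w) / 24) ^ l =
     x ^ (i - j) * (\<Sum>p\<in>{0..j - k}. a p) * Q * R"
    unfolding e2_power e3_power e4_power a_def b_def c_def Q_def R_def ..
  also have "\<dots> = (\<Sum>p\<in>{0..j - k}. x ^ (i - j) * a p * Q * R)"
    by (simp only: sum_distrib_left sum_distrib_right)
  also have "\<dots> = (\<Sum>p\<in>{0..j - k}. \<Sum>q\<in>{0..k - l}. \<Sum>r\<in>{0..q}. x ^ (i - j) * a p * b q r * R)"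
    by (simp only: Q_def sum_distrib_left sum_distrib_right)
  also have "\<dots> = (\<Sum>p\<in>{0..j - k}. \<Sum>q\<in>{0..k - l}. \<Sum>r\<in>{0..q}. \<Sum>s\<in>{0..l}. \<Sum>t\<in>{0..s}. \<Sum>u\<in>{0..t}. \<Sum>v\<in>{0..u}.
      x ^ (i - j) * a p * b q r * c s t u v)"
    by (simp only: R_def sum_distrib_left)
  also have "\<dots> = (\<Sum>p\<in>{0..j - k}. \<Sum>q\<in>{0..k - l}. \<Sum>r\<in>{0..q}. \<Sum>s\<in>{0..l}. \<Sum>t\<in>{0..s}. \<Sum>u\<in>{0..t}. \<Sum>v\<in>{0..u}.
        of_nat ((j - k) choose p) * of_nat ((k - l) choose q) * of_nat (q choose r)
        * of_nat (l choose s) * of_nat (s choose t) * of_nat (t choose u) * of_nat (u choose v)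
        * ((- 1) powi (int p + int q - int r + int s - int t + int v)
        * 2 powi (- int j - 2 * int l + int r + int s + 2 * int t - 3 * int u + int v)
        * 3 powi (- int k + int q - int r + int s - int t + int u)
        * (x ^ (i + j + k + l - 2 * p - 2 * q - r - 2 * s - t - u) * y ^ (p + q - r + s - t + 2 * u - 2 * v)
           * z ^ (r + t - u) * w ^ v)))"
  proof (rule sum.cong[OF refl], rule sum.cong[OF refl], rule sum.cong[OF refl], rule sum.cong[OF refl],
      rule sum.cong[OF refl], rule sum.cong[OF refl], rule sum.cong[OF refl])
    fix p q r s t u v
    assume "p \<in> {0..j - k}" "q \<in> {0..k - l}" "r \<in> {0..q}" "s \<in> {0..l}" "t \<in> {0..s}" "u \<in> {0..t}" "v \<in> {0..u}"
    then have m: "p \<le> j - k" "q \<le> k - l" "r \<le> q" "s \<le> l" "t \<le> s" "u \<le> t" "v \<le> u" by auto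
    have "x ^ (i - j) * a p * b q r * c s t u v =
      of_nat ((j - k) choose p) * of_nat ((k - l) choose q) * of_nat (q choose r)
        * of_nat (l choose s) * of_nat (s choose t) * of_nat (t choose u) * of_nat (u choose v) *
      (x ^ (i - j) * ((- y) ^ p * (x ^ 2) ^ (j - k - p) / 2 ^ (j - k)) *
    ((2 * z) ^ r * (- (3 * x * y)) ^ (q - r) * (x ^ 3) ^ (k - l - q) / 6 ^ (k - l)) *
    ((- (6 * w)) ^ v * (3 * y ^ 2) ^ (u - v) * (8 * x * z) ^ (t - u) * (- (6 * x ^ 2 * y)) ^ (s - t) * (x ^ 4) ^ (l - s) / 24 ^ l))"
      unfolding a_def b_def c_def by (simp only: ac_simps)
    then show "x ^ (i - j) * a p * b q r * c s t u v =
      of_nat ((j - k) choose p) * of_nat ((k - l) choose q) * of_nat (q choose r)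
        * of_nat (l choose s) * of_nat (s choose t) * of_nat (t choose u) * of_nat (u choose v)
        * ((- 1) powi (int p + int q - int r + int s - int t + int v)
        * 2 powi (- int j - 2 * int l + int r + int s + 2 * int t - 3 * int u + int v)
        * 3 powi (- int k + int q - int r + int s - int t + int u)
        * (x ^ (i + j + k + l - 2 * p - 2 * q - r - 2 * s - t - u) * y ^ (p + q - r + s - t + 2 * u - 2 * v)
           * z ^ (r + t - u) * w ^ v))"
      by (simp only: monomial_eq[OF assms m])
  qed
  finally show ?thesis by (simp only: mult.assoc)
qed

context plane_waves
begin

lemma v_block_W:
  "W x {b + 1..b + m} (\<lambda>w. v_block \<kappa> (\<lambda>j. M (w j)) (\<lambda>j. N (w j)) b m) =
    \<kappa> ^ m * fps_nth (vol_fps (power_traces (\<eta> ** h x))) m"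
proof -
  let ?t = "power_traces (\<eta> ** h x)"
  have "W x {b + 1..b + m} (\<lambda>w. v_block \<kappa> (\<lambda>j. M (w j)) (\<lambda>j. N (w j)) b m) =
    \<kappa> ^ m *
     (\<Sum>(i, j, k, l)\<in>{(i, j, k, l). i + j + k + l = m \<and> j \<le> i \<and> k \<le> j \<and> l \<le> k}.
      \<Sum>p\<in>{0..j - k}. \<Sum>q\<in>{0..k - l}. \<Sum>r\<in>{0..q}. \<Sum>s\<in>{0..l}. \<Sum>t\<in>{0..s}. \<Sum>u\<in>{0..t}. \<Sum>v\<in>{0..u}.
        ((1/2) gchoose i) * of_nat (i choose j) * of_nat (j choose k) * of_nat (k choose l)
        * of_nat ((j - k) choose p) * of_nat ((k - l) choose q) * of_nat (q choose r)
        * of_nat (l choose s) * of_nat (s choose t) * of_nat (t choose u) * of_nat (u choose v)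
        * (- 1) powi (int p + int q - int r + int s - int t + int v)
        * 2 powi (- int j - 2 * int l + int r + int s + 2 * int t - 3 * int u + int v)
        * 3 powi (- int k + int q - int r + int s - int t + int u)
        * W x {b + 1..b + m} (\<lambda>w. E_block (\<lambda>j. M (w j)) (\<lambda>j. N (w j)) b
            (i + j + k + l - 2 * p - 2 * q - r - 2 * s - t - u)
            (p + q - r + s - t + 2 * u - 2 * v)
            (r + t - u)
            v))"
    unfolding v_block_def case_prod_unfold word_sum_cmult word_sum_sum ..
  also have "\<dots> = \<kappa> ^ m *
     (\<Sum>(i, j, k, l)\<in>{(i, j, k, l). i + j + k + l = m \<and> j \<le> i \<and> k \<le> j \<and> l \<le> k}.
      ((1/2) gchoose i) * of_nat (i choose j) * of_nat (j choose k) * of_nat (k choose l) *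
      (\<Sum>p\<in>{0..j - k}. \<Sum>q\<in>{0..k - l}. \<Sum>r\<in>{0..q}. \<Sum>s\<in>{0..l}. \<Sum>t\<in>{0..s}. \<Sum>u\<in>{0..t}. \<Sum>v\<in>{0..u}.
        of_nat ((j - k) choose p) * of_nat ((k - l) choose q) * of_nat (q choose r)
        * of_nat (l choose s) * of_nat (s choose t) * of_nat (t choose u) * of_nat (u choose v)
        * (- 1) powi (int p + int q - int r + int s - int t + int v)
        * 2 powi (- int j - 2 * int l + int r + int s + 2 * int t - 3 * int u + int v)
        * 3 powi (- int k + int q - int r + int s - int t + int u)
        * (?t 1 ^ (i + j + k + l - 2 * p - 2 * q - r - 2 * s - t - u) * ?t 2 ^ (p + q - r + s - t + 2 * u - 2 * v)
           * ?t 3 ^ (r + t - u) * ?t 4 ^ v)))"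
    apply (rule arg_cong[where f = "(*) (\<kappa> ^ m)"], rule sum.cong[OF refl], clarify)
    unfolding sum_distrib_left
    \<comment> \<open>The side condition A + 2B + 3C + 4D = m follows from i + j + k + l = m and the
      ranges of the indices, in which all subtractions are exact.\<close>
    apply (intro sum.cong refl, subst E_block_W)
     apply auto[1]
    by (simp only: mult.assoc)
  also have "\<dots> = \<kappa> ^ m * fps_nth (vol_fps ?t) m"
    unfolding vol_fps_nth_e
    by (rule arg_cong[where f = "(*) (\<kappa> ^ m)"], rule sum.cong[OF refl], clarify) (simp only: e_product_expand)
  finally show ?thesis .
qed

end

section \<open>Vertices as word sums\<close>

text \<open>This and its analogues for more parts bring sums over compositions into the nested form
  that iterated Cauchy products produce.\<close>

lemma sum_tuple2: "(\<Sum>(m1, m2)\<in>{(m1, m2). m1 + m2 = n}. f m1 m2) = (\<Sum>m1\<in>{0..n}. f m1 (n - m1))" for n :: nat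
  by (rule sum.reindex_bij_witness[of _ "\<lambda>m1. (m1, n - m1)" fst]) auto

lemma sum_tuple3: "(\<Sum>(m1, m2, m3)\<in>{(m1, m2, m3). m1 + m2 + m3 = n}. f m1 m2 m3) =
  (\<Sum>m1\<in>{0..n}. \<Sum>m2\<in>{0..n - m1}. f m1 m2 (n - m1 - m2))" for n :: nat
  unfolding sum.Sigma[OF finite_atLeastAtMost ballI[OF finite_atLeastAtMost]]
  by (rule sum.reindex_bij_witness[of _ "\<lambda>(m1, m2). (m1, m2, n - m1 - m2)" "\<lambda>(m1, m2, m3). (m1, m2)"]) auto

lemma sum_tuple4: "(\<Sum>(m1, m2, m3, m4)\<in>{(m1, m2, m3, m4). m1 + m2 + m3 + m4 = n}. f m1 m2 m3 m4) =
  (\<Sum>m1\<in>{0..n}. \<Sum>m2\<in>{0..n - m1}. \<Sum>m3\<in>{0..n - m1 - m2}. f m1 m2 m3 (n - m1 - m2 - m3))" for n :: nat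
proof -
  have "(\<Sum>m1\<in>{0..n}. \<Sum>m2\<in>{0..n - m1}. \<Sum>m3\<in>{0..n - m1 - m2}. f m1 m2 m3 (n - m1 - m2 - m3)) =
    (\<Sum>(m1, m2, m3)\<in>(SIGMA m1:{0..n}. SIGMA m2:{0..n - m1}. {0..n - m1 - m2}). f m1 m2 m3 (n - m1 - m2 - m3))"
    by (simp add: sum.Sigma)
  then show ?thesis
    by (simp only:) (rule sum.reindex_bij_witness[of _ "\<lambda>(m1, m2, m3). (m1, m2, m3, n - m1 - m2 - m3)"
      "\<lambda>(m1, m2, m3, m4). (m1, m2, m3)"]; auto)
qed

lemma sum_tuple5: "(\<Sum>(m1, m2, m3, m4, m5)\<in>{(m1, m2, m3, m4, m5). m1 + m2 + m3 + m4 + m5 = n}. f m1 m2 m3 m4 m5) =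
  (\<Sum>m1\<in>{0..n}. \<Sum>m2\<in>{0..n - m1}. \<Sum>m3\<in>{0..n - m1 - m2}. \<Sum>m4\<in>{0..n - m1 - m2 - m3}.
     f m1 m2 m3 m4 (n - m1 - m2 - m3 - m4))" for n :: nat
proof -
  have "(\<Sum>m1\<in>{0..n}. \<Sum>m2\<in>{0..n - m1}. \<Sum>m3\<in>{0..n - m1 - m2}. \<Sum>m4\<in>{0..n - m1 - m2 - m3}.
     f m1 m2 m3 m4 (n - m1 - m2 - m3 - m4)) =
    (\<Sum>(m1, m2, m3, m4)\<in>(SIGMA m1:{0..n}. SIGMA m2:{0..n - m1}. SIGMA m3:{0..n - m1 - m2}. {0..n - m1 - m2 - m3}).
     f m1 m2 m3 m4 (n - m1 - m2 - m3 - m4))"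
    by (simp add: sum.Sigma)
  then show ?thesis
    by (simp only:) (rule sum.reindex_bij_witness[of _ "\<lambda>(m1, m2, m3, m4). (m1, m2, m3, m4, n - m1 - m2 - m3 - m4)"
      "\<lambda>(m1, m2, m3, m4, m5). (m1, m2, m3, m4)"]; auto)
qed

text \<open>The Cauchy product at the level of words: the second factor starts at the offset where
  the first one ends.\<close>

definition conv :: "(nat \<Rightarrow> nat \<Rightarrow> 'w \<Rightarrow> 'a) \<Rightarrow> (nat \<Rightarrow> nat \<Rightarrow> 'w \<Rightarrow> 'a) \<Rightarrow> nat \<Rightarrow> nat \<Rightarrow> 'w \<Rightarrow> 'a::comm_ring_1" where
  "conv \<phi> \<psi> b m w = (\<Sum>i\<in>{0..m}. \<phi> b i w * \<psi> (b + i) (m - i) w)"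

text \<open>A Christoffel factor is linear in the field and so uses exactly one letter, the first of
  its block.\<close>

definition single_letter :: "(nat \<Rightarrow> 'w \<Rightarrow> 'a) \<Rightarrow> nat \<Rightarrow> nat \<Rightarrow> 'w \<Rightarrow> 'a::comm_ring_1" where
  "single_letter \<phi> b m w = (if m = 1 then \<phi> (b + 1) w else 0)"

lemma conv_single_letter:
  "conv (single_letter \<phi>) \<psi> b m w = (if m = 0 then 0 else \<phi> (b + 1) w * \<psi> (b + 1) (m - 1) w)"
proof -
  have "conv (single_letter \<phi>) \<psi> b m w = (\<Sum>i\<in>{0..m}. if i = 1 then \<phi> (b + 1) w * \<psi> (b + 1) (m - 1) w else 0)"
    unfolding conv_def single_letter_def by (intro sum.cong) auto
  then show ?thesis by simp
qed

context plane_waves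
begin

abbreviation Wc :: "real^4 \<Rightarrow> nat set \<Rightarrow> ((nat \<Rightarrow> 'l) \<Rightarrow> complex) \<Rightarrow> complex" where
  "Wc x \<equiv> word_sum L (\<lambda>l. of_real (weight x l))"

text \<open>All offsets are required, because in a product the position of the right factor varies
  with the length of the left one. Locality is included so that products factor.\<close>

definition rep :: "real \<Rightarrow> real^4 \<Rightarrow> complex fps \<Rightarrow> (nat \<Rightarrow> nat \<Rightarrow> (nat \<Rightarrow> 'l) \<Rightarrow> complex) \<Rightarrow> bool" where
  "rep \<kappa> x F \<phi> \<longleftrightarrow> (\<forall>b m. of_real \<kappa> ^ m * fps_nth F m = Wc x {b + 1..b + m} (\<phi> b m) \<and> local_on {b + 1..b + m} (\<phi> b m))"

lemma repI:
  assumes "\<And>b m. W x {b + 1..b + m} (\<phi> b m) = \<kappa> ^ m * fps_nth F m"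
    and "\<And>b m. local_on {b + 1..b + m} (\<phi> b m)"
  shows "rep \<kappa> x (cfps F) (\<lambda>b m w. of_real (\<phi> b m w))"
  unfolding rep_def
proof (intro allI conjI)
  fix b m
  show "of_real \<kappa> ^ m * fps_nth (cfps F) m = Wc x {b + 1..b + m} (\<lambda>w. of_real (\<phi> b m w))"
    unfolding of_real_word_sum[symmetric] assms(1) by simp
  show "local_on {b + 1..b + m} (\<lambda>w. complex_of_real (\<phi> b m w))"
    using assms(2)[of b m] unfolding local_on_def by metis
qed

lemma rep_cong: "rep \<kappa> x F \<phi> \<Longrightarrow> (\<And>b m w. \<phi> b m w = \<psi> b m w) \<Longrightarrow> rep \<kappa> x F \<psi>"
  by (metis ext)

lemma rep_const_mult:
  assumes "rep \<kappa> x F \<phi>"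
  shows "rep \<kappa> x (fps_const c * F) (\<lambda>b m w. c * \<phi> b m w)"
  using assms unfolding rep_def
  by (auto simp: word_sum_cmult intro!: local_on_mult local_on_const)

lemma rep_sum:
  assumes "\<And>i. rep \<kappa> x (F i) (\<phi> i)"
  shows "rep \<kappa> x (\<Sum>i\<in>I. F i) (\<lambda>b m w. \<Sum>i\<in>I. \<phi> i b m w)"
  using assms unfolding rep_def
  by (auto simp: word_sum_sum fps_sum_nth sum_distrib_left intro!: local_on_sum)

text \<open>A block of length m splits into adjacent blocks of lengths i and m - i; by locality the
  sum over words splits accordingly, and summing over i gives the Cauchy product.\<close>

lemma rep_mult:
  assumes F: "rep \<kappa> x F \<phi>" and G: "rep \<kappa> x G \<psi>"
  shows "rep \<kappa> x (F * G) (conv \<phi> \<psi>)"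
  unfolding rep_def
proof (intro allI conjI)
  fix b m
  have "of_real \<kappa> ^ m * fps_nth (F * G) m =
      (\<Sum>i\<in>{0..m}. (of_real \<kappa> ^ i * fps_nth F i) * (of_real \<kappa> ^ (m - i) * fps_nth G (m - i)))"
    unfolding fps_mult_nth sum_distrib_left
    by (intro sum.cong refl) (simp add: ac_simps flip: power_add)
  also have "\<dots> = (\<Sum>i\<in>{0..m}. Wc x {b + 1..b + m} (\<lambda>w. \<phi> b i w * \<psi> (b + i) (m - i) w))"
  proof (intro sum.cong refl)
    fix i assume i: "i \<in> {0..m}"
    have "of_real \<kappa> ^ i * fps_nth F i * (of_real \<kappa> ^ (m - i) * fps_nth G (m - i)) =
        Wc x {b + 1..b + i} (\<phi> b i) * Wc x {b + i + 1..b + i + (m - i)} (\<psi> (b + i) (m - i))"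
      using F G unfolding rep_def by metis
    also have "\<dots> = Wc x ({b + 1..b + i} \<union> {b + i + 1..b + i + (m - i)}) (\<lambda>w. \<phi> b i w * \<psi> (b + i) (m - i) w)"
    proof (rule word_sum_Un[symmetric])
      show "local_on {b + 1..b + i} (\<phi> b i)" using F unfolding rep_def by blast
      show "local_on {b + i + 1..b + i + (m - i)} (\<psi> (b + i) (m - i))" using G unfolding rep_def by blast
    qed auto
    also have "{b + 1..b + i} \<union> {b + i + 1..b + i + (m - i)} = {b + 1..b + m}" using i by auto
    finally show "of_real \<kappa> ^ i * fps_nth F i * (of_real \<kappa> ^ (m - i) * fps_nth G (m - i)) =
        Wc x {b + 1..b + m} (\<lambda>w. \<phi> b i w * \<psi> (b + i) (m - i) w)" .
  qed
  also have "\<dots> = Wc x {b + 1..b + m} (conv \<phi> \<psi> b m)"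
    unfolding word_sum_sum[symmetric] by (rule word_sum_cong) (simp add: conv_def)
  finally show "of_real \<kappa> ^ m * fps_nth (F * G) m = Wc x {b + 1..b + m} (conv \<phi> \<psi> b m)" .
  have "local_on {b + 1..b + m} (\<lambda>w. \<Sum>i\<in>{0..m}. \<phi> b i w * \<psi> (b + i) (m - i) w)"
  proof (intro local_on_sum local_on_mult)
    fix i assume i: "i \<in> {0..m}"
    show "local_on {b + 1..b + m} (\<phi> b i)"
    proof (rule local_on_mono)
      show "local_on {b + 1..b + i} (\<phi> b i)" using F unfolding rep_def by blast
    qed (use i in auto)
    show "local_on {b + 1..b + m} (\<psi> (b + i) (m - i))"
    proof (rule local_on_mono)
      show "local_on {b + i + 1..b + i + (m - i)} (\<psi> (b + i) (m - i))" using G unfolding rep_def by blast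
    qed (use i in auto)
  qed
  then show "local_on {b + 1..b + m} (conv \<phi> \<psi> b m)"
    by (simp add: conv_def[abs_def])
qed

lemma rep_eval: "rep \<kappa> x F \<phi> \<Longrightarrow> of_real \<kappa> ^ n * fps_nth F n = Wc x {1..n} (\<phi> 0 n)"
  unfolding rep_def by (drule spec[of _ 0], drule spec[of _ n]) simp

text \<open>Offset and length come first, as \<open>conv\<close> expects, and the blocks stay opaque
  while products are rearranged.\<close>

definition h_comp :: "real \<Rightarrow> 4 \<Rightarrow> 4 \<Rightarrow> nat \<Rightarrow> nat \<Rightarrow> (nat \<Rightarrow> 'l) \<Rightarrow> real" where
  "h_comp \<kappa> \<alpha> \<beta> b m w = h_block \<kappa> (\<lambda>j. M (w j)) (\<lambda>j. N (w j)) b m \<alpha> \<beta>"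

definition h'_comp :: "real \<Rightarrow> 4 \<Rightarrow> 4 \<Rightarrow> 4 \<Rightarrow> nat \<Rightarrow> nat \<Rightarrow> (nat \<Rightarrow> 'l) \<Rightarrow> real" where
  "h'_comp \<kappa> \<rho> \<alpha> \<beta> b m w = h'_block \<kappa> (\<lambda>j. M (w j)) (\<lambda>j. N (w j)) (\<lambda>j. P (w j)) b m \<rho> \<alpha> \<beta>"

definition v_comp :: "real \<Rightarrow> nat \<Rightarrow> nat \<Rightarrow> (nat \<Rightarrow> 'l) \<Rightarrow> real" where
  "v_comp \<kappa> b m w = v_block \<kappa> (\<lambda>j. M (w j)) (\<lambda>j. N (w j)) b m"

definition \<Gamma>_comp :: "real \<Rightarrow> 4 \<Rightarrow> 4 \<Rightarrow> 4 \<Rightarrow> nat \<Rightarrow> (nat \<Rightarrow> 'l) \<Rightarrow> real" where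
  "\<Gamma>_comp \<kappa> \<alpha> \<beta> \<rho> i w = \<Gamma>_block \<kappa> (\<lambda>j. M (w j)) (\<lambda>j. N (w j)) (\<lambda>j. P (w j)) i \<alpha> \<beta> \<rho>"

lemma local_h_comp: "local_on {b + 1..b + m} (h_comp \<kappa> \<alpha> \<beta> b m)"
  unfolding h_comp_def[abs_def] by (rule local_h_block)

lemma local_h'_comp: "local_on {b + 1..b + m} (h'_comp \<kappa> \<rho> \<alpha> \<beta> b m)"
  unfolding h'_comp_def[abs_def] by (rule local_h'_block)

lemma rep_ginv: "rep \<kappa> x (cfps (ginv_fps (h x) \<alpha> \<beta>)) (\<lambda>b m w. of_real ((- 1) ^ m * h_comp \<kappa> \<alpha> \<beta> b m w))"
proof (rule repI)
  show "W x {b + 1..b + m} (\<lambda>w. (- 1) ^ m * h_comp \<kappa> \<alpha> \<beta> b m w) = \<kappa> ^ m * fps_nth (ginv_fps (h x) \<alpha> \<beta>) m" for b m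
    unfolding word_sum_cmult h_comp_def hpow_W ginv_fps_def by simp
qed (intro local_on_mult local_on_const local_h_comp)

lemma rep_viel: "rep \<kappa> x (cfps (viel_fps (h x) \<alpha> \<beta>))
  (\<lambda>b m w. of_real (((1/2) gchoose m) * (\<Sum>\<nu>\<in>UNIV. \<eta> $ \<alpha> $ \<nu> * h_comp \<kappa> \<nu> \<beta> b m w)))"
proof (rule repI)
  show "W x {b + 1..b + m} (\<lambda>w. ((1/2) gchoose m) * (\<Sum>\<nu>\<in>UNIV. \<eta> $ \<alpha> $ \<nu> * h_comp \<kappa> \<nu> \<beta> b m w)) =
      \<kappa> ^ m * fps_nth (viel_fps (h x) \<alpha> \<beta>) m" for b m
    unfolding word_sum_cmult word_sum_sum h_comp_def hpow_W viel_fps_def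
    by (simp add: sum_distrib_left ac_simps)
qed (intro local_on_mult local_on_const local_on_sum local_h_comp)

lemma rep_iviel: "rep \<kappa> x (cfps (iviel_fps (h x) \<alpha> \<beta>)) (\<lambda>b m w. of_real (((- 1/2) gchoose m) * h_comp \<kappa> \<alpha> \<beta> b m w))"
proof (rule repI)
  show "W x {b + 1..b + m} (\<lambda>w. ((- 1/2) gchoose m) * h_comp \<kappa> \<alpha> \<beta> b m w) = \<kappa> ^ m * fps_nth (iviel_fps (h x) \<alpha> \<beta>) m" for b m
    unfolding word_sum_cmult h_comp_def hpow_W iviel_fps_def by simp
qed (intro local_on_mult local_on_const local_h_comp)

lemma rep_dviel: "rep \<kappa> x (cfps (dviel_fps h x \<rho> \<alpha> \<beta>))
  (\<lambda>b m w. of_real (((1/2) gchoose m) * (\<Sum>\<nu>\<in>UNIV. \<eta> $ \<alpha> $ \<nu> * h'_comp \<kappa> \<rho> \<nu> \<beta> b m w)))"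
proof (rule repI)
  show "W x {b + 1..b + m} (\<lambda>w. ((1/2) gchoose m) * (\<Sum>\<nu>\<in>UNIV. \<eta> $ \<alpha> $ \<nu> * h'_comp \<kappa> \<rho> \<nu> \<beta> b m w)) =
      \<kappa> ^ m * fps_nth (dviel_fps h x \<rho> \<alpha> \<beta>) m" for b m
    unfolding word_sum_cmult word_sum_sum h'_comp_def hpow_partial_W dviel_fps_def
    by (simp add: sum_distrib_left ac_simps)
qed (intro local_on_mult local_on_const local_on_sum local_h'_comp)

lemma rep_vol: "rep \<kappa> x (cfps (vol_fps (power_traces (\<eta> ** h x)))) (\<lambda>b m w. of_real (v_comp \<kappa> b m w))"
  unfolding v_comp_def by (rule repI, rule v_block_W, rule local_v_block)

lemma rep_chr1: "rep \<kappa> x (cfps (chr1_fps h x \<alpha> \<beta> \<rho>)) (single_letter (\<lambda>i w. of_real (\<Gamma>_comp \<kappa> \<alpha> \<beta> \<rho> i w)))"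
proof (rule rep_cong)
  show "rep \<kappa> x (cfps (chr1_fps h x \<alpha> \<beta> \<rho>)) (\<lambda>b m w. of_real (single_letter (\<Gamma>_comp \<kappa> \<alpha> \<beta> \<rho>) b m w))"
  proof (rule repI)
    fix b m
    have "W x {b + 1..b + 1} (\<Gamma>_comp \<kappa> \<alpha> \<beta> \<rho> (b + 1)) = \<kappa> * chr1 h x \<alpha> \<beta> \<rho>"
      using chr1_W[of x "b + 1" \<kappa> \<alpha> \<beta> \<rho>] by (simp add: \<Gamma>_comp_def[abs_def])
    then show "W x {b + 1..b + m} (single_letter (\<Gamma>_comp \<kappa> \<alpha> \<beta> \<rho>) b m) = \<kappa> ^ m * fps_nth (chr1_fps h x \<alpha> \<beta> \<rho>) m"
      by (cases "m = 1") (simp_all add: single_letter_def[abs_def] chr1_fps_def word_sum_def)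
    show "local_on {b + 1..b + m} (single_letter (\<Gamma>_comp \<kappa> \<alpha> \<beta> \<rho>) b m)"
      using local_\<Gamma>_block[of "b + 1" \<kappa> M N P \<alpha> \<beta> \<rho>]
      by (cases "m = 1") (simp_all add: single_letter_def[abs_def] \<Gamma>_comp_def[abs_def] local_on_const)
  qed
qed (simp add: single_letter_def)

text \<open>The closure properties of \<open>rep\<close> follow the structure of
  \<open>vertex_sum\<close> and produce an iterated \<open>conv\<close>; what remains is to
  recognise it as the sum over block sizes in the vertex.\<close>

lemma lagr_fps_W:
  "of_real \<kappa> ^ n * fps_nth (lagr_fps T h x) n =
    Wc x {1..n} (\<lambda>w. unsym_vertex \<kappa> (map_matter (\<lambda>f. f x) T) n (\<lambda>j. M (w j)) (\<lambda>j. N (w j)) (\<lambda>j. P (w j)))"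
proof -
  note reps = rep_sum rep_const_mult rep_mult rep_ginv rep_viel rep_iviel rep_dviel rep_vol rep_chr1
  note comps = h_comp_def[symmetric] h'_comp_def[symmetric] v_comp_def[symmetric] \<Gamma>_comp_def[symmetric]
  note unf = unsym_vertex_def Let_def matter.case matter.map o_apply comps
  have p1: "(y + 1 = Suc m) = (y = m)" "(y + 1 = (0::nat)) = False" "(y + 2 = Suc (Suc m)) = (y = m)" for y m :: nat
    by simp_all
  note c1 = p1 conv_single_letter nat.distinct if_False diff_Suc_1 add_0
  note c = conv_def of_real_sum of_real_mult add_0 add_0_right sum_distrib_left power_add
  show ?thesis
  proof (cases T)
    case (Type1 F)
    show ?thesis
      unfolding Type1 lagr_fps_def vertex_sum_def matter.case matter.map
      by (rule trans[OF rep_eval], (rule reps)+, rule word_sum_cong) (simp only: unf)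
  next
    case (Type2 F)
    show ?thesis
      unfolding Type2 lagr_fps_def vertex_sum_def matter.case matter.map o_apply
      by (rule trans[OF rep_eval], (rule reps)+, rule word_sum_cong)
        (simp only: unf sum_tuple2, simp only: c mult_ac)
  next
    case (Type3 F)
    show ?thesis
      unfolding Type3 lagr_fps_def vertex_sum_def matter.case matter.map o_apply
      by (rule trans[OF rep_eval], (rule reps)+, rule word_sum_cong)
        (simp only: unf sum_tuple3, simp only: c mult_ac)
  next
    case (Type4 F)
    show ?thesis
    \<comment> \<open>For n = 0 there is no letter for the Christoffel factor: the convolution
      vanishes, and the set of block sizes is empty.\<close>
    proof (cases n)
      case 0
      show ?thesis
        unfolding 0 Type4 lagr_fps_def vertex_sum_def matter.case matter.map o_apply
        by (rule trans[OF rep_eval], (rule reps)+, rule word_sum_cong)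
          (simp add: unf conv_single_letter case_prod_unfold)
    next
      case (Suc n')
      show ?thesis
        unfolding Suc Type4 lagr_fps_def vertex_sum_def matter.case matter.map o_apply
        by (rule trans[OF rep_eval], (rule reps)+, rule word_sum_cong)
          (simp only: unf c1 sum_tuple3, simp only: c mult_ac)
    qed
  next
    case (Type5 F)
    show ?thesis
    proof (cases n)
      case 0
      show ?thesis
        unfolding 0 Type5 lagr_fps_def vertex_sum_def matter.case matter.map o_apply
        by (rule trans[OF rep_eval], (rule reps)+, rule word_sum_cong)
          (simp add: unf conv_single_letter case_prod_unfold)
    next
      case (Suc n')
      show ?thesis
        unfolding Suc Type5 lagr_fps_def vertex_sum_def matter.case matter.map o_apply
        by (rule trans[OF rep_eval], (rule reps)+, rule word_sum_cong)
          (simp only: unf c1 sum_tuple4, simp only: c mult_ac)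
    qed
  next
    case (Type6 F)
    \<comment> \<open>Two Christoffel factors use up two letters, so both sides vanish for n = 0 and
      n = 1.\<close>
    consider "n = 0" | "n = 1" | n' where "n = Suc (Suc n')" by (metis One_nat_def not0_implies_Suc)
    then show ?thesis
    proof cases
      case 1
      show ?thesis
        unfolding 1 Type6 lagr_fps_def vertex_sum_def matter.case matter.map o_apply
        by (rule trans[OF rep_eval], (rule reps)+, rule word_sum_cong)
          (simp add: unf conv_single_letter case_prod_unfold)
    next
      case 2
      show ?thesis
        unfolding 2 Type6 lagr_fps_def vertex_sum_def matter.case matter.map o_apply
        by (rule trans[OF rep_eval], (rule reps)+, rule word_sum_cong)
          (simp add: unf conv_single_letter case_prod_unfold)
    next
      case (3 n')
      show ?thesis
        unfolding 3 Type6 lagr_fps_def vertex_sum_def matter.case matter.map o_apply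
        by (rule trans[OF rep_eval], (rule reps)+, rule word_sum_cong)
          (simp only: unf c1 one_add_one sum_tuple5, simp only: c mult_ac)
    qed
  next
    case (Type7 F)
    show ?thesis
      unfolding Type7 lagr_fps_def vertex_sum_def matter.case matter.map o_apply
      by (rule trans[OF rep_eval], (rule reps)+, rule word_sum_cong)
        (simp only: unf sum_tuple2, simp only: c mult_ac)
  next
    case (Type8 F)
    show ?thesis
      unfolding Type8 lagr_fps_def vertex_sum_def matter.case matter.map o_apply
      by (rule trans[OF rep_eval], (rule reps)+, rule word_sum_cong)
        (simp only: unf sum_tuple3, simp only: c mult_ac)
  next
    case (Type9 F)
    show ?thesis
      unfolding Type9 lagr_fps_def vertex_sum_def matter.case matter.map o_apply
      by (rule trans[OF rep_eval], (rule reps)+, rule word_sum_cong)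
        (simp only: unf eta_sum sum_tuple5, simp only: c mult_ac)
  next
    case (Type10 F)
    show ?thesis
    proof (cases n)
      case 0
      show ?thesis
        unfolding 0 Type10 lagr_fps_def vertex_sum_def matter.case matter.map o_apply
        by (rule trans[OF rep_eval], (rule reps)+, rule word_sum_cong)
          (simp add: unf conv_single_letter case_prod_unfold)
    next
      case (Suc n')
      show ?thesis
        unfolding Suc Type10 lagr_fps_def vertex_sum_def matter.case matter.map o_apply
        by (rule trans[OF rep_eval], (rule reps)+, rule word_sum_cong)
          (simp only: unf c1 sum_tuple5, simp only: c mult_ac)
    qed
  qed
qed

end

section \<open>Transforms and functional derivatives\<close>

text \<open>Among the momenta with nonzero coefficient take \<open>P0\<close> of maximal norm. Along
  the ray through \<open>P0\<close>, after division by its own exponential, every other term decays,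
  because P \<bullet> P0 < P0 \<bullet> P0 for any other P of norm at most that of
  \<open>P0\<close>; the coefficient of \<open>P0\<close> is then the limit of the zero
  function.\<close>

lemma exponentials_independent:
  fixes c :: "real^4 \<Rightarrow> complex"
  assumes S: "finite S" and z: "\<And>x. (\<Sum>P\<in>S. c P * of_real (exp (P \<bullet> x))) = 0"
  shows "\<forall>P\<in>S. c P = 0"
proof (rule ccontr)
  define S' where "S' = {P\<in>S. c P \<noteq> 0}"
  assume "\<not> (\<forall>P\<in>S. c P = 0)"
  then have S': "finite S'" "S' \<noteq> {}" using S by (auto simp: S'_def)
  then have "Max (norm ` S') \<in> norm ` S'" by (intro Max_in) auto
  then obtain P0 where "P0 \<in> S'" "norm P0 = Max (norm ` S')" by auto
  then have P0: "P0 \<in> S'" "\<And>P. P \<in> S' \<Longrightarrow> norm P \<le> norm P0"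
    using S' by (auto intro!: Max_ge)
  have neg: "P \<bullet> P0 - P0 \<bullet> P0 < 0" if "P \<in> S'" "P \<noteq> P0" for P
  proof -
    have "0 < (P - P0) \<bullet> (P - P0)" using that by simp
    also have "\<dots> = P \<bullet> P + P0 \<bullet> P0 - 2 * (P \<bullet> P0)"
      by (simp add: inner_diff_left inner_diff_right inner_commute)
    also have "P \<bullet> P \<le> P0 \<bullet> P0" using P0(2)[OF that(1)] by (simp add: norm_le)
    finally show ?thesis by simp
  qed
  have "((\<lambda>t. \<Sum>P\<in>S'. c P * of_real (exp (t * (P \<bullet> P0 - P0 \<bullet> P0)))) \<longlongrightarrow>
      (\<Sum>P\<in>S'. if P = P0 then c P0 else 0)) at_top"
  proof (rule tendsto_sum)
    fix P assume P: "P \<in> S'"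
    show "((\<lambda>t. c P * of_real (exp (t * (P \<bullet> P0 - P0 \<bullet> P0)))) \<longlongrightarrow> (if P = P0 then c P0 else 0)) at_top"
    proof (cases "P = P0")
      case False
      have "((\<lambda>t. exp (t * (P \<bullet> P0 - P0 \<bullet> P0))) \<longlongrightarrow> 0) at_top"
        using neg[OF P False]
        by (intro filterlim_compose[OF exp_at_bot] filterlim_tendsto_neg_mult_at_bot[OF tendsto_const])
           (auto simp: mult.commute[of _ "P \<bullet> P0 - P0 \<bullet> P0"] intro!: filterlim_ident filterlim_tendsto_neg_mult_at_bot[OF tendsto_const])
      then have "((\<lambda>t. c P * of_real (exp (t * (P \<bullet> P0 - P0 \<bullet> P0)))) \<longlongrightarrow> c P * of_real 0) at_top"
        by (intro tendsto_mult tendsto_const tendsto_of_real)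
      with False show ?thesis by simp
    qed simp
  qed
  moreover have "(\<Sum>P\<in>S'. c P * of_real (exp (t * (P \<bullet> P0 - P0 \<bullet> P0)))) = 0" for t
  proof -
    have "(\<Sum>P\<in>S'. c P * of_real (exp (t * (P \<bullet> P0 - P0 \<bullet> P0)))) =
        of_real (exp (- t * (P0 \<bullet> P0))) * (\<Sum>P\<in>S'. c P * of_real (exp (P \<bullet> (t *\<^sub>R P0))))"
      unfolding sum_distrib_left
      by (intro sum.cong refl) (simp add: algebra_simps exp_diff exp_minus divide_inverse)
    also have "(\<Sum>P\<in>S'. c P * of_real (exp (P \<bullet> (t *\<^sub>R P0)))) = (\<Sum>P\<in>S. c P * of_real (exp (P \<bullet> (t *\<^sub>R P0))))"
      by (rule sum.mono_neutral_left) (auto simp: S'_def S)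
    finally show ?thesis by (simp only: z mult_zero_right)
  qed
  ultimately have "((\<lambda>t::real. 0) \<longlongrightarrow> c P0) at_top" using S' P0(1) by simp
  then have "c P0 = 0" by (simp add: tendsto_const_iff)
  then show False using P0(1) by (simp add: S'_def)
qed

section \<open>Transforms of finite superpositions\<close>

lemma is_transform_superset:
  assumes "is_transform f A" "finite S" "\<And>P. A P \<noteq> 0 \<Longrightarrow> P \<in> S"
  shows "f x = (\<Sum>P\<in>S. A P * of_real (exp (P \<bullet> x)))"
  using assms unfolding is_transform_def by (auto intro!: sum.mono_neutral_left)

lemma is_transformI:
  assumes "finite S" "\<And>P. A P \<noteq> 0 \<Longrightarrow> P \<in> S" "\<And>x. f x = (\<Sum>P\<in>S. A P * of_real (exp (P \<bullet> x)))"
  shows "is_transform f A"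
  unfolding is_transform_def
proof (intro conjI allI)
  show fin: "finite {P. A P \<noteq> 0}" using assms by (auto intro: finite_subset)
  show "f x = (\<Sum>P | A P \<noteq> 0. A P * of_real (exp (P \<bullet> x)))" for x
    unfolding assms(3) by (rule sum.mono_neutral_right) (use assms in auto)
qed

lemma is_transform_unique:
  assumes "is_transform f A" "is_transform f B"
  shows "A = B"
proof (rule ext)
  fix P
  let ?S = "insert P ({P. A P \<noteq> 0} \<union> {P. B P \<noteq> 0})"
  have S: "finite ?S" using assms by (simp add: is_transform_def)
  have "\<forall>P\<in>?S. A P - B P = 0"
  proof (rule exponentials_independent[OF S])
    fix x
    have "(\<Sum>P\<in>?S. A P * of_real (exp (P \<bullet> x))) = (\<Sum>P\<in>?S. B P * of_real (exp (P \<bullet> x)))"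
      using is_transform_superset[OF assms(1) S, of x] is_transform_superset[OF assms(2) S, of x] by simp
    then show "(\<Sum>P\<in>?S. (A P - B P) * of_real (exp (P \<bullet> x))) = 0"
      by (simp add: left_diff_distrib sum_subtractf)
  qed
  then show "A P = B P" by simp
qed

lemma fourier_eq: "is_transform f A \<Longrightarrow> fourier f = A"
  unfolding fourier_def using is_transform_unique by blast

lemma is_transform_zero: "is_transform (\<lambda>_. 0) (\<lambda>_. 0)"
  by (rule is_transformI[of "{}"]) auto

lemma is_transform_add:
  assumes "is_transform f A" "is_transform g B"
  shows "is_transform (\<lambda>x. f x + g x) (\<lambda>P. A P + B P)"
proof (rule is_transformI)
  let ?S = "{P. A P \<noteq> 0} \<union> {P. B P \<noteq> 0}"
  show S: "finite ?S" using assms by (simp add: is_transform_def)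
  show "f x + g x = (\<Sum>P\<in>?S. (A P + B P) * of_real (exp (P \<bullet> x)))" for x
    using is_transform_superset[OF assms(1) S, of x] is_transform_superset[OF assms(2) S, of x]
    by (simp add: sum.distrib distrib_right)
qed auto

lemma is_transform_cmult:
  assumes "is_transform f A"
  shows "is_transform (\<lambda>x. c * f x) (\<lambda>P. c * A P)"
  by (rule is_transformI[of "{P. A P \<noteq> 0}"])
     (use assms in \<open>auto simp: is_transform_def sum_distrib_left mult.assoc\<close>)

lemma is_transform_cmult_right: "is_transform f A \<Longrightarrow> is_transform (\<lambda>x. f x * c) (\<lambda>P. A P * c)"
  using is_transform_cmult[of f A c] by (simp add: mult.commute)

lemma is_transform_sum:
  "finite I \<Longrightarrow> (\<And>i. i \<in> I \<Longrightarrow> is_transform (f i) (A i)) \<Longrightarrow>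
     is_transform (\<lambda>x. \<Sum>i\<in>I. f i x) (\<lambda>P. \<Sum>i\<in>I. A i P)"
  by (induction I rule: finite_induct) (auto intro: is_transform_zero is_transform_add)

lemma is_transform_shift:
  assumes "is_transform f A"
  shows "is_transform (\<lambda>x. of_real (exp (q \<bullet> x)) * f x) (\<lambda>P. A (P - q))"
proof (rule is_transformI)
  let ?S = "{P. A P \<noteq> 0}"
  show "finite ((\<lambda>P. P + q) ` ?S)" using assms by (simp add: is_transform_def)
  show "P \<in> (\<lambda>P. P + q) ` ?S" if "A (P - q) \<noteq> 0" for P
    using that by (intro image_eqI[of _ _ "P - q"]) auto
  fix x
  have "of_real (exp (q \<bullet> x)) * f x = (\<Sum>P\<in>?S. A P * of_real (exp ((P + q) \<bullet> x)))"
    using assms by (simp add: is_transform_def sum_distrib_left inner_add_left exp_add ac_simps)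
  also have "\<dots> = (\<Sum>P\<in>(\<lambda>P. P + q) ` ?S. A (P - q) * of_real (exp (P \<bullet> x)))"
    by (subst sum.reindex) (auto simp: inj_on_def)
  finally show "of_real (exp (q \<bullet> x)) * f x = (\<Sum>P\<in>(\<lambda>P. P + q) ` ?S. A (P - q) * of_real (exp (P \<bullet> x)))" .
qed

text \<open>The vertex is linear in the matter tensor with coefficients independent of the point, so
  the transform acts on each tensor component.\<close>

lemma is_transform_unsym_vertex:
  assumes "\<And>f. f \<in> set_matter T \<Longrightarrow> \<exists>A. is_transform f A"
  shows "is_transform (\<lambda>x. unsym_vertex \<kappa> (map_matter (\<lambda>f. f x) T) n \<mu> \<nu> p)
    (\<lambda>P. unsym_vertex \<kappa> (map_matter (\<lambda>f. fourier f P) T) n \<mu> \<nu> p)"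
proof -
  have *: "is_transform f (fourier f)" if "f \<in> set_matter T" for f
    using assms[OF that] fourier_eq by metis
  show ?thesis
    by (cases T; simp only: unsym_vertex_def Let_def matter.case matter.map o_apply;
        intro is_transform_sum is_transform_cmult_right finite; rule *; simp; blast?)
qed

lemma local_on_comp: "local_on S \<phi> \<Longrightarrow> local_on S (\<lambda>w. f (\<phi> w))"
  unfolding local_on_def by metis

lemma local_unsym_vertex:
  "local_on {1..n} (\<lambda>w. unsym_vertex \<kappa> T n (\<lambda>j. M (w j)) (\<lambda>j. N (w j)) (\<lambda>j. P (w j)))"
proof -
  note l = local_on_sum local_on_mult local_on_const local_on_comp[of _ _ complex_of_real]
    local_on_mono[OF local_h_block] local_on_mono[OF local_h'_block] local_on_mono[OF local_v_block]
    local_on_mono[OF local_\<Gamma>_block]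
  show ?thesis
    by (cases T; simp only: unsym_vertex_def Let_def matter.case case_prod_unfold sum_distrib_left; intro l; auto)
qed

text \<open>\<open>D m\<close> is the monomial with exponents \<open>a\<close> after differentiation
  in its first m variables. If \<open>a i = 0\<close>, the truncated exponent is harmless because of
  the factor \<open>real (a i)\<close>.\<close>

lemma monomial_derivative:
  fixes a :: "nat \<Rightarrow> nat" and t :: "nat \<Rightarrow> real"
  assumes m: "Suc m \<le> n"
  defines "D \<equiv> \<lambda>m t. \<Prod>i\<in>{1..n}. if i \<le> m then real (a i) * t i ^ (a i - 1) else t i ^ a i"
  shows "((\<lambda>s. D m (t(Suc m := t (Suc m) + s))) has_real_derivative D (Suc m) t) (at 0)"
proof -
  define R where "R = (\<Prod>i\<in>{1..n} - {Suc m}. if i \<le> m then real (a i) * t i ^ (a i - 1) else t i ^ a i)"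
  have "D m (t(Suc m := t (Suc m) + s)) = (t (Suc m) + s) ^ a (Suc m) * R" for s
    unfolding D_def R_def using m by (subst prod.remove[of _ "Suc m"]) (auto intro!: prod.cong cong: if_cong)
  moreover have "D (Suc m) t = real (a (Suc m)) * t (Suc m) ^ (a (Suc m) - 1) * R"
  proof -
    have "R = (\<Prod>i\<in>{1..n} - {Suc m}. if i \<le> Suc m then real (a i) * t i ^ (a i - 1) else t i ^ a i)"
      unfolding R_def by (intro prod.cong refl) (auto simp: le_Suc_eq)
    then show ?thesis unfolding D_def using m by (subst prod.remove[of _ "Suc m"]) auto
  qed
  moreover have "((\<lambda>s. (t (Suc m) + s) ^ a (Suc m) * R) has_real_derivative
      real (a (Suc m)) * t (Suc m) ^ (a (Suc m) - 1) * R) (at 0)"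
    by (auto intro!: derivative_eq_intros)
  ultimately show ?thesis by simp
qed

text \<open>On the span of the modes \<open>F\<close> is a polynomial in the amplitudes
  \<open>t\<close>, with one monomial per word. Differentiating once in each amplitude and setting
  all of them to 0 keeps exactly the monomials t1 ... tn.\<close>

lemma func_derivs_multilinear:
  fixes F :: "(real^4 \<Rightarrow> real^4^4) \<Rightarrow> complex" and K :: "'w \<Rightarrow> complex" and u :: "'w \<Rightarrow> nat \<Rightarrow> nat"
  assumes fin: "finite S"
    and F: "\<And>t. F (\<lambda>q. \<Sum>i\<in>{1..n}. t i *\<^sub>R graviton_mode (\<mu> i) (\<nu> i) (p i) q) =
      (\<Sum>w\<in>S. of_real (\<Prod>j\<in>{1..n}. t (u w j)) * K w)"
    and u: "\<And>w j. w \<in> S \<Longrightarrow> j \<in> {1..n} \<Longrightarrow> u w j \<in> {1..n}"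
  shows "func_derivs \<mu> \<nu> p n F (\<lambda>_. 0) = (\<Sum>w\<in>{w\<in>S. bij_betw (u w) {1..n} {1..n}}. K w)"
proof -
  define H where "H t q = (\<Sum>i\<in>{1..n}. t i *\<^sub>R graviton_mode (\<mu> i) (\<nu> i) (p i) q)" for t q
  define a where "a w i = card {j\<in>{1..n}. u w j = i}" for w i
  define D where "D m w t = (\<Prod>i\<in>{1..n}. if i \<le> m then real (a w i) * t i ^ (a w i - 1) else t i ^ a w i)" for m w and t :: "nat \<Rightarrow> real"
  \<comment> \<open>The statement holds at every amplitude vector, since each further derivative
    needs the previous one in a neighbourhood of 0.\<close>
  have main: "func_derivs \<mu> \<nu> p m F (H t) = (\<Sum>w\<in>S. of_real (D m w t) * K w)" if "m \<le> n" for m t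
    using that
  proof (induction m arbitrary: t)
    case 0
    have "(\<Prod>j\<in>{1..n}. t (u w j)) = D 0 w t" if "w \<in> S" for w
    proof -
      have "(\<Prod>j\<in>{1..n}. t (u w j)) = (\<Prod>i\<in>{1..n}. \<Prod>j\<in>{j\<in>{1..n}. u w j = i}. t (u w j))"
        by (rule prod.group[symmetric]) (use u[OF that] in auto)
      also have "\<dots> = D 0 w t" by (simp add: D_def a_def)
      finally show ?thesis .
    qed
    then show ?case using F[of t] by (simp add: H_def[abs_def])
  next
    case (Suc m)
    have H: "(\<lambda>q. H t q + s *\<^sub>R graviton_mode (\<mu> (Suc m)) (\<nu> (Suc m)) (p (Suc m)) q) = H (t(Suc m := t (Suc m) + s))" for s
    proof
      fix q
      show "H t q + s *\<^sub>R graviton_mode (\<mu> (Suc m)) (\<nu> (Suc m)) (p (Suc m)) q = H (t(Suc m := t (Suc m) + s)) q"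
        unfolding H_def using Suc.prems
        by (subst (1 2) sum.remove[of _ "Suc m"]) (auto simp: scaleR_add_left intro!: sum.cong)
    qed
    have IH: "func_derivs \<mu> \<nu> p m F (H t') = (\<Sum>w\<in>S. of_real (D m w t') * K w)" for t'
      using Suc by simp
    have "func_derivs \<mu> \<nu> p (Suc m) F (H t) =
        vector_derivative (\<lambda>s. \<Sum>w\<in>S. of_real (D m w (t(Suc m := t (Suc m) + s))) * K w) (at 0)"
      unfolding func_derivs.simps func_deriv_def H IH ..
    also have "\<dots> = (\<Sum>w\<in>S. of_real (D (Suc m) w t) * K w)"
    proof (rule vector_derivative_at)
      have "((\<lambda>s. complex_of_real (D m w (t(Suc m := t (Suc m) + s)))) has_vector_derivative of_real (D (Suc m) w t)) (at 0)" for w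
        using monomial_derivative[OF Suc.prems, of "a w" t]
        by (intro has_vector_derivative_of_real) (simp add: D_def has_real_derivative_iff_has_vector_derivative)
      then show "((\<lambda>s. \<Sum>w\<in>S. of_real (D m w (t(Suc m := t (Suc m) + s))) * K w) has_vector_derivative
          (\<Sum>w\<in>S. of_real (D (Suc m) w t) * K w)) (at 0)"
        by (intro has_vector_derivative_sum has_vector_derivative_mult_left)
    qed
    finally show ?case .
  qed
  \<comment> \<open>If each graviton occurs once, every factor is 1 times 0^0 = 1; otherwise some
    graviton is missing, and its multiplicity 0 is a factor.\<close>
  have D: "D n w (\<lambda>_. 0) = (if bij_betw (u w) {1..n} {1..n} then 1 else 0)" if "w \<in> S" for w
  proof (cases "bij_betw (u w) {1..n} {1..n}")
    case True
    have "a w i = 1" if "i \<in> {1..n}" for i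
    proof -
      have inj: "inj_on (u w) {1..n}" and "u w ` {1..n} = {1..n}" using True by (simp_all add: bij_betw_def)
      then have "i \<in> u w ` {1..n}" using that by simp
      then obtain j where "i = u w j" "j \<in> {1..n}" by (rule imageE)
      then have "{j\<in>{1..n}. u w j = i} = {j}" by (auto dest: inj_onD[OF inj])
      then show ?thesis by (simp add: a_def)
    qed
    then show ?thesis using True by (simp add: D_def)
  next
    case False
    have "u w ` {1..n} \<subseteq> {1..n}" using u[OF that] by auto
    moreover have "u w ` {1..n} \<noteq> {1..n}"
      using False eq_card_imp_inj_on[of "{1..n}" "u w"] by (auto simp: bij_betw_def)
    ultimately have "\<not> {1..n} \<subseteq> u w ` {1..n}" by blast
    then obtain i where "i \<in> {1..n}" "i \<notin> u w ` {1..n}" by blast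
    then have "a w i = 0" by (auto simp: a_def)
    then have "D n w (\<lambda>_. 0) = 0" unfolding D_def using \<open>i \<in> {1..n}\<close> by (intro prod_zero) auto
    with False show ?thesis by simp
  qed
  have "H (\<lambda>_. 0) = (\<lambda>_. 0)" by (simp add: H_def[abs_def])
  then have "func_derivs \<mu> \<nu> p n F (\<lambda>_. 0) = (\<Sum>w\<in>S. of_real (D n w (\<lambda>_. 0)) * K w)"
    using main[of n "\<lambda>_. 0"] by simp
  also have "\<dots> = (\<Sum>w\<in>S. if bij_betw (u w) {1..n} {1..n} then K w else 0)"
    by (intro sum.cong refl) (simp add: D)
  also have "\<dots> = (\<Sum>w\<in>{w\<in>S. bij_betw (u w) {1..n} {1..n}}. K w)"
    by (rule sum.inter_filter[OF fin, symmetric])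
  finally show ?thesis .
qed

text \<open>Gravitons may share a momentum and then add up in a single amplitude. Exchanging the
  sums over momenta and gravitons separates them again.\<close>

lemma graviton_field_modes:
  fixes n :: nat
  shows "graviton_field (\<lambda>q. \<Sum>i\<in>{1..n}. t i *\<^sub>R graviton_mode (\<mu> i) (\<nu> i) (p i) q) x =
    (\<Sum>i\<in>{1..n}. (t i * exp (p i \<bullet> x)) *\<^sub>R graviton_mode (\<mu> i) (\<nu> i) (p i) (p i))"
proof -
  define H where "H q = (\<Sum>i\<in>{1..n}. t i *\<^sub>R graviton_mode (\<mu> i) (\<nu> i) (p i) q)" for q
  have 0: "H q = 0" if "q \<notin> p ` {1..n}" for q
    unfolding H_def using that by (intro sum.neutral) (auto simp: graviton_mode_def)
  have "graviton_field H x = (\<Sum>q\<in>p ` {1..n}. exp (q \<bullet> x) *\<^sub>R H q)"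
    unfolding graviton_field_def using 0 by (intro sum.mono_neutral_left) auto
  also have "\<dots> = (\<Sum>q\<in>p ` {1..n}. \<Sum>i\<in>{1..n}. (t i * exp (q \<bullet> x)) *\<^sub>R graviton_mode (\<mu> i) (\<nu> i) (p i) q)"
    by (simp add: H_def scaleR_sum_right mult.commute)
  also have "\<dots> = (\<Sum>i\<in>{1..n}. \<Sum>q\<in>p ` {1..n}. if q = p i then (t i * exp (q \<bullet> x)) *\<^sub>R graviton_mode (\<mu> i) (\<nu> i) (p i) q else 0)"
    by (subst sum.swap) (intro sum.cong refl, auto simp: graviton_mode_def)
  also have "\<dots> = (\<Sum>i\<in>{1..n}. (t i * exp (p i \<bullet> x)) *\<^sub>R graviton_mode (\<mu> i) (\<nu> i) (p i) (p i))"
    by (intro sum.cong refl) (subst sum.delta, auto)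
  finally show ?thesis unfolding H_def .
qed

text \<open>Exchanging the two index families gives the partner index of the same letter.\<close>

definition letter_index :: "(nat \<Rightarrow> 4) \<Rightarrow> (nat \<Rightarrow> 4) \<Rightarrow> nat \<times> bool \<Rightarrow> 4" where
  "letter_index \<mu> \<nu> l = (if snd l then \<nu> (fst l) else \<mu> (fst l))"

text \<open>A letter is a graviton together with the choice whether its two indices are exchanged. The
  amplitude is divided by 2, so that the two letters of a graviton add up to its symmetric mode.\<close>

lemma plane_waves_gravitons:
  "plane_waves ({1..n} \<times> UNIV) (\<lambda>l. t (fst l) / 2) (letter_index \<mu> \<nu>) (letter_index \<nu> \<mu>) (\<lambda>l. p (fst l))
    (graviton_field (\<lambda>q. \<Sum>i\<in>{1..n}. t i *\<^sub>R graviton_mode (\<mu> i) (\<nu> i) (p i) q))"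
proof
  show "finite ({1..n} \<times> (UNIV :: bool set))" by simp
  fix x
  show "graviton_field (\<lambda>q. \<Sum>i\<in>{1..n}. t i *\<^sub>R graviton_mode (\<mu> i) (\<nu> i) (p i) q) x $ a $ b =
      (\<Sum>l\<in>{1..n} \<times> UNIV. t (fst l) / 2 * exp (p (fst l) \<bullet> x) *
        (kron a (letter_index \<nu> \<mu> l) * kron b (letter_index \<mu> \<nu> l)))" for a b
    unfolding graviton_field_modes sum.cartesian_product'
    by (auto simp: sum_component graviton_mode_def UNIV_bool letter_index_def algebra_simps intro!: sum.cong)
  show "transpose (graviton_field (\<lambda>q. \<Sum>i\<in>{1..n}. t i *\<^sub>R graviton_mode (\<mu> i) (\<nu> i) (p i) q) x) =
      graviton_field (\<lambda>q. \<Sum>i\<in>{1..n}. t i *\<^sub>R graviton_mode (\<mu> i) (\<nu> i) (p i) q) x"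
    unfolding graviton_field_modes transpose_def
    by (auto simp: vec_eq_iff sum_component graviton_mode_def algebra_simps intro!: sum.cong)
qed

text \<open>At coupling 0 the eigenvalue bound reads 0 < 1. Some positive radius is all that is
  needed to read off coefficients at a point.\<close>

lemma regular_exists: "\<exists>R>0. regular R (\<eta> ** H)"
  using small_imp_regular[of 0 H] by simp

text \<open>Each word multiplies the matter part by a plane wave of its total momentum, which shifts
  the argument of the transform. The factor 1/2^n comes from the n halved amplitudes.\<close>

lemma fourier_order_part:
  fixes \<kappa> :: real and T :: "(real^4 \<Rightarrow> complex) matter"
  assumes matter: "\<And>f. f \<in> set_matter T \<Longrightarrow> \<exists>A. is_transform f A"
  shows "fourier (\<lambda>x. order_part (\<lambda>k. lagrangian k T
      (graviton_field (\<lambda>q. \<Sum>i\<in>{1..n}. t i *\<^sub>R graviton_mode (\<mu> i) (\<nu> i) (p i) q)) x) n \<kappa>) Z =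
    (\<Sum>w\<in>{1..n} \<rightarrow>\<^sub>E {1..n} \<times> UNIV. of_real (\<Prod>j\<in>{1..n}. t (fst (w j))) *
      (1 / 2 ^ n * unsym_vertex \<kappa> (map_matter (\<lambda>f. fourier f (Z - (\<Sum>j\<in>{1..n}. p (fst (w j))))) T) n
        (\<lambda>j. letter_index \<mu> \<nu> (w j)) (\<lambda>j. letter_index \<nu> \<mu> (w j)) (\<lambda>j. p (fst (w j)))))"
proof -
  define h where "h = graviton_field (\<lambda>q. \<Sum>i\<in>{1..n}. t i *\<^sub>R graviton_mode (\<mu> i) (\<nu> i) (p i) q)"
  interpret plane_waves "{1..n} \<times> UNIV" "\<lambda>l. t (fst l) / 2" "letter_index \<mu> \<nu>" "letter_index \<nu> \<mu>" "\<lambda>l. p (fst l)" h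
    unfolding h_def by (rule plane_waves_gravitons)
  define U where "U w S = unsym_vertex \<kappa> S n
    (\<lambda>j. letter_index \<mu> \<nu> (w j)) (\<lambda>j. letter_index \<nu> \<mu> (w j)) (\<lambda>j. p (fst (w j)))" for w and S :: "complex matter"
  have "order_part (\<lambda>k. lagrangian k T h x) n \<kappa> =
      (\<Sum>w\<in>{1..n} \<rightarrow>\<^sub>E {1..n} \<times> UNIV. of_real (\<Prod>j\<in>{1..n}. t (fst (w j))) * (1 / 2 ^ n) *
        (of_real (exp ((\<Sum>j\<in>{1..n}. p (fst (w j))) \<bullet> x)) * U w (map_matter (\<lambda>f. f x) T)))" for x
  proof -
    \<comment> \<open>The radius depends on the point, but the coefficients of the resulting series
      have the same word expansion everywhere.\<close>
    obtain R where R: "R > 0" "regular R (\<eta> ** h x)" using regular_exists by blast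
    have "order_part (\<lambda>k. lagrangian k T h x) n \<kappa> = of_real \<kappa> ^ n * fps_nth (lagr_fps T h x) n"
      using order_part_powser_on[OF lagrangian_series[OF R(2,1) field_differentiable symmetric] R(1)]
      by (simp add: mult.commute)
    also have "\<dots> = Wc x {1..n} (\<lambda>w. U w (map_matter (\<lambda>f. f x) T))"
      unfolding U_def by (rule lagr_fps_W)
    also have "\<dots> = (\<Sum>w\<in>{1..n} \<rightarrow>\<^sub>E {1..n} \<times> UNIV. of_real (\<Prod>j\<in>{1..n}. t (fst (w j))) * (1 / 2 ^ n) *
        (of_real (exp ((\<Sum>j\<in>{1..n}. p (fst (w j))) \<bullet> x)) * U w (map_matter (\<lambda>f. f x) T)))"
    proof -
      have "(\<Prod>j\<in>{1..n}. complex_of_real (t (fst (w j)) / 2 * exp (p (fst (w j)) \<bullet> x))) =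
        of_real (\<Prod>j\<in>{1..n}. t (fst (w j))) * (1 / 2 ^ n) * of_real (exp ((\<Sum>j\<in>{1..n}. p (fst (w j))) \<bullet> x))" for w :: "nat \<Rightarrow> nat \<times> bool"
        by (simp add: prod.distrib prod_dividef inner_sum_left exp_sum)
      then show ?thesis by (simp only: word_sum_def mult.assoc)
    qed
    finally show ?thesis .
  qed
  moreover have "is_transform (\<lambda>x. \<Sum>w\<in>{1..n} \<rightarrow>\<^sub>E {1..n} \<times> UNIV. of_real (\<Prod>j\<in>{1..n}. t (fst (w j))) * (1 / 2 ^ n) *
        (of_real (exp ((\<Sum>j\<in>{1..n}. p (fst (w j))) \<bullet> x)) * U w (map_matter (\<lambda>f. f x) T)))
      (\<lambda>P. \<Sum>w\<in>{1..n} \<rightarrow>\<^sub>E {1..n} \<times> UNIV. of_real (\<Prod>j\<in>{1..n}. t (fst (w j))) * (1 / 2 ^ n) *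
        U w (map_matter (\<lambda>f. fourier f (P - (\<Sum>j\<in>{1..n}. p (fst (w j))))) T))"
  proof (rule is_transform_sum)
    show "finite ({1..n} \<rightarrow>\<^sub>E {1..n} \<times> (UNIV :: bool set))" by (intro finite_PiE) auto
    fix w :: "nat \<Rightarrow> nat \<times> bool"
    have "is_transform (\<lambda>x. U w (map_matter (\<lambda>f. f x) T)) (\<lambda>P. U w (map_matter (\<lambda>f. fourier f P) T))"
      unfolding U_def by (rule is_transform_unsym_vertex[OF matter])
    from is_transform_cmult[OF is_transform_shift[OF this, of "\<Sum>j\<in>{1..n}. p (fst (w j))"], of "of_real (\<Prod>j\<in>{1..n}. t (fst (w j))) * (1 / 2 ^ n)"]
    show "is_transform (\<lambda>x. of_real (\<Prod>j\<in>{1..n}. t (fst (w j))) * (1 / 2 ^ n) *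
        (of_real (exp ((\<Sum>j\<in>{1..n}. p (fst (w j))) \<bullet> x)) * U w (map_matter (\<lambda>f. f x) T)))
      (\<lambda>P. of_real (\<Prod>j\<in>{1..n}. t (fst (w j))) * (1 / 2 ^ n) *
        U w (map_matter (\<lambda>f. fourier f (P - (\<Sum>j\<in>{1..n}. p (fst (w j))))) T))" .
  qed
  ultimately show ?thesis
    unfolding h_def[symmetric] U_def[symmetric] by (simp only: fourier_eq mult.assoc)
qed

text \<open>A word using every graviton once is a permutation with a flag at each position.
  \<open>X\<close> records flagged gravitons rather than positions, whence the test
  \<open>s j \<in> X\<close>.\<close>

lemma sum_bijective_words:
  fixes g :: "(nat \<Rightarrow> nat \<times> bool) \<Rightarrow> complex"
  assumes loc: "local_on {1..n} g"
  shows "(\<Sum>w\<in>{w\<in>{1..n} \<rightarrow>\<^sub>E {1..n} \<times> UNIV. bij_betw (\<lambda>j. fst (w j)) {1..n} {1..n}}. g w) =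
    (\<Sum>X\<in>Pow {1..n}. \<Sum>s\<in>{s. s permutes {1..n}}. g (\<lambda>j. (s j, s j \<in> X)))"
  unfolding sum.cartesian_product
proof (rule sum.reindex_bij_witness[of _
    "\<lambda>(X, s). restrict (\<lambda>j. (s j, s j \<in> X)) {1..n}"
    "\<lambda>w. ({i. \<exists>j\<in>{1..n}. w j = (i, True)}, \<lambda>j. if j \<in> {1..n} then fst (w j) else j)"])
  fix w :: "nat \<Rightarrow> nat \<times> bool"
  assume "w \<in> {w\<in>{1..n} \<rightarrow>\<^sub>E {1..n} \<times> UNIV. bij_betw (\<lambda>j. fst (w j)) {1..n} {1..n}}"
  then have w: "w \<in> {1..n} \<rightarrow>\<^sub>E {1..n} \<times> UNIV" and bij: "bij_betw (\<lambda>j. fst (w j)) {1..n} {1..n}" by auto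
  let ?X = "{i. \<exists>j\<in>{1..n}. w j = (i, True)}" and ?s = "\<lambda>j. if j \<in> {1..n} then fst (w j) else j"
  \<comment> \<open>A graviton occurs at one position only, so its flag can be recovered from the
    set \<open>X\<close>.\<close>
  have X: "fst (w j) \<in> ?X \<longleftrightarrow> snd (w j)" if "j \<in> {1..n}" for j
  proof
    assume "fst (w j) \<in> ?X"
    then obtain j' where j': "j' \<in> {1..n}" "w j' = (fst (w j), True)" by blast
    then have "fst (w j') = fst (w j)" by simp
    then have "j' = j" using inj_onD[OF bij_betw_imp_inj_on[OF bij], of j' j] j' that by simp
    with j' show "snd (w j)" by (metis snd_conv)
  next
    assume "snd (w j)"
    then have "w j = (fst (w j), True)" by (metis prod.collapse)
    then show "fst (w j) \<in> ?X" using that by blast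
  qed
  show eq: "(case (?X, ?s) of (X, s) \<Rightarrow> restrict (\<lambda>j. (s j, s j \<in> X)) {1..n}) = w"
  proof
    fix j
    show "(case (?X, ?s) of (X, s) \<Rightarrow> restrict (\<lambda>j. (s j, s j \<in> X)) {1..n}) j = w j"
    proof (cases "j \<in> {1..n}")
      case True
      then show ?thesis using X[OF True] by (simp add: prod_eq_iff del: mem_Collect_eq)
    next
      case False
      then show ?thesis using PiE_arb[OF w False] by (simp only: prod.case restrict_apply if_False)
    qed
  qed
  have "bij_betw ?s {1..n} {1..n}" using bij by (rule bij_betw_cong[THEN iffD1, rotated]) auto
  then have "?s permutes {1..n}" by (rule bij_imp_permutes) auto
  moreover have "?X \<subseteq> {1..n}" using PiE_mem[OF w] by fastforce
  ultimately show "(?X, ?s) \<in> Pow {1..n} \<times> {s. s permutes {1..n}}" by blast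
  \<comment> \<open>The reconstructed word and \<open>w\<close> may differ outside {1..n}, where
    \<open>w\<close> is \<open>undefined\<close>; locality of \<open>g\<close> ignores this.\<close>
  have "g (\<lambda>j. (?s j, ?s j \<in> ?X)) = g w"
    by (rule local_onD[OF loc]) (use X in \<open>auto simp: prod_eq_iff\<close>)
  then show "(case (?X, ?s) of (X, s) \<Rightarrow> g (\<lambda>j. (s j, s j \<in> X))) = g w" by simp
next
  fix Xs :: "nat set \<times> (nat \<Rightarrow> nat)"
  assume "Xs \<in> Pow {1..n} \<times> {s. s permutes {1..n}}"
  then obtain X s where Xs: "Xs = (X, s)" "X \<subseteq> {1..n}" and s: "s permutes {1..n}" by auto
  let ?w = "restrict (\<lambda>j. (s j, s j \<in> X)) {1..n}"
  have "{i. \<exists>j\<in>{1..n}. ?w j = (i, True)} = X"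
  proof (intro equalityI subsetI)
    fix i assume "i \<in> X"
    then have "i \<in> s ` {1..n}" using Xs permutes_image[OF s] by auto
    then obtain j where "j \<in> {1..n}" "i = s j" by blast
    then show "i \<in> {i. \<exists>j\<in>{1..n}. ?w j = (i, True)}" using \<open>i \<in> X\<close> by auto
  qed auto
  moreover have "(\<lambda>j. if j \<in> {1..n} then fst (?w j) else j) = s"
    using permutes_not_in[OF s] by (intro ext) auto
  ultimately show "(\<lambda>w. ({i. \<exists>j\<in>{1..n}. w j = (i, True)}, \<lambda>j. if j \<in> {1..n} then fst (w j) else j))
      (case Xs of (X, s) \<Rightarrow> restrict (\<lambda>j. (s j, s j \<in> X)) {1..n}) = Xs"
    by (simp only: Xs prod.case)
  have "bij_betw (\<lambda>j. fst (?w j)) {1..n} {1..n}"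
    using permutes_imp_bij[OF s] by (rule bij_betw_cong[THEN iffD1, rotated]) auto
  moreover have "?w \<in> {1..n} \<rightarrow>\<^sub>E {1..n} \<times> UNIV"
    using permutes_in_image[OF s] by auto
  ultimately show "(case Xs of (X, s) \<Rightarrow> restrict (\<lambda>j. (s j, s j \<in> X)) {1..n}) \<in>
      {w\<in>{1..n} \<rightarrow>\<^sub>E {1..n} \<times> UNIV. bij_betw (\<lambda>j. fst (w j)) {1..n} {1..n}}"
    unfolding Xs by simp
qed

theorem theorem4p16:
  fixes \<kappa> :: real
    and h :: "real^4 \<Rightarrow> real^4^4"
    and T :: "(real^4 \<Rightarrow> complex) matter"
    and n :: nat
    and \<mu> \<nu> :: "nat \<Rightarrow> 4"
    and p :: "nat \<Rightarrow> real^4"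
    and Q :: "real^4"
  assumes symmetric: "\<And>x. transpose (h x) = h x"
    and differentiable: "\<And>x. h differentiable (at x)"
    and small: "\<And>x. \<bar>\<kappa>\<bar> * Max (cmod ` EW (h x)) < 1"
    and matter: "\<And>f. f \<in> set_matter T \<Longrightarrow> \<exists>A. is_transform f A"
  shows "(\<forall>x. (\<lambda>m. order_part (\<lambda>k. lagrangian k T h x) m \<kappa>) sums lagrangian \<kappa> T h x) \<and>
    feynman_rule \<kappa> T n \<mu> \<nu> p Q =
      \<i> / 2 ^ n * (\<Sum>X\<in>Pow {1..n}. \<Sum>s\<in>{s. s permutes {1..n}}.
        unsym_vertex \<kappa> (map_matter (\<lambda>f. fourier f Q) T) n
          (swap_idx X \<mu> \<nu> \<circ> s) (swap_idx X \<nu> \<mu> \<circ> s) (p \<circ> s))"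
proof (intro conjI allI)
  fix x
  \<comment> \<open>The eigenvalue bound places the given coupling inside a zero-free disc, so the
    series may be evaluated there and not only near 0.\<close>
  obtain R where R: "R > \<bar>\<kappa>\<bar>" "regular R (\<eta> ** h x)" using small_imp_regular[OF small] by blast
  then have R0: "R > 0" by simp
  note series = lagrangian_series[OF R(2) R0 differentiable symmetric, of T]
  show "(\<lambda>m. order_part (\<lambda>k. lagrangian k T h x) m \<kappa>) sums lagrangian \<kappa> T h x"
    unfolding order_part_powser_on[OF series R0] using series R(1) by (simp add: powser_on_def)
next
  define g where "g w = unsym_vertex \<kappa> (map_matter (\<lambda>f. fourier f Q) T) n
    (\<lambda>j. letter_index \<mu> \<nu> (w j)) (\<lambda>j. letter_index \<nu> \<mu> (w j)) (\<lambda>j. p (fst (w j)))" for w :: "nat \<Rightarrow> nat \<times> bool"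
  define K where "K w = 1 / 2 ^ n * unsym_vertex \<kappa> (map_matter (\<lambda>f. fourier f
      (Q + (\<Sum>i=1..n. p i) - (\<Sum>j\<in>{1..n}. p (fst (w j))))) T) n
    (\<lambda>j. letter_index \<mu> \<nu> (w j)) (\<lambda>j. letter_index \<nu> \<mu> (w j)) (\<lambda>j. p (fst (w j)))" for w :: "nat \<Rightarrow> nat \<times> bool"
  have "feynman_rule \<kappa> T n \<mu> \<nu> p Q =
      \<i> * (\<Sum>w\<in>{w\<in>{1..n} \<rightarrow>\<^sub>E {1..n} \<times> UNIV. bij_betw (\<lambda>j. fst (w j)) {1..n} {1..n}}. K w)"
    unfolding feynman_rule_def
  proof (rule arg_cong[where f = "(*) \<i>"], rule func_derivs_multilinear)
    show "finite ({1..n} \<rightarrow>\<^sub>E {1..n} \<times> (UNIV :: bool set))" by (intro finite_PiE) auto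
    show "fst (w j) \<in> {1..n}" if "w \<in> {1..n} \<rightarrow>\<^sub>E {1..n} \<times> (UNIV :: bool set)" "j \<in> {1..n}" for w j
      using PiE_mem[OF that] by auto
    show "fourier (\<lambda>x. order_part (\<lambda>k. lagrangian k T
        (graviton_field (\<lambda>q. \<Sum>i\<in>{1..n}. t i *\<^sub>R graviton_mode (\<mu> i) (\<nu> i) (p i) q)) x) n \<kappa>) (Q + (\<Sum>i=1..n. p i)) =
      (\<Sum>w\<in>{1..n} \<rightarrow>\<^sub>E {1..n} \<times> UNIV. of_real (\<Prod>j\<in>{1..n}. t (fst (w j))) * K w)" for t
      unfolding K_def by (rule fourier_order_part[OF matter])
  qed
  also have "(\<Sum>w\<in>{w\<in>{1..n} \<rightarrow>\<^sub>E {1..n} \<times> UNIV. bij_betw (\<lambda>j. fst (w j)) {1..n} {1..n}}. K w) =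
      (\<Sum>w\<in>{w\<in>{1..n} \<rightarrow>\<^sub>E {1..n} \<times> UNIV. bij_betw (\<lambda>j. fst (w j)) {1..n} {1..n}}. 1 / 2 ^ n * g w)"
  proof (rule sum.cong[OF refl])
    fix w :: "nat \<Rightarrow> nat \<times> bool"
    assume "w \<in> {w\<in>{1..n} \<rightarrow>\<^sub>E {1..n} \<times> UNIV. bij_betw (\<lambda>j. fst (w j)) {1..n} {1..n}}"
    \<comment> \<open>A bijective word carries the sum of all graviton momenta, so the shift cancels
      and every matter transform is evaluated at \<open>Q\<close>.\<close>
    then have "(\<Sum>j\<in>{1..n}. p (fst (w j))) = (\<Sum>i=1..n. p i)"
      by (intro sum.reindex_bij_betw) simp
    then show "K w = 1 / 2 ^ n * g w" by (simp add: K_def g_def)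
  qed
  also have "\<dots> = 1 / 2 ^ n * (\<Sum>X\<in>Pow {1..n}. \<Sum>s\<in>{s. s permutes {1..n}}. g (\<lambda>j. (s j, s j \<in> X)))"
  proof -
    have "local_on {1..n} g"
      unfolding g_def[abs_def] using local_unsym_vertex[of n \<kappa> _ "letter_index \<mu> \<nu>" "letter_index \<nu> \<mu>" "\<lambda>l. p (fst l)"] .
    from sum_bijective_words[OF this] show ?thesis by (simp only: sum_distrib_left[symmetric])
  qed
  also have "\<i> * \<dots> = \<i> / 2 ^ n * (\<Sum>X\<in>Pow {1..n}. \<Sum>s\<in>{s. s permutes {1..n}}.
        unsym_vertex \<kappa> (map_matter (\<lambda>f. fourier f Q) T) n
          (swap_idx X \<mu> \<nu> \<circ> s) (swap_idx X \<nu> \<mu> \<circ> s) (p \<circ> s))"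
    by (simp add: g_def letter_index_def swap_idx_def o_def cong: if_cong)
  finally show "feynman_rule \<kappa> T n \<mu> \<nu> p Q =
      \<i> / 2 ^ n * (\<Sum>X\<in>Pow {1..n}. \<Sum>s\<in>{s. s permutes {1..n}}.
        unsym_vertex \<kappa> (map_matter (\<lambda>f. fourier f Q) T) n
          (swap_idx X \<mu> \<nu> \<circ> s) (swap_idx X \<nu> \<mu> \<circ> s) (p \<circ> s))" .
qed

end
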